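(* Let $\kappa$ be a regular uncountable cardinal and suppose that $\mathrm{P}_\xi(\kappa,2,\sqsubseteq,\kappa)$ holds for some ordinal $\xi\le\kappa$. Then there is a family $\langle \mathbf L_\zeta\mid \zeta<2^\kappa\rangle$ of linear orders such that each $\mathbf L_\zeta$ has size $\kappa$, is non-$\sigma$-scattered and is minimal with respect to being non-$\sigma$-scattered, and for all distinct $\zeta,\zeta'<2^\kappa$, $\mathbf L_\zeta$ does not embed into $\mathbf L_{\zeta'}$. Moreover, if $\xi<\kappa$, then the members of the family are all $\kappa$-Countryman lines.
   Context: For a set of ordinals $C$, $\mathrm{acc}(C):=\{\alpha\in C\mid \sup(C\cap\alpha)=\alpha>0\}$ and $\mathrm{nacc}(C):=C\setminus\mathrm{acc}(C)$; in particular $\mathrm{acc}(\kappa)$ is the set of nonzero limit ordinals below $\kappa$. $\mathrm{P}^-_\xi(\kappa,2,\sqsubseteq,\kappa)$ asserts the existence of a sequence $\langle C_\alpha\mid\alpha<\kappa\rangle$ of sets of ordinals such that: (1) for every $\alpha\in\mathrm{acc}(\kappa)$, $C_\alpha$ is a club in $\alpha$ of order-type $\le\xi$; (2) for every $\alpha<\kappa$ and every $\bar\alpha\in\mathrm{acc}(C_\alpha)$, $C_{\bar\alpha}=C_\alpha\cap\bar\alpha$; (3) for every sequence $\langle B_i\mid i<\kappa\rangle$ of cofinal subsets of $\kappa$, there are stationarily many $\alpha<\kappa$ such that $\sup(\mathrm{nacc}(C_\alpha)\cap B_i)=\alpha$ for every $i<\alpha$. $\diamondsuit(\kappa)$ asserts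 the existence of a sequence $\langle A_\alpha\mid\alpha<\kappa\rangle$ with $A_\alpha\subseteq\alpha$ such that for every $A\subseteq\kappa$ the set $\{\alpha<\kappa\mid A\cap\alpha=A_\alpha\}$ is stationary in $\kappa$. $\mathrm{P}_\xi(\kappa,2,\sqsubseteq,\kappa)$ is the conjunction of $\mathrm{P}^-_\xi(\kappa,2,\sqsubseteq,\kappa)$ and $\diamondsuit(\kappa)$. An embedding of linear orders is a (strictly) order-preserving function. A linear order is scattered if the rational line $(\mathbb Q,<)$ does not embed into it; it is $\sigma$-scattered if it is a union of countably many scattered suborders. A non-$\sigma$-scattered linear order $(L,<_L)$ is minimal with respect to being non-$\sigma$-scattered if for every $X\subseteq L$ such that $(X,<_L)$ is non-$\sigma$-scattered, there is an embedding of $(L,<_L)$ into $(X,<_L)$. For $\kappa=\lambda^+$ with $\lambda$ an infinite cardinal, a linear order $(C,<_C)$ is a $\kappa$-Countryman line if $|C|=\lambda^+$ and $C\times C$ with the coordinatewise order ($(a,b)\le(c,d)$ iff $a\le_C c$ and $b\le_C d$) is a union of $\lambda$-many chains. (If $\xi<\kappa$, the hypothesis implies that $\kappa$ is a successor cardinal.) *)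

theory Defs
  imports Complex_Main "HOL-Library.Lub_Glb"
begin

unbundle cardinal_syntax

(* A cardinal kappa is given as a type 'k of class wellorder, whose order relation
   le_rel is (by assumption, where needed) a Card_order. The ordinals below kappa are
   the elements of 'k, an ordinal alpha being identified with {..<alpha}; kappa itself
   is UNIV as a set of ordinals and le_rel as an order type. *)

definition le_rel :: "'a::ord rel" where
  "le_rel = {(x, y). x \<le> y}"


section \<open>Ordinals, clubs and stationary sets\<close>

(* isLub UNIV A a says that sup A exists below kappa and equals a, with sup {} = 0. *)

definition acc :: "'k::wellorder set \<Rightarrow> 'k set" where
  "acc C = {\<alpha> \<in> C. isLub UNIV (C \<inter> {..<\<alpha>}) \<alpha> \<and> (\<exists>\<beta>. \<beta> < \<alpha>)}"

definition nacc :: "'k::wellorder set \<Rightarrow> 'k set" where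
  "nacc C = C - acc C"

definition club_below :: "'k::wellorder \<Rightarrow> 'k set \<Rightarrow> bool" where
  "club_below \<alpha> C \<longleftrightarrow>
     C \<subseteq> {..<\<alpha>} \<and> isLub UNIV C \<alpha> \<and>
     (\<forall>\<beta><\<alpha>. isLub UNIV (C \<inter> {..<\<beta>}) \<beta> \<and> (\<exists>\<gamma>. \<gamma> < \<beta>) \<longrightarrow> \<beta> \<in> C)"

definition club :: "'k::wellorder set \<Rightarrow> bool" where
  "club D \<longleftrightarrow>
     cofinal D le_rel \<and>
     (\<forall>\<beta>. isLub UNIV (D \<inter> {..<\<beta>}) \<beta> \<and> (\<exists>\<gamma>. \<gamma> < \<beta>) \<longrightarrow> \<beta> \<in> D)"

definition stationary :: "'k::wellorder set \<Rightarrow> bool" where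
  "stationary S \<longleftrightarrow> (\<forall>D. club D \<longrightarrow> S \<inter> D \<noteq> {})"


section \<open>The proxy principle and diamond\<close>

(* proxy_minus xi TYPE('k) is P^-_xi(kappa, 2, sqsubseteq, kappa). An ordinal xi that
   need not lie below kappa is represented by an arbitrary well-order. *)

definition proxy_minus :: "'x rel \<Rightarrow> 'k::wellorder itself \<Rightarrow> bool" where
  "proxy_minus \<xi> _ \<longleftrightarrow>
     (\<exists>C :: 'k \<Rightarrow> 'k set.
        (\<forall>\<alpha> \<in> acc UNIV. club_below \<alpha> (C \<alpha>) \<and> Restr le_rel (C \<alpha>) \<le>o \<xi>) \<and>
        (\<forall>\<alpha>. \<forall>\<alpha>' \<in> acc (C \<alpha>). C \<alpha>' = C \<alpha> \<inter> {..<\<alpha>'}) \<and>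
        (\<forall>B :: 'k \<Rightarrow> 'k set.
           (\<forall>i. cofinal (B i) le_rel) \<longrightarrow>
           stationary {\<alpha>. \<forall>i<\<alpha>. isLub UNIV (nacc (C \<alpha>) \<inter> B i) \<alpha>}))"

definition diamond :: "'k::wellorder itself \<Rightarrow> bool" where
  "diamond _ \<longleftrightarrow>
     (\<exists>A :: 'k \<Rightarrow> 'k set.
        (\<forall>\<alpha>. A \<alpha> \<subseteq> {..<\<alpha>}) \<and>
        (\<forall>X. stationary {\<alpha>. X \<inter> {..<\<alpha>} = A \<alpha>}))"

definition proxy :: "'x rel \<Rightarrow> 'k::wellorder itself \<Rightarrow> bool" where
  "proxy \<xi> T \<longleftrightarrow> proxy_minus \<xi> T \<and> diamond T"


section \<open>Linear orders\<close>

(* A linear order is a relation r with Linear_order r; it is reflexive, and its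
   underlying set is Field r. *)

definition lin_embeds :: "'a rel \<Rightarrow> 'b rel \<Rightarrow> bool" where
  "lin_embeds r s \<longleftrightarrow>
     (\<exists>f. f ` Field r \<subseteq> Field s \<and>
          (\<forall>x y. (x, y) \<in> r \<and> x \<noteq> y \<longrightarrow> (f x, f y) \<in> s \<and> f x \<noteq> f y))"

definition scattered :: "'a rel \<Rightarrow> bool" where
  "scattered r \<longleftrightarrow> \<not> lin_embeds (le_rel :: rat rel) r"

definition sigma_scattered :: "'a rel \<Rightarrow> bool" where
  "sigma_scattered r \<longleftrightarrow>
     (\<exists>S :: nat \<Rightarrow> 'a set. Field r = (\<Union>n. S n) \<and> (\<forall>n. scattered (Restr r (S n))))"

definition minimal_non_sigma_scattered :: "'a rel \<Rightarrow> bool" where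
  "minimal_non_sigma_scattered r \<longleftrightarrow>
     \<not> sigma_scattered r \<and>
     (\<forall>X \<subseteq> Field r. \<not> sigma_scattered (Restr r X) \<longrightarrow> lin_embeds r (Restr r X))"

definition coordinatewise :: "'a rel \<Rightarrow> ('a \<times> 'a) rel" where
  "coordinatewise r = {((a, b), (c, d)). (a, c) \<in> r \<and> (b, d) \<in> r}"

definition countryman :: "'k rel \<Rightarrow> 'a rel \<Rightarrow> bool" where
  "countryman \<kappa> r \<longleftrightarrow>
     Linear_order r \<and>
     (\<exists>\<mu> :: 'k rel. Cinfinite \<mu> \<and> \<kappa> =o cardSuc \<mu> \<and> |Field r| =o cardSuc \<mu> \<and>
        (\<exists>K :: 'k \<Rightarrow> ('a \<times> 'a) set.
           (\<forall>i \<in> Field \<mu>. K i \<in> Chains (coordinatewise r)) \<and>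
           Field r \<times> Field r = (\<Union>i \<in> Field \<mu>. K i)))"

(* The type 'k set has exactly 2^kappa elements, so it serves as the index set of a
   family of length 2^kappa. *)

lemma card_of_index_type:
  assumes "Card_order (le_rel :: 'k::wellorder rel)"
  shows "|UNIV :: 'k set set| =o ctwo ^c (le_rel :: 'k rel)"
proof -
  have "Field (le_rel :: 'k rel) = UNIV"
    by (auto simp: le_rel_def Field_def)
  then have eq: "|UNIV :: 'k set| =o (le_rel :: 'k rel)"
    using card_of_Field_ordIso[OF assms] by simp
  have "|UNIV :: 'k set set| =o ctwo ^c |UNIV :: 'k set|"
    using card_of_Pow_Func[of "UNIV :: 'k set"]
    by (simp add: cexp_def ctwo_def Field_card_of)
  also have "ctwo ^c |UNIV :: 'k set| =o ctwo ^c (le_rel :: 'k rel)"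
    by (rule cexp_cong2[OF eq ctwo_Cnotzero[THEN conjunct2] card_of_Card_order])
  finally show ?thesis .
qed

end

theory Submission
  imports Defs "HOL-Library.Product_Lexorder" "HOL-Library.Countable_Set"
begin

text \<open>
  The lines consist of nodes of one tree of functions from \<^term>\<open>{..<a} \<times> (UNIV :: nat set)\<close>, for
  \<^term>\<open>a\<close> below \<open>\<kappa>\<close>, to the integers, any two of which differ only finitely often. Each integer has a
  weight \<open>\<ge> -1\<close>, and the depth of a node is the running sum of the weights, with the lower limit taken
  at limits. The branch \<open>e d\<close> is built by recursion along \<open>C d\<close>, so that its depth is nonnegative and
  returns to \<open>0\<close> once in each interval of \<open>C d\<close>; within these bounds each interval tries to meet the
  set guessed by diamond. As diamond guesses correctly at many endpoints of intervals, every set of nodes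
  that is dense with respect to extensions which do not go below their starting depth (\<open>nice\<close>
  extensions) is met on the way to every node of some level. Consequently the predecessors of every
  unbounded set of nodes contain all nice extensions of some node (sealing).

  The line \<open>L A\<close> orders an antichain with one node inside every block \<open>a\<close> lexicographically, reversing
  the order of values at the heights in \<open>A\<close>. Bounded subsets are \<open>\<sigma>\<close>-scattered as only finitely many
  values vary. An unbounded subset contains the predecessors above some \<open>w\<close>; the line embeds there by
  shifting heights above \<open>w\<close> and then raising the value wherever the depth would otherwise sink below
  that of \<open>w\<close>, an order preserving change. An embedding of \<open>L A\<close> into \<open>L B\<close> must agree with the
  identity on long stretches, which by sealing is impossible if \<open>A\<close> and \<open>B\<close> differ unboundedly often.
  Finally, if all \<open>C d\<close> are shorter than \<open>\<kappa>\<close>, their order types yield a colouring of the tree with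
  fewer than \<open>\<kappa>\<close> colours which is injective on branches, and the colours at the finitely many
  positions where \<open>x a\<close> and \<open>x b\<close> differ divide the pairs \<open>(a, b)\<close> into chains.
\<close>

section \<open>Weights and depth\<close>

text \<open>Sealing is limited to nice extensions as a compromise. If it gave all extensions of some
  node, some \<open>x a\<close> would properly extend another, so no antichain could have a node in
  every block. Depth leaves room for both: \<open>x a\<close> ends where the depth has first turned
  negative, while every node still has nice extensions to all heights. Niceness compares with the
  starting depth only, so it survives finite changes further down; this makes it compatible with
  coherence.

  The choice on an interval of \<open>C d\<close> is made once and can serve only one finite
  modification of \<open>e d\<close>. The guess \<open>N b\<close> therefore names this modification
  together with the set to be met, and the sets to be hit by \<open>nacc (C d)\<close> are indexed
  by modifications. For suitable \<open>d\<close>, all modifications below \<open>d\<close> have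
  codes below \<open>d\<close>, so every node of level \<open>d\<close> is served.

  The weight cannot be monotone in the value: its lowest class would be a half-line of integers,
  which a strictly increasing map cannot send into the next class, bounded on that side. It is read
  off instead from the number of trailing digits 1 in base 3, and \<open>raise\<close> appends one
  such digit.\<close>

text \<open>All that matters about \<open>wt\<close> is that it is at least \<open>-1\<close>, that it takes the value \<open>-1\<close>, and that
  some strictly increasing map (\<open>raise\<close>) increases it by one.\<close>

function marks :: "int \<Rightarrow> nat" where
  "marks z = (if z mod 3 = 1 then Suc (marks ((z - 1) div 3)) else 0)"
  by pat_completeness auto
termination
proof (relation "measure (\<lambda>z. nat \<bar>z\<bar>)")
  fix z :: int
  assume "z mod 3 = 1"
  then obtain k where "z = 3 * k + 1" by (metis mult_div_mod_eq)
  moreover have "\<bar>k\<bar> < \<bar>3 * k + 1\<bar>" by linarith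
  ultimately show "((z - 1) div 3, z) \<in> measure (\<lambda>z. nat \<bar>z\<bar>)" by simp
qed simp

declare marks.simps [simp del]

definition wt :: "int \<Rightarrow> int" where
  "wt z = int (marks z) - 1"

definition raise :: "int \<Rightarrow> int" where
  "raise z = 3 * z + 1"

lemma wt_raise [simp]: "wt (raise z) = wt z + 1"
proof -
  have "(3 * z + 1) mod 3 = 1" by presburger
  then show ?thesis
    unfolding wt_def raise_def by (subst marks.simps) simp
qed

lemma wt_ge: "wt z \<ge> -1"
  by (simp add: wt_def)

lemma wt_0 [simp]: "wt 0 = -1"
  by (simp add: wt_def marks.simps[of 0])

lemma wt_1 [simp]: "wt 1 = 0"
  using wt_raise[of 0] by (simp add: raise_def)

lemma wt_4 [simp]: "wt 4 = 1"
  using wt_raise[of 1] by (simp add: raise_def)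

lemma raise_less_iff [simp]: "raise y < raise z \<longleftrightarrow> y < z"
  unfolding raise_def by linarith

lemma wt_unbounded: "\<exists>v. wt v \<ge> n"
proof -
  have "wt ((raise ^^ k) 0) = int k - 1" for k
    by (induction k) auto
  from this[of "nat (n + 1)"] have "wt ((raise ^^ nat (n + 1)) 0) \<ge> n" by simp
  then show ?thesis ..
qed

text \<open>The lower limit of \<open>D z + wt (t z)\<close> as \<open>z\<close> tends to
  \<open>p\<close>. The values are integers, so a finite lower limit \<open>d\<close> is reached:
  eventually nothing is below \<open>d\<close>, and cofinally often nothing is gained above
  it.\<close>

definition lev :: "('p::wellorder \<Rightarrow> int) \<Rightarrow> ('p \<Rightarrow> int) \<Rightarrow> 'p \<Rightarrow> int \<Rightarrow> bool" where
  "lev t D p d \<longleftrightarrow>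
     (\<exists>a<p. \<forall>z. a \<le> z \<and> z < p \<longrightarrow> d \<le> D z + wt (t z)) \<and>
     (\<forall>a<p. \<exists>z. a \<le> z \<and> z < p \<and> D z + wt (t z) \<le> d)"

text \<open>At every \<^term>\<open>p\<close>, successor or limit, the depth is the lower limit of the depths reached
  just after the positions below \<^term>\<open>p\<close>; \<open>ok t q\<close> says that these lower limits are
  finite up to \<^term>\<open>q\<close> (otherwise \<open>dep\<close> is junk).\<close>

definition dep :: "('p::wellorder \<Rightarrow> int) \<Rightarrow> 'p \<Rightarrow> int" where
  "dep t = wfrec {(x, y). x < y} (\<lambda>D p. if \<exists>a. a < p then THE d. lev t D p d else 0)"

definition ok :: "('p::wellorder \<Rightarrow> int) \<Rightarrow> 'p \<Rightarrow> bool" where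
  "ok t q \<longleftrightarrow> (\<forall>p\<le>q. (\<exists>a. a < p) \<longrightarrow> lev t (dep t) p (dep t p))"

lemma lev_cong:
  assumes "\<And>z. z < p \<Longrightarrow> t z = t' z" "\<And>z. z < p \<Longrightarrow> D z = D' z"
  shows "lev t D p d \<longleftrightarrow> lev t' D' p d"
  unfolding lev_def using assms by (metis (no_types, lifting))

lemma lev_unique:
  assumes "lev t D p d" "lev t D p d'"
  shows "d = d'"
proof -
  have "d \<le> d'" if d: "lev t D p d" and d': "lev t D p d'" for d d'
  proof -
    obtain a where a: "a < p" "\<forall>z. a \<le> z \<and> z < p \<longrightarrow> d \<le> D z + wt (t z)"
      using d unfolding lev_def by blast
    then obtain z where "a \<le> z" "z < p" "D z + wt (t z) \<le> d'"
      using d' unfolding lev_def by blast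
    with a show ?thesis by force
  qed
  with assms show ?thesis by (meson order_antisym)
qed

lemma wf_less_rel: "wf {(x, y). x < (y::'p::wellorder)}"
  by (rule wf)

lemma dep_unfold:
  "dep t p = (if \<exists>a. a < p then THE d. lev t (dep t) p d else 0)"
proof -
  let ?H = "\<lambda>D p. if \<exists>a. a < p then THE d. lev t D p d else (0::int)"
  have "dep t p = ?H (cut (dep t) {(x, y). x < y} p) p"
    unfolding dep_def by (rule wfrec[OF wf_less_rel])
  also have "\<dots> = ?H (dep t) p"
  proof -
    have "lev t (cut (dep t) {(x, y). x < y} p) p = lev t (dep t) p"
      by (intro ext lev_cong) (auto simp: cut_apply)
    then show ?thesis by (simp only:)
  qed
  finally show ?thesis .
qed

lemma dep_eqI:
  assumes "a < p" "lev t (dep t) p d"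
  shows "dep t p = d"
proof -
  have "(THE d. lev t (dep t) p d) = d"
    using assms(2) lev_unique by (metis the_equality)
  then show ?thesis using assms(1) by (subst dep_unfold) auto
qed

lemma dep_cong:
  assumes "\<And>z. z < p \<Longrightarrow> t z = t' z"
  shows "dep t p = dep t' p"
  using assms
proof (induction p rule: less_induct)
  case (less p)
  have "lev t (dep t) p = lev t' (dep t') p"
  proof (intro ext lev_cong)
    fix z assume "z < p"
    then show "t z = t' z" using less.prems by blast
    show "dep t z = dep t' z"
      using \<open>z < p\<close> by (intro less.IH less.prems) auto
  qed
  then show ?case by (simp only: dep_unfold[of t p] dep_unfold[of t' p])
qed

lemma ok_cong:
  assumes "\<And>z. z < q \<Longrightarrow> t z = t' z"
  shows "ok t q \<longleftrightarrow> ok t' q"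
proof -
  have "lev t (dep t) p (dep t p) \<longleftrightarrow> lev t' (dep t') p (dep t' p)" if "p \<le> q" for p
  proof -
    have 1: "\<And>z. z < p \<Longrightarrow> t z = t' z" using assms that by auto
    have 2: "dep t z = dep t' z" if "z \<le> p" for z
      using 1 that by (intro dep_cong) auto
    show ?thesis
      unfolding 2[OF order_refl]
      by (rule lev_cong) (auto simp: 1 2)
  qed
  then show ?thesis unfolding ok_def by blast
qed

lemma ok_mono: "ok t q \<Longrightarrow> p \<le> q \<Longrightarrow> ok t p"
  unfolding ok_def by auto

lemma okD: "ok t q \<Longrightarrow> p \<le> q \<Longrightarrow> a < p \<Longrightarrow> lev t (dep t) p (dep t p)"
  unfolding ok_def by blast

lemma okI:
  assumes "\<And>p. p < q \<Longrightarrow> ok t p" "a < q" "lev t (dep t) q d"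
  shows "ok t q"
  unfolding ok_def
proof (intro allI impI)
  fix p assume p: "p \<le> q" "\<exists>a. a < p"
  show "lev t (dep t) p (dep t p)"
  proof (cases "p < q")
    case True
    then show ?thesis using assms(1)[OF True] p(2) unfolding ok_def by blast
  next
    case False
    with p have "p = q" by simp
    with p assms show ?thesis using dep_eqI by metis
  qed
qed

text \<open>Past the last changed position below \<open>p\<close> the two running sums differ by a
  constant, and a lower limit commutes with adding a constant. This is what makes depth meaningful
  for all nodes of a coherent tree at once.\<close>

lemma dep_finite_change:
  assumes "finite M" "ok t q" "\<And>z. z < q \<Longrightarrow> z \<notin> M \<Longrightarrow> s z = t z"
  shows "ok s q \<and> (\<forall>p\<le>q. dep s p = dep t p + (\<Sum>z\<in>{z\<in>M. z < p}. wt (s z) - wt (t z)))"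
proof -
  define D where "D p = dep t p + (\<Sum>z\<in>{z\<in>M. z < p}. wt (s z) - wt (t z))" for p
  have main: "dep s p = D p \<and> ok s p" if "p \<le> q" for p
    using that
  proof (induction p rule: less_induct)
    case (less p)
    show ?case
    proof (cases "\<exists>a. a < p")
      case False
      then have "{z\<in>M. z < p} = {}" by auto
      moreover have "dep s p = 0" "dep t p = 0"
        using False by (auto simp: dep_unfold)
      moreover have "ok s p" unfolding ok_def using False by (metis leD leI le_less_trans)
      ultimately show ?thesis by (simp only: D_def) simp
    next
      case True
      then obtain a where a: "a < p" by blast
      obtain b where b: "b < p" "\<And>z. z \<in> M \<Longrightarrow> z < p \<Longrightarrow> z \<le> b"
      proof -
        define b where "b = Max (insert a {z\<in>M. z < p})"
        have "finite (insert a {z\<in>M. z < p})" using assms(1) by simp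
        then have "b \<in> insert a {z\<in>M. z < p}" "\<And>z. z \<in> insert a {z\<in>M. z < p} \<Longrightarrow> z \<le> b"
          unfolding b_def by (rule Max_in[OF _ insert_not_empty], rule Max_ge)
        then have "b = a \<or> b \<in> M \<and> b < p" "\<And>z. z \<in> M \<Longrightarrow> z < p \<Longrightarrow> z \<le> b" by auto
        with a show ?thesis by (intro that[of b]) auto
      qed
      define K where "K = (\<Sum>z\<in>{z\<in>M. z < p}. wt (s z) - wt (t z))"
      have eq: "dep s z + wt (s z) = dep t z + wt (t z) + K" if "b \<le> z" "z < p" for z
      proof -
        have d: "dep s z = D z" using less that by auto
        have "K = (\<Sum>z\<in>{y\<in>M. y < z}. wt (s z) - wt (t z)) + (if z \<in> M then wt (s z) - wt (t z) else 0)"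
        proof (cases "z \<in> M")
          case True
          have "{y\<in>M. y < p} = insert z {y\<in>M. y < z}"
          proof (intro set_eqI iffI)
            fix y assume "y \<in> {y\<in>M. y < p}"
            then have "y \<in> M" "y \<le> z" using b(2)[of y] that by auto
            then show "y \<in> insert z {y\<in>M. y < z}" by auto
          qed (use True that in auto)
          then show ?thesis unfolding K_def using assms(1) True by simp
        next
          case False
          then have "{y\<in>M. y < p} = {y\<in>M. y < z}"
          proof (intro set_eqI iffI)
            fix y assume "y \<in> {y\<in>M. y < p}"
            then have "y \<in> M" "y \<le> z" using b(2)[of y] that by auto
            with False show "y \<in> {y\<in>M. y < z}" by (cases "y = z") auto
          qed (use that in auto)
          then show ?thesis unfolding K_def using False by simp
        qed
        moreover have "z \<notin> M \<Longrightarrow> s z = t z" using assms(3) that less.prems by auto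
        ultimately show ?thesis by (cases "z \<in> M") (auto simp: d D_def)
      qed
      have L: "lev t (dep t) p (dep t p)"
        using assms(2) less.prems a by (rule okD)
      have "lev s (dep s) p (D p)"
      proof -
        obtain a1 where a1: "a1 < p" "\<forall>z. a1 \<le> z \<and> z < p \<longrightarrow> dep t p \<le> dep t z + wt (t z)"
          using L unfolding lev_def by blast
        have "\<forall>z. max a1 b \<le> z \<and> z < p \<longrightarrow> D p \<le> dep s z + wt (s z)"
        proof (intro allI impI)
          fix z assume z: "max a1 b \<le> z \<and> z < p"
          then have "dep t p \<le> dep t z + wt (t z)" using a1 by simp
          moreover have "D p = dep t p + K" by (simp only: D_def K_def)
          ultimately show "D p \<le> dep s z + wt (s z)" using eq[of z] z by simp
        qed
        moreover have "max a1 b < p" using a1 b by simp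
        moreover have "\<exists>z. c \<le> z \<and> z < p \<and> dep s z + wt (s z) \<le> D p" if "c < p" for c
        proof -
          have "max c b < p" using that b by simp
          then obtain z where "max c b \<le> z" "z < p" "dep t z + wt (t z) \<le> dep t p"
            using L unfolding lev_def by blast
          moreover have "D p = dep t p + K" by (simp only: D_def K_def)
          ultimately have "c \<le> z \<and> z < p \<and> dep s z + wt (s z) \<le> D p" using eq[of z] by simp
          then show ?thesis by blast
        qed
        ultimately show ?thesis unfolding lev_def by blast
      qed
      then have L': "lev s (dep s) p (D p)" .
      have "ok s y" if "y < p" for y using less that by auto
      then have "ok s p" using a L' by (rule okI)
      with dep_eqI[OF a L'] show ?thesis by blast
    qed
  qed
  then show ?thesis by (auto simp: D_def)
qed

text \<open>The lower limit bounds the sums after all positions from some \<open>b\<close> on. A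
  depth at a later \<open>p\<close> is itself approached by such sums from below \<open>p\<close>,
  so it inherits the bound.\<close>

lemma dep_eventually_ge:
  assumes "ok t q" "a < q"
  shows "\<exists>a<q. \<forall>p. a < p \<and> p \<le> q \<longrightarrow> dep t q \<le> dep t p"
proof -
  obtain b where b: "b < q" "\<forall>z. b \<le> z \<and> z < q \<longrightarrow> dep t q \<le> dep t z + wt (t z)"
    using okD[OF assms(1) order_refl assms(2)] unfolding lev_def by blast
  have "dep t q \<le> dep t p" if p: "b < p" "p \<le> q" for p
  proof -
    obtain z where "b \<le> z" "z < p" "dep t z + wt (t z) \<le> dep t p"
      using okD[OF assms(1) p(2,1)] p(1) unfolding lev_def by blast
    with b p show ?thesis by force
  qed
  with b show ?thesis by blast
qed

text \<open>Close to \<open>q\<close> the depth at \<open>q\<close> is a bound; what remains ends at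
  some \<open>a < q\<close> and is covered by induction.\<close>

lemma dep_bounded_below:
  assumes "ok t q"
  shows "\<exists>B. \<forall>p\<le>q. B \<le> dep t p"
  using assms
proof (induction q rule: less_induct)
  case (less q)
  show ?case
  proof (cases "\<exists>a. a < q")
    case False
    then have "\<forall>p\<le>q. p = q" by (metis le_less)
    then show ?thesis by auto
  next
    case True
    then obtain a where a: "a < q" "\<forall>p. a < p \<and> p \<le> q \<longrightarrow> dep t q \<le> dep t p"
      using dep_eventually_ge[OF less.prems] by blast
    obtain B where "\<forall>p\<le>a. B \<le> dep t p"
      using less.IH[OF a(1)] ok_mono[OF less.prems] a(1) by (auto simp: less_imp_le)
    with a show ?thesis by (intro exI[of _ "min B (dep t q)"]) (metis linorder_not_less min.coboundedI1 min.coboundedI2)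
  qed
qed

lemma dep_tail_shift:
  assumes "finite {z. z < q \<and> s z \<noteq> t z}" "ok t q" "\<And>z. a \<le> z \<Longrightarrow> z < q \<Longrightarrow> s z = t z" "a \<le> p" "p \<le> q"
  shows "dep s p - dep t p = dep s a - dep t a"
proof -
  let ?M = "{z. z < q \<and> s z \<noteq> t z}"
  have "\<forall>p\<le>q. dep s p = dep t p + (\<Sum>z\<in>{z\<in>?M. z < p}. wt (s z) - wt (t z))"
    using dep_finite_change[OF assms(1,2), of s] by auto
  moreover have "{z\<in>?M. z < p} = {z\<in>?M. z < a}"
  proof -
    have "z < a" if "z < q" "s z \<noteq> t z" for z
      using assms(3)[OF _ that(1)] that(2) by (meson not_le)
    then show ?thesis using assms(4) by (auto intro: less_le_trans)
  qed
  ultimately show ?thesis using assms(4,5) by (metis (no_types, lifting) add_diff_cancel_left' order_trans)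
qed

subsection \<open>Positions\<close>

lemma pos_less_Suc: "p < (a, Suc n) \<longleftrightarrow> p \<le> (a, n)"
  for p :: "'k::wellorder \<times> nat"
  by (cases p) auto

lemma pos_less_height: "p < (a, 0::nat) \<longleftrightarrow> fst p < a"
  for a :: "'k::wellorder"
  by (cases p) auto

lemma pos_height_le: "(a, 0::nat) \<le> p \<longleftrightarrow> a \<le> fst p"
  for a :: "'k::wellorder"
  by (cases p) auto

lemma lev_Suc:
  fixes t :: "'k::wellorder \<times> nat \<Rightarrow> int"
  shows "lev t D (a, Suc n) d \<longleftrightarrow> d = D (a, n) + wt (t (a, n))"
proof -
  have *: "(a, n) \<le> z \<and> z < (a, Suc n) \<longleftrightarrow> z = (a, n)" for z
    by (cases z) auto
  show ?thesis
  proof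
    assume L: "lev t D (a, Suc n) d"
    have "\<exists>z. (a, n) \<le> z \<and> z < (a, Suc n) \<and> D z + wt (t z) \<le> d"
      using L unfolding lev_def by (metis lessI less_prod_simp order_refl)
    then have "D (a, n) + wt (t (a, n)) \<le> d" using * by metis
    moreover have "d \<le> D (a, n) + wt (t (a, n))"
    proof -
      obtain b where "b < (a, Suc n)" "\<forall>z. b \<le> z \<and> z < (a, Suc n) \<longrightarrow> d \<le> D z + wt (t z)"
        using L unfolding lev_def by blast
      then show ?thesis by (simp only: pos_less_Suc) blast
    qed
    ultimately show "d = D (a, n) + wt (t (a, n))" by simp
  next
    assume d: "d = D (a, n) + wt (t (a, n))"
    have "\<forall>z. (a, n) \<le> z \<and> z < (a, Suc n) \<longrightarrow> d \<le> D z + wt (t z)"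
      using * d by simp
    moreover have "\<exists>z. y \<le> z \<and> z < (a, Suc n) \<and> D z + wt (t z) \<le> d" if "y < (a, Suc n)" for y
      using that d by (intro exI[of _ "(a, n)"]) (simp add: pos_less_Suc del: less_prod_simp)
    moreover have "(a, n) < (a, Suc n)" by simp
    ultimately show "lev t D (a, Suc n) d"
      unfolding lev_def by blast
  qed
qed

lemma dep_Suc:
  fixes t :: "'k::wellorder \<times> nat \<Rightarrow> int"
  shows "dep t (a, Suc n) = dep t (a, n) + wt (t (a, n))"
  by (rule dep_eqI[of "(a, n)"]) (auto simp: lev_Suc)

lemma ok_Suc:
  fixes t :: "'k::wellorder \<times> nat \<Rightarrow> int"
  assumes "ok t (a, n)"
  shows "ok t (a, Suc n)"
proof (rule okI[where a = "(a, n)"])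
  show "ok t p" if "p < (a, Suc n)" for p
    using that ok_mono[OF assms] by (simp only: pos_less_Suc)
  show "lev t (dep t) (a, Suc n) (dep t (a, n) + wt (t (a, n)))"
    by (simp only: lev_Suc)
qed simp

lemma ok_block:
  fixes t :: "'k::wellorder \<times> nat \<Rightarrow> int"
  assumes "ok t (a, 0)"
  shows "ok t (a, n)"
  by (induction n) (auto simp: assms ok_Suc)

lemma dep_ge_limit:
  assumes "ok t q" "a \<le> q" "\<And>z. a \<le> z \<Longrightarrow> z < q \<Longrightarrow> b \<le> dep t z + wt (t z)" "b \<le> dep t a"
  shows "b \<le> dep t q"
proof (cases "a < q")
  case True
  from okD[OF assms(1) order_refl True] obtain z where "a \<le> z" "z < q" "dep t z + wt (t z) \<le> dep t q"
    unfolding lev_def using True by blast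
  with assms(3) show ?thesis by force
qed (use assms in auto)

text \<open>Here \<open>b\<close> is the next height after \<open>a\<close>. Only the end of block
  \<open>a\<close> matters for the lower limit at \<open>(b, 0)\<close>, and there the depth no
  longer moves.\<close>

lemma dep_height_eq:
  fixes t :: "'k::wellorder \<times> nat \<Rightarrow> int"
  assumes ok: "ok t (a, 0)" and ab: "a < b" "\<And>y. y < b \<Longrightarrow> y \<le> a"
    and wt: "\<And>n. n \<ge> m \<Longrightarrow> wt (t (a, n)) = 0"
  shows "ok t (b, 0) \<and> dep t (b, 0) = dep t (a, m)"
proof -
  have c: "dep t (a, n) = dep t (a, m)" if "m \<le> n" for n
    using that by (induction n rule: dec_induct) (auto simp: dep_Suc wt)
  have lt: "fst p < a \<or> fst p = a" if "p < (b, 0::nat)" for p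
    using that ab(2)[of "fst p"] by (simp add: pos_less_height le_less)
  have L: "lev t (dep t) (b, 0) (dep t (a, m))"
    unfolding lev_def
  proof (intro conjI allI impI)
    show "\<exists>a'<(b, 0). \<forall>z. a' \<le> z \<and> z < (b, 0) \<longrightarrow> dep t (a, m) \<le> dep t z + wt (t z)"
    proof (intro exI[of _ "(a, m)"] conjI allI impI)
      fix z assume z: "(a, m) \<le> z \<and> z < (b, 0)"
      obtain x n where zx: "z = (x, n)" by (cases z)
      with z lt[of z] have "x = a" "m \<le> n" by auto
      then show "dep t (a, m) \<le> dep t z + wt (t z)" using c[of n] wt[of n] zx by simp
    qed (simp add: ab(1))
    fix y assume y: "y < (b, 0::nat)"
    obtain x n where yx: "y = (x, n)" by (cases y)
    have le: "x \<le> a" using lt[OF y] yx by auto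
    show "\<exists>z. y \<le> z \<and> z < (b, 0) \<and> dep t z + wt (t z) \<le> dep t (a, m)"
      by (rule exI[of _ "(a, max m n)"]) (simp add: le yx ab(1) c[of "max m n"] wt[of "max m n"])
  qed
  have okp: "ok t p" if p: "p < (b, 0)" for p
  proof (cases "fst p = a")
    case True
    then have "p = (a, snd p)" by (cases p) simp
    then show ?thesis using ok_block[OF ok, of "snd p"] by simp
  next
    case False
    with lt[OF p] have "p \<le> (a, 0)" by (cases p) auto
    then show ?thesis by (rule ok_mono[OF ok])
  qed
  have "(a, 0::nat) < (b, 0)" using ab(1) by simp
  from okI[OF okp this L] dep_eqI[OF this L] show ?thesis ..
qed

section \<open>Regular cardinals as well-ordered types\<close>

text \<open>\<open>small K I\<close> says that the size of \<^term>\<open>I\<close> is below the cofinality of the type \<^typ>\<open>'k\<close>.\<close>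

definition small :: "'k::wellorder itself \<Rightarrow> 'i set \<Rightarrow> bool" where
  "small K I \<longleftrightarrow> (\<forall>h :: 'i \<Rightarrow> 'k. \<exists>b. \<forall>i\<in>I. h i < b)"

definition unbdd :: "'k::wellorder set \<Rightarrow> bool" where
  "unbdd S \<longleftrightarrow> (\<forall>b. \<exists>a\<in>S. b < a)"

lemma smallD:
  fixes K :: "'k::wellorder itself" and h :: "'i \<Rightarrow> 'k"
  assumes "small K I"
  shows "\<exists>b. \<forall>i\<in>I. h i < b"
  using assms unfolding small_def by blast

lemma small_subset: "small K I \<Longrightarrow> J \<subseteq> I \<Longrightarrow> small K J"
  unfolding small_def by (meson subsetD)

lemma small_image:
  fixes K :: "'k::wellorder itself"
  assumes "small K I"
  shows "small K (f ` I)"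
  unfolding small_def
proof
  fix h :: "'b \<Rightarrow> 'k"
  obtain b where "\<forall>i\<in>I. (h \<circ> f) i < b" using assms unfolding small_def by blast
  then show "\<exists>b. \<forall>i\<in>f ` I. h i < b" by auto
qed

lemma small_UN:
  fixes K :: "'k::wellorder itself"
  assumes "small K I" "\<And>i. i \<in> I \<Longrightarrow> small K (A i)"
  shows "small K (\<Union>i\<in>I. A i)"
  unfolding small_def
proof
  fix h :: "'b \<Rightarrow> 'k"
  have "\<forall>i\<in>I. \<exists>b. \<forall>x\<in>A i. h x < b"
    using assms(2) unfolding small_def by blast
  then obtain B where B: "\<And>i x. i \<in> I \<Longrightarrow> x \<in> A i \<Longrightarrow> h x < B i" by metis
  obtain b where "\<forall>i\<in>I. B i < b"
    using smallD[OF assms(1)] ..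
  with B have "\<forall>x\<in>(\<Union>i\<in>I. A i). h x < b" by (metis UN_iff less_trans)
  then show "\<exists>b. \<forall>x\<in>(\<Union>i\<in>I. A i). h x < b" ..
qed

lemma small_Times:
  assumes "small K A" "small K B"
  shows "small K (A \<times> B)"
proof -
  have "A \<times> B = (\<Union>a\<in>A. Pair a ` B)" by auto
  then show ?thesis using assms by (simp add: small_UN small_image)
qed

lemma unbdd_pigeonhole:
  fixes K :: "'k::wellorder itself" and S :: "'k set"
  assumes "unbdd S" "small K I" "\<And>a. a \<in> S \<Longrightarrow> f a \<in> I"
  shows "\<exists>i\<in>I. unbdd {a\<in>S. f a = i}"
proof (rule ccontr)
  assume "\<not> ?thesis"
  then have "\<forall>i\<in>I. \<exists>b. \<forall>a\<in>S. f a = i \<longrightarrow> a \<le> b"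
    unfolding unbdd_def by (fastforce simp: not_less)
  then obtain g where g: "\<And>a. a \<in> S \<Longrightarrow> a \<le> g (f a)" using assms(3) by metis
  obtain b where "\<forall>i\<in>I. g i < b" using smallD[OF assms(2)] ..
  then have "\<forall>a\<in>S. a < b" using g assms(3) by (meson le_less_trans)
  then show False using assms(1) unfolding unbdd_def by (meson less_asym)
qed

lemma Field_le_rel [simp]: "Field (le_rel :: 'k::wellorder rel) = UNIV"
  by (auto simp: le_rel_def Field_def)

lemma cofinal_iff: "cofinal S (le_rel :: 'k::wellorder rel) \<longleftrightarrow> unbdd S"
  unfolding cofinal_def unbdd_def Field_le_rel by (simp add: le_rel_def order.strict_iff_order conj_commute)

lemma isLub_Int_iff:
  fixes a :: "'k::wellorder"
  shows "isLub UNIV (S \<inter> {..<a}) a \<longleftrightarrow> (\<forall>y<a. \<exists>x\<in>S. y < x \<and> x < a)"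
proof -
  have "isLub UNIV (S \<inter> {..<a}) a \<longleftrightarrow> (\<forall>u. (\<forall>x\<in>S. x < a \<longrightarrow> x \<le> u) \<longrightarrow> a \<le> u)"
    unfolding isLub_def leastP_def isUb_def setle_def setge_def by auto
  then show ?thesis by (meson not_le)
qed

lemma isLub_iff:
  fixes a :: "'k::wellorder"
  assumes "S \<subseteq> {..<a}"
  shows "isLub UNIV S a \<longleftrightarrow> (\<forall>y<a. \<exists>x\<in>S. y < x)"
proof -
  have "S \<inter> {..<a} = S" using assms by blast
  then show ?thesis using isLub_Int_iff[of S a] assms by (metis lessThan_iff subsetD)
qed

lemma acc_iff:
  "a \<in> acc S \<longleftrightarrow> a \<in> S \<and> (\<forall>y<a. \<exists>x\<in>S. y < x \<and> x < a) \<and> (\<exists>b. b < a)"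
  unfolding acc_def isLub_Int_iff by simp

lemma acc_UNIV_iff: "a \<in> acc UNIV \<longleftrightarrow> (\<forall>y<a. \<exists>x. y < x \<and> x < a) \<and> (\<exists>b. b < a)"
  unfolding acc_iff by simp

lemma acc_subset_UNIV: "a \<in> acc S \<Longrightarrow> a \<in> acc UNIV"
  unfolding acc_iff by blast

section \<open>Clubs of closure points, and guessing of coded objects\<close>

definition closed_under :: "('k::wellorder \<Rightarrow> 'k) \<Rightarrow> 'k set" where
  "closed_under h = {d \<in> acc UNIV. \<forall>b<d. h b < d}"

lemma closed_underD: "d \<in> closed_under h \<Longrightarrow> b < d \<Longrightarrow> h b < d"
  by (simp add: closed_under_def)

lemma closed_under_gt: "d \<in> closed_under (\<lambda>x. max c (h x)) \<Longrightarrow> c < d"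
  by (auto simp: closed_under_def acc_UNIV_iff)

locale regular_uncountable =
  fixes K :: "'k::wellorder itself"
  assumes small_lessThan: "\<And>a::'k. small K {..<a}"
    and small_nat: "small K (UNIV :: nat set)"
begin

lemma small_countable_image: "small K (range (f :: nat \<Rightarrow> 'i))"
  using small_nat by (rule small_image)

lemma small_countable: "countable A \<Longrightarrow> small K A"
proof (cases "A = {}")
  case False
  moreover assume "countable A"
  ultimately show ?thesis
    using small_countable_image[of "from_nat_into A"] by (simp add: range_from_nat_into)
qed (simp add: small_def)

lemma small_lists:
  assumes "small K A"
  shows "small K (lists A)"
proof -
  have "small K {l \<in> lists A. length l = n}" for n
  proof (induction n)
    case 0
    have "countable {l \<in> lists A. length l = 0}"
      by (rule countable_subset[of _ "{[]}"]) auto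
    then show ?case by (rule small_countable)
  next
    case (Suc n)
    have "{l \<in> lists A. length l = Suc n} = (\<lambda>(x, l). x # l) ` (A \<times> {l \<in> lists A. length l = n})"
      by (auto simp: length_Suc_conv image_iff)
    then show ?case using Suc assms by (simp add: small_Times small_image)
  qed
  then have "small K (\<Union>n. {l \<in> lists A. length l = n})"
    by (rule small_UN[OF small_nat])
  moreover have "(\<Union>n. {l \<in> lists A. length l = n}) = lists A" by auto
  ultimately show ?thesis by simp
qed

lemma ex_gt: "\<exists>b. (a::'k) < b"
proof -
  obtain b where "\<And>n::nat. n \<in> UNIV \<Longrightarrow> a < b"
    using smallD[OF small_nat, of "\<lambda>_. a"] by blast
  then show ?thesis by blast
qed

definition sc :: "'k \<Rightarrow> 'k" where
  "sc a = (LEAST b. a < b)"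

lemma sc_gt: "a < sc a"
  unfolding sc_def using ex_gt by (rule LeastI_ex)

lemma sc_le: "a < b \<Longrightarrow> sc a \<le> b"
  unfolding sc_def by (rule Least_le)

lemma less_sc_iff: "y < sc a \<longleftrightarrow> y \<le> a"
  using sc_gt sc_le by (meson leD le_less_trans not_le)

lemma sc_less_limit: "d \<in> acc UNIV \<Longrightarrow> a < d \<Longrightarrow> sc a < d"
  unfolding acc_UNIV_iff using le_less_trans[OF sc_le] by blast

lemma not_limit_cases:
  obtains "d \<in> acc UNIV" | "\<And>b. \<not> b < d" | a where "d = sc a"
proof (cases "d \<in> acc UNIV \<or> (\<forall>b. \<not> b < d)")
  case False
  then obtain y where y: "y < d" "\<And>x. y < x \<Longrightarrow> \<not> x < d"
    unfolding acc_UNIV_iff by blast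
  then have "d = sc y" using sc_gt sc_le by (meson antisym not_le)
  then show ?thesis using that by blast
qed (use that in blast)

text \<open>Starting at \<open>b\<close>, iterate a function \<open>g\<close> that exceeds each
  \<open>x\<close> and all \<open>h z\<close> with \<open>z < x\<close>. The supremum of the
  countably many iterates exists by uncountable cofinality and is a limit closed under
  \<open>h\<close>.\<close>

lemma unbdd_closed_under: "unbdd (closed_under (h :: 'k \<Rightarrow> 'k))"
  unfolding unbdd_def
proof
  fix b
  have "\<exists>y. x < y \<and> (\<forall>z<x. h z < y)" for x
  proof -
    obtain y where "\<forall>z<x. h z < y" using smallD[OF small_lessThan[of x], of h] by auto
    then show ?thesis using sc_gt[of x] by (intro exI[of _ "max (sc x) y"]) (auto simp: less_max_iff_disj)
  qed
  then obtain g where g: "\<And>x. x < g x" "\<And>x z. z < x \<Longrightarrow> h z < g x" by metis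
  define f where "f n = (g ^^ n) b" for n
  have f: "f n < f (Suc n)" for n by (simp add: f_def g)
  define d where "d = (LEAST d. \<forall>n. f n < d)"
  have "\<exists>d. \<forall>n. f n < d" using smallD[OF small_nat, of f] by auto
  then have "\<forall>n. f n < d" unfolding d_def by (rule LeastI_ex)
  then have d: "f n < d" for n by blast
  have d2: "\<exists>n. y < f n" if "y < d" for y
  proof -
    have "\<not> (\<forall>n. f n < y)" using not_less_Least[OF that[unfolded d_def]] .
    then obtain n where "y \<le> f n" by (auto simp: not_less)
    then show ?thesis using f[of n] by (blast intro: le_less_trans)
  qed
  have "d \<in> closed_under h"
    unfolding closed_under_def acc_UNIV_iff
  proof (intro CollectI conjI allI impI)
    fix y assume "y < d"
    then obtain n where n: "y < f n" using d2 by blast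
    then show "\<exists>x>y. x < d" using d by blast
    have "h y < f (Suc n)" using g(2)[OF n] by (simp add: f_def)
    then show "h y < d" using d[of "Suc n"] by (rule less_trans)
  qed (use d in blast)
  moreover have "b < d" using d[of 0] by (simp add: f_def)
  ultimately show "\<exists>a\<in>closed_under h. b < a" by blast
qed

lemma club_closed_under: "club (closed_under (h :: 'k \<Rightarrow> 'k))"
  unfolding club_def isLub_Int_iff
proof (intro conjI allI impI)
  show "cofinal (closed_under h) le_rel"
    unfolding cofinal_iff by (rule unbdd_closed_under)
next
  fix d assume d: "(\<forall>y<d. \<exists>x\<in>closed_under h. y < x \<and> x < d) \<and> (\<exists>g. g < d)"
  have "h y < d" if "y < d" for y
  proof -
    from conjunct1[OF d, rule_format, OF that]
    obtain x where x: "x \<in> closed_under h" "y < x" "x < d" by blast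
    from closed_underD[OF x(1,2)] x(3) show ?thesis by (rule less_trans)
  qed
  moreover have "d \<in> acc UNIV"
    unfolding acc_UNIV_iff
  proof (intro conjI allI impI)
    fix y assume "y < d"
    from conjunct1[OF d, rule_format, OF this] obtain x where "y < x" "x < d" by blast
    then show "\<exists>x>y. x < d" by blast
  qed (rule conjunct2[OF d])
  ultimately show "d \<in> closed_under h" by (simp add: closed_under_def)
qed

lemma stationary_closed_under:
  assumes "stationary S"
  shows "\<exists>d\<in>S. d \<in> closed_under (h :: 'k \<Rightarrow> 'k)"
  using assms club_closed_under[of h] unfolding stationary_def by blast

text \<open>Diamond guesses sets of ordinals, so objects are guessed through their codes. At closure
  points \<open>b\<close> of the bound \<open>g\<close> every object of rank below \<open>b\<close>
  has its code below \<open>b\<close>, and the guess decides all of them.\<close>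

lemma diamond_guess:
  fixes code :: "'c \<Rightarrow> 'k" and rk :: "'c \<Rightarrow> 'k"
  assumes "diamond TYPE('k)" "inj code" "\<And>a. small K {c. rk c < a}"
  obtains N :: "'k \<Rightarrow> 'c set"
  where "\<And>X h. \<exists>b\<in>closed_under h. \<forall>c. rk c < b \<longrightarrow> (c \<in> N b \<longleftrightarrow> c \<in> X)"
proof -
  obtain A :: "'k \<Rightarrow> 'k set" where A: "\<And>X. stationary {a. X \<inter> {..<a} = A a}"
    using assms(1) unfolding diamond_def by blast
  have "\<exists>y. \<forall>c. rk c \<le> x \<longrightarrow> code c < y" for x
    using smallD[OF assms(3)[of "sc x"], of code] by (simp add: less_sc_iff)
  then obtain g where g: "\<And>c x. rk c \<le> x \<Longrightarrow> code c < g x" by metis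
  show ?thesis
  proof (rule that[of "\<lambda>b. {c. code c \<in> A b}"])
    fix X and h :: "'k \<Rightarrow> 'k"
    obtain b where b: "code ` X \<inter> {..<b} = A b" "b \<in> closed_under (\<lambda>x. max (h x) (g x))"
      using stationary_closed_under[OF A[of "code ` X"]] by blast
    have "c \<in> {c. code c \<in> A b} \<longleftrightarrow> c \<in> X" if "rk c < b" for c
    proof -
      have "g (rk c) < b" using closed_underD[OF b(2) that] by simp
      with g[OF order_refl] have "code c < b" by (rule less_trans)
      then have "code c \<in> A b \<longleftrightarrow> code c \<in> code ` X" using b(1) by blast
      then show ?thesis using assms(2) by (simp add: inj_image_mem_iff)
    qed
    moreover have "b \<in> closed_under h" using b(2) by (simp add: closed_under_def)
    ultimately show "\<exists>b\<in>closed_under h. \<forall>c. rk c < b \<longrightarrow> (c \<in> {c. code c \<in> A b} \<longleftrightarrow> c \<in> X)"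
      by blast
  qed
qed

lemma strict_mono_above:
  shows "\<exists>\<pi> :: 'k \<Rightarrow> 'k. strict_mono \<pi> \<and> (\<forall>a. c \<le> \<pi> a)"
proof -
  define P where "P f x r \<longleftrightarrow> c \<le> r \<and> (\<forall>b<x. f b < r)" for f :: "'k \<Rightarrow> 'k" and x r
  have "\<exists>\<pi>. \<forall>x. P \<pi> x (\<pi> x)"
  proof (rule dependent_wf_choice[OF wf_less_rel])
    fix f g :: "'k \<Rightarrow> 'k" and x r
    assume "\<And>z. (z, x) \<in> {(x, y). x < y} \<Longrightarrow> f z = g z"
    then have "\<And>z. z < x \<Longrightarrow> f z = g z" by blast
    then show "P f x r = P g x r" unfolding P_def by auto
  next
    fix x :: 'k and f :: "'k \<Rightarrow> 'k"
    obtain y where "\<forall>z<x. f z < y" using smallD[OF small_lessThan[of x], of f] by auto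
    then show "\<exists>r. P f x r"
      unfolding P_def by (intro exI[of _ "max c y"]) (auto simp: less_max_iff_disj)
  qed
  then obtain \<pi> where \<pi>: "\<And>x. P \<pi> x (\<pi> x)" by blast
  have "strict_mono \<pi>" using \<pi> unfolding P_def strict_mono_def by blast
  moreover have "\<forall>a. c \<le> \<pi> a" using \<pi> unfolding P_def by blast
  ultimately show ?thesis by blast
qed

end

declare split_paired_All [simp del] split_paired_Ex [simp del]

section \<open>Scattered sets\<close>

definition noQ :: "('a \<Rightarrow> 'a \<Rightarrow> bool) \<Rightarrow> 'a set \<Rightarrow> bool" where
  "noQ lt S \<longleftrightarrow> \<not> (\<exists>f :: rat \<Rightarrow> 'a. range f \<subseteq> S \<and> (\<forall>x y. x < y \<longrightarrow> lt (f x) (f y)))"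

definition sigS :: "('a \<Rightarrow> 'a \<Rightarrow> bool) \<Rightarrow> 'a set \<Rightarrow> bool" where
  "sigS lt S \<longleftrightarrow> (\<exists>F :: nat \<Rightarrow> 'a set. S \<subseteq> (\<Union>n. F n) \<and> (\<forall>n. noQ lt (F n)))"

lemma noQ_subset: "noQ lt S \<Longrightarrow> R \<subseteq> S \<Longrightarrow> noQ lt R"
  unfolding noQ_def by (meson order_trans)

lemma sigS_subset: "sigS lt S \<Longrightarrow> R \<subseteq> S \<Longrightarrow> sigS lt R"
  unfolding sigS_def by (meson order_trans)

lemma noQ_imp_sigS: "noQ lt S \<Longrightarrow> sigS lt S"
  unfolding sigS_def by (rule exI[of _ "\<lambda>_. S"]) auto

lemma sigS_antichain:
  assumes "\<And>a b. a \<in> S \<Longrightarrow> b \<in> S \<Longrightarrow> \<not> lt a b"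
  shows "sigS lt S"
proof (rule noQ_imp_sigS)
  have "(0::rat) < 1" by simp
  then show "noQ lt S"
    unfolding noQ_def using assms by (meson rangeI subsetD)
qed

lemma sigS_UN:
  assumes "\<And>n::nat. sigS lt (S n)"
  shows "sigS lt (\<Union>n. S n)"
proof -
  obtain F where F: "\<And>n. S n \<subseteq> (\<Union>m::nat. F n m)" "\<And>n m. noQ lt (F n m)"
    using assms unfolding sigS_def by metis
  define G where "G k = (case prod_decode k of (n, m) \<Rightarrow> F n m)" for k
  have "noQ lt (G k)" for k
    using F(2) by (simp add: G_def split: prod.split)
  moreover have "(\<Union>n. S n) \<subseteq> (\<Union>k. G k)"
  proof
    fix x assume "x \<in> (\<Union>n. S n)"
    then obtain n m where "x \<in> F n m" using F(1) by blast
    then have "x \<in> G (prod_encode (n, m))" by (simp add: G_def)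
    then show "x \<in> (\<Union>k. G k)" by blast
  qed
  ultimately show ?thesis unfolding sigS_def by blast
qed

lemma rat_into_interval:
  fixes a b :: rat
  assumes "a < b"
  obtains f :: "rat \<Rightarrow> rat" where "strict_mono f" "\<And>x. a < f x" "\<And>x. f x < b"
proof -
  define g where "g x = x / (1 + \<bar>x\<bar>)" for x :: rat
  have g_mono: "g x < g y" if "x < y" for x y
  proof -
    have "x * (1 + \<bar>y\<bar>) < y * (1 + \<bar>x\<bar>)"
    proof (cases "0 \<le> x \<or> y \<le> 0")
      case True
      then have "x * \<bar>y\<bar> = y * \<bar>x\<bar>" using that by (auto simp: abs_if)
      then show ?thesis using that by (simp add: algebra_simps)
    next
      case False
      then have "x * (1 + \<bar>y\<bar>) < 0" "0 < y * (1 + \<bar>x\<bar>)"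
        by (auto simp: mult_less_0_iff zero_less_mult_iff)
      then show ?thesis by simp
    qed
    moreover have "0 < 1 + \<bar>x\<bar>" "0 < 1 + \<bar>y\<bar>" by simp_all
    ultimately show ?thesis
      unfolding g_def by (simp add: divide_less_eq less_divide_eq mult.commute)
  qed
  have g_bd: "-1 < g x" "g x < 1" for x
    unfolding g_def by (auto simp: divide_simps abs_if)
  define c where "c = (b - a) / 2"
  have "c > 0" using assms by (simp add: c_def)
  show ?thesis
  proof (rule that[of "\<lambda>x. a + c * (1 + g x)"])
    show "strict_mono (\<lambda>x. a + c * (1 + g x))"
      using \<open>c > 0\<close> g_mono by (auto intro!: strict_monoI)
    show "a < a + c * (1 + g x)" for x
      using \<open>c > 0\<close> g_bd(1)[of x] by simp
    have "c * (1 + g x) < c * 2" for x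
      using \<open>c > 0\<close> g_bd(2)[of x] by simp
    moreover have "a + c * 2 = b" by (simp add: c_def field_simps)
    ultimately show "a + c * (1 + g x) < b" for x by (metis add_strict_left_mono)
  qed
qed

text \<open>A copy of the rationals cannot be mapped monotonically to a well-order without being constant
  on an interval: take the least value attained on one side of \<open>0\<close>.\<close>

lemma noQ_monotone:
  fixes g :: "'a \<Rightarrow> 'p::wellorder"
  assumes mono: "(\<forall>a\<in>S. \<forall>b\<in>S. lt a b \<longrightarrow> g a \<le> g b) \<or> (\<forall>a\<in>S. \<forall>b\<in>S. lt a b \<longrightarrow> g b \<le> g a)"
    and fib: "\<And>p. noQ lt {a\<in>S. g a = p}"
  shows "noQ lt S"
  unfolding noQ_def
proof
  assume "\<exists>f :: rat \<Rightarrow> 'a. range f \<subseteq> S \<and> (\<forall>x y. x < y \<longrightarrow> lt (f x) (f y))"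
  then obtain f :: "rat \<Rightarrow> 'a" where f: "\<And>x. f x \<in> S" "\<And>x y. x < y \<Longrightarrow> lt (f x) (f y)"
    by (auto simp: image_subset_iff)
  have "\<exists>a b m. a < b \<and> (\<forall>x. a < x \<and> x < b \<longrightarrow> g (f x) = m)"
  proof -
    \<comment> \<open>If \<open>g\<close> increases along the copy, its least value on the positive
      rationals, attained at \<open>x1\<close>, is kept on the whole interval from \<open>0\<close>
      to \<open>x1\<close>. If it decreases, the negative rationals play the same part.\<close>
    define U where "U = (if \<forall>a\<in>S. \<forall>b\<in>S. lt a b \<longrightarrow> g a \<le> g b then {x::rat. 0 < x} else {x. x < 0})"
    define m where "m = (LEAST m. m \<in> (g \<circ> f) ` U)"
    have "U \<noteq> {}" unfolding U_def using zero_less_one[where 'a=rat] neg_less_0_iff_less[of "1::rat"] by (metis empty_iff mem_Collect_eq)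
    then have "m \<in> (g \<circ> f) ` U" unfolding m_def by (metis LeastI ex_in_conv image_is_empty)
    then obtain x1 where x1: "x1 \<in> U" "m = g (f x1)" by auto
    have least: "m \<le> g (f x)" if "x \<in> U" for x
      unfolding m_def using that by (intro Least_le) auto
    show ?thesis
    proof (cases "\<forall>a\<in>S. \<forall>b\<in>S. lt a b \<longrightarrow> g a \<le> g b")
      case True
      then have "0 < x1" using x1 by (simp add: U_def)
      moreover have "g (f x) = m" if "0 < x" "x < x1" for x
      proof (rule antisym)
        show "g (f x) \<le> m" using True f that x1(2) by blast
        show "m \<le> g (f x)" using True that by (intro least) (simp add: U_def)
      qed
      ultimately show ?thesis by blast
    next
      case False
      then have "U = {x. x < 0}" unfolding U_def by (rule if_not_P)
      with x1(1) have "x1 < 0" by simp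
      moreover have "g (f x) = m" if "x1 < x" "x < 0" for x
      proof (rule antisym)
        show "g (f x) \<le> m" using mono False f that x1(2) by blast
        show "m \<le> g (f x)" using \<open>U = {x. x < 0}\<close> that by (intro least) simp
      qed
      ultimately show ?thesis by blast
    qed
  qed
  then obtain a b m where ab: "a < b" "\<And>x. a < x \<Longrightarrow> x < b \<Longrightarrow> g (f x) = m" by blast
  obtain i :: "rat \<Rightarrow> rat" where i: "strict_mono i" "\<And>x. a < i x" "\<And>x. i x < b"
    using rat_into_interval[OF ab(1)] by metis
  have "range (\<lambda>x. f (i x)) \<subseteq> {a\<in>S. g a = m}"
    using f(1) ab(2) i by auto
  moreover have "\<forall>x y. x < y \<longrightarrow> lt (f (i x)) (f (i y))"
    using f(2) i(1) by (simp add: strict_mono_less)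
  ultimately show False using fib[of m] unfolding noQ_def by blast
qed

text \<open>The pieces with the same index \<open>n\<close> are collected from all fibres;
  \<open>noQ_monotone\<close> shows that such a union again contains no copy of the
  rationals.\<close>

lemma sigS_monotone:
  fixes g :: "'a \<Rightarrow> 'p::wellorder"
  assumes mono: "(\<forall>a\<in>S. \<forall>b\<in>S. lt a b \<longrightarrow> g a \<le> g b) \<or> (\<forall>a\<in>S. \<forall>b\<in>S. lt a b \<longrightarrow> g b \<le> g a)"
    and fib: "\<And>p. sigS lt {a\<in>S. g a = p}"
  shows "sigS lt S"
proof -
  obtain F where F: "\<And>p. {a\<in>S. g a = p} \<subseteq> (\<Union>n::nat. F p n)" "\<And>p n. noQ lt (F p n)"
    using fib unfolding sigS_def by metis
  define G where "G n = {a\<in>S. a \<in> F (g a) n}" for n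
  have "noQ lt (G n)" for n
  proof (rule noQ_monotone[where g = g])
    show "(\<forall>a\<in>G n. \<forall>b\<in>G n. lt a b \<longrightarrow> g a \<le> g b) \<or> (\<forall>a\<in>G n. \<forall>b\<in>G n. lt a b \<longrightarrow> g b \<le> g a)"
      using mono by (auto simp: G_def)
    show "noQ lt {a\<in>G n. g a = p}" for p
      by (rule noQ_subset[OF F(2)[of p n]]) (auto simp: G_def)
  qed
  moreover have "S \<subseteq> (\<Union>n. G n)" using F(1) by (auto simp: G_def)
  ultimately show ?thesis unfolding sigS_def by blast
qed

section \<open>Passage between strict orders and reflexive relations\<close>

definition rel_of :: "('a \<Rightarrow> 'a \<Rightarrow> bool) \<Rightarrow> 'a rel" where
  "rel_of lt = {(a, b). a = b \<or> lt a b}"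

lemma Field_rel_of [simp]: "Field (rel_of lt) = UNIV"
  by (auto simp: rel_of_def Field_def)

lemma Field_Restr_rel_of [simp]: "Field (Restr (rel_of lt) X) = X"
  by (auto simp: rel_of_def Field_def)

lemma scattered_rel_of:
  assumes "\<And>a. \<not> lt a a"
  shows "scattered (Restr (rel_of lt) X) \<longleftrightarrow> noQ lt X"
proof -
  have "lin_embeds (le_rel :: rat rel) (Restr (rel_of lt) X) \<longleftrightarrow>
      (\<exists>f :: rat \<Rightarrow> 'a. range f \<subseteq> X \<and> (\<forall>x y. x < y \<longrightarrow> lt (f x) (f y)))"
  proof -
    have F: "Field (le_rel :: rat rel) = UNIV" by (auto simp: le_rel_def Field_def)
    have "(\<forall>x y. (x, y) \<in> le_rel \<and> x \<noteq> y \<longrightarrow> (f x, f y) \<in> Restr (rel_of lt) X \<and> f x \<noteq> f y) \<longleftrightarrow>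
       (\<forall>x y. x < y \<longrightarrow> lt (f x) (f y))" if "range f \<subseteq> X" for f :: "rat \<Rightarrow> 'a"
    proof -
      have "f x \<in> X" for x using that by auto
      then have "(f x, f y) \<in> Restr (rel_of lt) X \<and> f x \<noteq> f y \<longleftrightarrow> lt (f x) (f y)" for x y
        using assms[of "f y"] by (auto simp: rel_of_def)
      moreover have "(x, y) \<in> le_rel \<and> x \<noteq> y \<longleftrightarrow> x < y" for x y :: rat
        by (auto simp: le_rel_def)
      ultimately show ?thesis by simp
    qed
    then show ?thesis unfolding lin_embeds_def F Field_Restr_rel_of by (simp cong: conj_cong)
  qed
  then show ?thesis unfolding scattered_def noQ_def by blast
qed

lemma sigma_scattered_rel_of:
  assumes "\<And>a. \<not> lt a a"
  shows "sigma_scattered (Restr (rel_of lt) X) \<longleftrightarrow> sigS lt X"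
proof -
  have sc: "scattered (Restr (rel_of lt) S) \<longleftrightarrow> noQ lt S" for S
    by (rule scattered_rel_of) (rule assms)
  have *: "Restr (Restr (rel_of lt) X) S = Restr (rel_of lt) S" if "S \<subseteq> X" for S
    using that by auto
  show ?thesis
  proof
    assume "sigma_scattered (Restr (rel_of lt) X)"
    then obtain S :: "nat \<Rightarrow> 'a set" where S: "X = (\<Union>n. S n)" "\<And>n. scattered (Restr (Restr (rel_of lt) X) (S n))"
      unfolding sigma_scattered_def by auto
    have "noQ lt (S n)" for n
    proof -
      have "S n \<subseteq> X" using S(1) by blast
      then show ?thesis using S(2)[of n] * sc by simp
    qed
    then show "sigS lt X" unfolding sigS_def using S(1) by blast
  next
    assume "sigS lt X"
    then obtain F :: "nat \<Rightarrow> 'a set" where F: "X \<subseteq> (\<Union>n. F n)" "\<And>n. noQ lt (F n)"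
      unfolding sigS_def by blast
    have "X = (\<Union>n. F n \<inter> X)" using F(1) by blast
    moreover have "scattered (Restr (Restr (rel_of lt) X) (F n \<inter> X))" for n
      using noQ_subset[OF F(2)[of n], of "F n \<inter> X"] *[of "F n \<inter> X"] sc by simp
    ultimately show "sigma_scattered (Restr (rel_of lt) X)"
      unfolding sigma_scattered_def Field_Restr_rel_of by blast
  qed
qed

subsection \<open>Lexicographic orders\<close>

text \<open>The order on values is reversed at the positions whose first component lies in \<^term>\<open>A\<close>.\<close>

definition lexl :: "'k::wellorder set \<Rightarrow> ('k \<times> nat \<Rightarrow> int) \<Rightarrow> ('k \<times> nat \<Rightarrow> int) \<Rightarrow> bool" where
  "lexl A s t \<longleftrightarrow> (\<exists>p. (\<forall>q<p. s q = t q) \<and> (if fst p \<in> A then t p < s p else s p < t p))"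

lemma lexlI:
  assumes "\<And>q. q < p \<Longrightarrow> s q = t q" "if fst p \<in> A then t p < s p else s p < t p"
  shows "lexl A s t"
  using assms unfolding lexl_def by blast

lemma lexl_iff:
  assumes "\<And>q. q < p \<Longrightarrow> s q = t q" "s p \<noteq> t p"
  shows "lexl A s t \<longleftrightarrow> (if fst p \<in> A then t p < s p else s p < t p)"
proof
  assume "lexl A s t"
  then obtain p' where p': "\<forall>q<p'. s q = t q" "if fst p' \<in> A then t p' < s p' else s p' < t p'"
    unfolding lexl_def by blast
  have "p' = p"
  proof (rule linorder_cases)
    assume "p' < p"
    then have "s p' = t p'" by (rule assms(1))
    with p'(2) show ?thesis by (simp split: if_splits)
  next
    assume "p < p'"
    with p'(1) assms(2) show ?thesis by blast
  qed
  with p' show "if fst p \<in> A then t p < s p else s p < t p" by blast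
qed (use assms in \<open>blast intro: lexlI\<close>)

lemma first_difference:
  fixes s t :: "'p::wellorder \<Rightarrow> int"
  assumes "s \<noteq> t"
  obtains p where "\<And>q. q < p \<Longrightarrow> s q = t q" "s p \<noteq> t p"
proof -
  have ex: "\<exists>p. s p \<noteq> t p" using assms by auto
  show ?thesis
    by (rule that[of "LEAST p. s p \<noteq> t p"]) (use LeastI_ex[OF ex] not_less_Least in blast)+
qed

lemma lexl_irrefl: "\<not> lexl A s s"
  by (auto simp: lexl_def split: if_splits)

lemma lexl_total:
  assumes "s \<noteq> t"
  shows "lexl A s t \<or> lexl A t s"
proof -
  obtain p where "\<And>q. q < p \<Longrightarrow> s q = t q" "s p \<noteq> t p"
    using first_difference[OF assms] by metis
  then show ?thesis using lexlI[of p s t A] lexlI[of p t s A] by (metis linorder_neqE_linordered_idom)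
qed

lemma lexl_trans:
  assumes "lexl A s t" "lexl A t u"
  shows "lexl A s u"
proof -
  obtain p where p: "\<forall>q<p. s q = t q" "if fst p \<in> A then t p < s p else s p < t p"
    using assms(1) unfolding lexl_def by blast
  obtain p' where p': "\<forall>q<p'. t q = u q" "if fst p' \<in> A then u p' < t p' else t p' < u p'"
    using assms(2) unfolding lexl_def by blast
  show ?thesis
  proof (rule lexlI[of "min p p'"])
    show "s q = u q" if "q < min p p'" for q
    proof -
      have "q < p" "q < p'" using that by auto
      then show ?thesis using p(1) p'(1) by metis
    qed
    show "if fst (min p p') \<in> A then u (min p p') < s (min p p') else s (min p p') < u (min p p')"
    proof (cases p p' rule: linorder_cases)
      case less
      then show ?thesis using p p'(1)[rule_format, OF less] by (simp split: if_splits)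
    next
      case greater
      then show ?thesis using p' p(1)[rule_format, OF greater] by (simp split: if_splits)
    next
      case equal
      then show ?thesis using p p' by (auto split: if_splits)
    qed
  qed
qed

lemma lexl_asym: "lexl A s t \<Longrightarrow> \<not> lexl A t s"
  using lexl_trans lexl_irrefl by metis

lemma Linear_order_lexl:
  assumes "inj x"
  shows "Linear_order (rel_of (\<lambda>a b. lexl A (x a) (x b)))"
proof -
  let ?r = "rel_of (\<lambda>a b. lexl A (x a) (x b))"
  have "refl ?r" by (auto simp: rel_of_def refl_on_def)
  moreover have "trans ?r"
    using lexl_trans[of A] by (auto simp: rel_of_def trans_def)
  moreover have "antisym ?r"
    using lexl_asym[of A] by (auto simp: rel_of_def antisym_def)
  moreover have "total ?r"
    using lexl_total[of _ _ A] inj_eq[OF assms] by (auto simp: rel_of_def total_on_def)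
  ultimately show ?thesis
    by (simp add: linear_order_on_def partial_order_on_def preorder_on_def)
qed

subsection \<open>Rationals as finitely supported sequences\<close>

text \<open>The factorial number system, with the integral part as digit \<open>0\<close>. Unlike in
  a fixed base, every rational has only finitely many nonzero digits, because
  \<open>fact n * q\<close> is eventually an integer.\<close>

definition digit :: "rat \<Rightarrow> nat \<Rightarrow> int" where
  "digit q n = (if n = 0 then \<lfloor>q\<rfloor> else \<lfloor>fact n * q\<rfloor> - int n * \<lfloor>fact (n - 1) * q\<rfloor>)"

lemma fact_mult_Ints: "\<exists>N. \<forall>n\<ge>N. fact n * q \<in> (\<int> :: rat set)"
proof -
  obtain a b where ab: "q = of_int a / of_int b" "b > 0"
    by (cases q rule: Rat_cases) (auto simp: Fract_of_int_quotient)
  have "fact n * q \<in> \<int>" if "nat b \<le> n" for n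
  proof -
    have "nat b dvd fact n" using ab(2) that by (intro dvd_fact) auto
    then obtain c where "fact n = nat b * c" by (auto simp: dvd_def)
    then have "rat_of_nat (fact n) = rat_of_nat (nat b) * of_nat c" by (simp only: of_nat_mult)
    then have "(fact n :: rat) = of_int b * of_nat c" using ab(2) by simp
    then have "fact n * q = of_int (int c * a)" using ab by simp
    then show ?thesis by (metis Ints_of_int)
  qed
  then show ?thesis by blast
qed

lemma finite_digit: "finite {n. digit q n \<noteq> 0}"
proof -
  obtain N where N: "\<And>n. N \<le> n \<Longrightarrow> fact n * q \<in> (\<int> :: rat set)"
    using fact_mult_Ints[of q] by blast
  have "digit q n = 0" if le: "Suc N \<le> n" for n
  proof -
    obtain m where m: "n = Suc m" "N \<le> m" using Suc_le_D[OF le] le by auto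
    obtain k where k: "fact m * q = of_int k" using N[OF m(2)] by (auto elim: Ints_cases)
    have "fact n * q = of_int (int n * k)" using k m(1) by (simp add: algebra_simps)
    then have "\<lfloor>fact n * q\<rfloor> = int n * k" by (simp only: floor_of_int)
    then show ?thesis using k m(1) by (simp add: digit_def del: fact_Suc of_nat_Suc)
  qed
  then have "{n. digit q n \<noteq> 0} \<subseteq> {..N}" by (metis (mono_tags) atMost_iff mem_Collect_eq not_less_eq_eq subsetI)
  then show ?thesis using finite_subset by blast
qed

text \<open>The place is the first \<open>n\<close> at which the integral parts of
  \<open>fact n * q\<close> and \<open>fact n * q'\<close> differ. It exists because for large
  \<open>n\<close> both products are integers.\<close>

lemma digit_less:
  assumes "q < q'"
  obtains n where "\<And>m. m < n \<Longrightarrow> digit q m = digit q' m" "digit q n < digit q' n"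
proof -
  let ?P = "\<lambda>n. \<lfloor>fact n * q\<rfloor> \<noteq> \<lfloor>fact n * q'\<rfloor>"
  obtain N where N: "\<And>n. N \<le> n \<Longrightarrow> fact n * q \<in> (\<int> :: rat set)"
    using fact_mult_Ints[of q] by blast
  obtain N' where N': "\<And>n. N' \<le> n \<Longrightarrow> fact n * q' \<in> (\<int> :: rat set)"
    using fact_mult_Ints[of q'] by blast
  have "fact (max N N') * q < fact (max N N') * q'" using assms by simp
  moreover obtain i where "fact (max N N') * q = of_int i"
    using N[OF max.cobounded1] by (rule Ints_cases)
  moreover obtain j where "fact (max N N') * q' = of_int j"
    using N'[OF max.cobounded2] by (rule Ints_cases)
  ultimately have "?P (max N N')" by simp
  define n where "n = (LEAST n. ?P n)"
  have n: "?P n" unfolding n_def using \<open>?P (max N N')\<close> by (rule LeastI)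
  have eq: "\<lfloor>fact m * q\<rfloor> = \<lfloor>fact m * q'\<rfloor>" if "m < n" for m
    using not_less_Least[OF that[unfolded n_def]] by blast
  have "\<lfloor>fact n * q\<rfloor> \<le> \<lfloor>fact n * q'\<rfloor>" using assms by (intro floor_mono) simp
  with n have lt: "\<lfloor>fact n * q\<rfloor> < \<lfloor>fact n * q'\<rfloor>" by simp
  show ?thesis
  proof (rule that[of n])
    fix m assume "m < n"
    then show "digit q m = digit q' m" using eq[of m] eq[of "m - 1"] eq[of 0] by (auto simp: digit_def)
  next
    show "digit q n < digit q' n"
      using lt eq[of "n - 1"] by (cases "n = 0") (auto simp: digit_def)
  qed
qed

section \<open>Coherent trees\<close>

text \<open>A node of height \<^term>\<open>a\<close> is a function considered only at the positions with first
  component below \<^term>\<open>a\<close>; its values elsewhere are irrelevant.\<close>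

definition agree :: "'k::wellorder \<Rightarrow> ('k \<times> nat \<Rightarrow> int) \<Rightarrow> ('k \<times> nat \<Rightarrow> int) \<Rightarrow> bool" where
  "agree a s t \<longleftrightarrow> (\<forall>p. fst p < a \<longrightarrow> s p = t p)"

text \<open>The comparison is with the depth at \<open>a\<close>, not with \<open>0\<close>: a
  finite change below \<open>a\<close> shifts all these depths by the same amount and leaves the
  condition intact.\<close>

definition nice :: "'k::wellorder \<Rightarrow> 'k \<Rightarrow> ('k \<times> nat \<Rightarrow> int) \<Rightarrow> bool" where
  "nice a b u \<longleftrightarrow> (\<forall>p. (a, 0) \<le> p \<and> p \<le> (b, 0) \<longrightarrow> dep u (a, 0) \<le> dep u p)"

definition node :: "('k::wellorder \<Rightarrow> 'k \<times> nat \<Rightarrow> int) \<Rightarrow> 'k \<Rightarrow> ('k \<times> nat \<Rightarrow> int) \<Rightarrow> bool" where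
  "node e a t \<longleftrightarrow> finite {p. fst p < a \<and> t p \<noteq> e a p}"

lemma agree_sym: "agree a s t \<Longrightarrow> agree a t s"
  by (simp add: agree_def)

lemma agree_trans: "agree a s t \<Longrightarrow> agree a t u \<Longrightarrow> agree a s u"
  by (simp add: agree_def)

lemma agree_mono: "agree b s t \<Longrightarrow> a \<le> b \<Longrightarrow> agree a s t"
  unfolding agree_def by (meson less_le_trans)

lemma agreeD: "agree a s t \<Longrightarrow> fst p < a \<Longrightarrow> s p = t p"
  by (simp add: agree_def)

lemma agree_dep:
  assumes "agree a s t" "p \<le> (a, 0)"
  shows "dep s p = dep t p"
proof (rule dep_cong)
  fix z assume "z < p"
  then have "z < (a, 0)" using assms(2) by (rule less_le_trans)
  then show "s z = t z" using assms(1) by (simp only: pos_less_height agree_def)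
qed

lemma nice_cong:
  assumes "agree b s t" "nice a b s"
  shows "nice a b t"
  unfolding nice_def
proof (intro allI impI)
  fix p assume p: "(a, 0::nat) \<le> p \<and> p \<le> (b, 0)"
  from conjunct1[OF p] conjunct2[OF p] have "(a, 0) \<le> (b, 0::nat)" by (rule order_trans)
  then show "dep t (a, 0) \<le> dep t p"
    using assms(2) p agree_dep[OF assms(1)] unfolding nice_def by metis
qed

lemma nice_refl: "nice a a u"
  unfolding nice_def by (metis order_antisym order_refl)

lemma nice_trans:
  assumes "nice a b u" "nice b c u" "a \<le> b"
  shows "nice a c u"
  unfolding nice_def
proof (intro allI impI)
  fix p assume p: "(a, 0::nat) \<le> p \<and> p \<le> (c, 0)"
  show "dep u (a, 0) \<le> dep u p"
  proof (cases "p \<le> (b, 0)")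
    case False
    then have "dep u (b, 0) \<le> dep u p" using assms(2) p unfolding nice_def by (metis linear)
    moreover have "dep u (a, 0) \<le> dep u (b, 0)"
      using assms(1,3) unfolding nice_def by (metis order_refl pos_height_le fst_conv)
    ultimately show ?thesis by simp
  qed (use assms(1) p in \<open>auto simp: nice_def\<close>)
qed

lemma nice_if_nonneg:
  assumes "ok u (b, 0)" "\<And>z. (a, 0) \<le> z \<Longrightarrow> z < (b, 0) \<Longrightarrow> 0 \<le> wt (u z)"
  shows "nice a b u"
proof -
  have "dep u (a, 0) \<le> dep u p" if "(a, 0::nat) \<le> p" "p \<le> (b, 0::nat)" for p
    using that
  proof (induction p rule: less_induct)
    case (less p)
    show ?case
    proof (rule dep_ge_limit[where a = "(a, 0)"])
      show "ok u p" using assms(1) less.prems(2) by (rule ok_mono)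
      fix z assume z: "(a, 0) \<le> z" "z < p"
      then have "z < (b, 0)" using less.prems(2) by (meson less_le_trans)
      then show "dep u (a, 0) \<le> dep u z + wt (u z)"
        using less.IH[OF z(2,1)] assms(2)[OF z(1)] by fastforce
    qed (use less.prems in auto)
  qed
  then show ?thesis unfolding nice_def by blast
qed

text \<open>Continuing \<open>t\<close> by \<open>f\<close> gives depths that are bounded below up
  to \<open>b\<close>. One value of large weight at \<open>(a, 0)\<close> then lifts all later
  depths above the depth at \<open>a\<close>.\<close>

lemma extend_raw:
  fixes t f :: "'k::wellorder \<times> nat \<Rightarrow> int"
  assumes t: "finite {p. fst p < a \<and> t p \<noteq> f p}" and f: "ok f (b, 0)" and "a \<le> b"
  shows "\<exists>t'. agree a t t' \<and> finite {p. fst p < b \<and> t' p \<noteq> f p} \<and> ok t' (b, 0) \<and> nice a b t'"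
proof (cases "a = b")
  case True
  have "ok t (b, 0)"
    using dep_finite_change[OF t f, of t] True by (auto simp: pos_less_height)
  then show ?thesis using True t nice_refl by (intro exI[of _ t]) (auto simp: agree_def)
next
  case False
  define u where "u = (\<lambda>p. if fst p < a then t p else f p)"
  have fin_u: "finite {p. u p \<noteq> f p}"
    by (rule finite_subset[OF _ t]) (auto simp: u_def)
  have u: "ok u (b, 0)"
    using dep_finite_change[OF fin_u f, of u] by auto
  obtain B where B: "\<forall>p\<le>(b, 0). B \<le> dep u p" using dep_bounded_below[OF u] by blast
  \<comment> \<open>This makes up for the weight that is replaced and for the deepest fall below the
    depth at \<open>(a, 0)\<close>.\<close>
  obtain v where v: "wt v \<ge> wt (u (a, 0)) + (dep u (a, 0) - B)" using wt_unbounded by blast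
  define t' where "t' = u((a, 0) := v)"
  have D: "ok t' (b, 0)" "\<forall>p\<le>(b, 0). dep t' p = dep u p + (\<Sum>z\<in>{z\<in>{(a, 0)}. z < p}. wt (t' z) - wt (u z))"
    using dep_finite_change[of "{(a, 0)}" u "(b, 0)" t'] u by (auto simp: t'_def)
  have ab: "(a, 0) \<le> (b, 0::nat)" using assms(3) by auto
  have "{z\<in>{(a, 0)}. z < (a, 0::nat)} = {}" by auto
  with D(2)[rule_format, OF ab] have 1: "dep t' (a, 0) = dep u (a, 0)" by (simp only: sum.empty add_0_right)
  have "nice a b t'"
    unfolding nice_def
  proof (intro allI impI)
    fix p assume p: "(a, 0::nat) \<le> p \<and> p \<le> (b, 0)"
    show "dep t' (a, 0) \<le> dep t' p"
    proof (cases "p = (a, 0)")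
      case False
      then have "{z\<in>{(a, 0)}. z < p} = {(a, 0)}" using p by auto
      with D(2) p have "dep t' p = dep u p + (wt v - wt (u (a, 0)))" by (simp add: t'_def)
      moreover have "B \<le> dep u p" using B p by blast
      ultimately show ?thesis using 1 v by simp
    qed simp
  qed
  moreover have "agree a t t'" by (auto simp: agree_def t'_def u_def)
  moreover have "finite {p. fst p < b \<and> t' p \<noteq> f p}"
    by (rule finite_subset[of _ "insert (a, 0) {p. u p \<noteq> f p}"]) (use fin_u in \<open>auto simp: t'_def\<close>)
  ultimately show ?thesis using D(1) by blast
qed

section \<open>Nodes as finite modifications of coherent branches\<close>

locale coherent_tree = regular_uncountable K for K :: "'k::wellorder itself" +
  fixes e :: "'k \<Rightarrow> 'k \<times> nat \<Rightarrow> int"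
  assumes coh: "\<And>a b. a \<le> b \<Longrightarrow> finite {p. fst p < a \<and> e a p \<noteq> e b p}"
    and ok_e: "\<And>a. ok (e a) (a, 0)"
    and e_sc: "\<And>a n. e (sc a) (a, n) = 1"
begin

lemma node_change:
  assumes "node e a t" "finite {p. fst p < a \<and> s p \<noteq> t p}"
  shows "node e a s"
  unfolding node_def
  by (rule finite_subset[OF _ finite_UnI[OF assms(1)[unfolded node_def] assms(2)]]) auto

lemma node_diff:
  assumes "node e a s" "node e a t"
  shows "finite {p. fst p < a \<and> s p \<noteq> t p}"
  by (rule finite_subset[OF _ finite_UnI[OF assms[unfolded node_def]]]) auto

lemma node_e: "a \<le> b \<Longrightarrow> node e a (e b)"
  using coh[of a b] unfolding node_def by (simp add: eq_commute)

lemma node_mono: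
  assumes "node e b t" "a \<le> b"
  shows "node e a t"
proof (rule node_change[OF node_e[OF assms(2)]])
  show "finite {p. fst p < a \<and> t p \<noteq> e b p}"
    by (rule finite_subset[OF _ assms(1)[unfolded node_def]]) (use assms(2) in auto)
qed

lemma node_ok:
  assumes "node e a t"
  shows "ok t (a, 0)"
proof -
  have "ok t (a, 0) \<and> (\<forall>p\<le>(a, 0). dep t p = dep (e a) p + (\<Sum>z\<in>{z\<in>{p. fst p < a \<and> t p \<noteq> e a p}. z < p}. wt (t z) - wt (e a z)))"
    by (rule dep_finite_change[OF assms[unfolded node_def] ok_e]) (auto simp: pos_less_height)
  then show ?thesis ..
qed

lemma node_paste:
  assumes "node e a t" "a \<le> b" "node e b u"
  shows "node e b (\<lambda>p. if fst p < a then t p else u p)"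
proof (rule node_change[OF assms(3)])
  show "finite {p. fst p < b \<and> (if fst p < a then t p else u p) \<noteq> u p}"
    by (rule finite_subset[OF _ node_diff[OF assms(1) node_mono[OF assms(3,2)]]]) auto
qed

lemma dep_tail:
  assumes "node e b s" "node e b t" "\<And>z. q \<le> z \<Longrightarrow> z < (b, 0) \<Longrightarrow> s z = t z" "q \<le> p" "p \<le> (b, 0)"
  shows "dep s p - dep t p = dep s q - dep t q"
proof (rule dep_tail_shift[OF _ node_ok[OF assms(2)] assms(3-5)])
  show "finite {z. z < (b, 0) \<and> s z \<noteq> t z}"
    using node_diff[OF assms(1,2)] by (simp only: pos_less_height)
qed

lemma extend_nice:
  assumes "node e a t" "a \<le> b"
  shows "\<exists>t'. node e b t' \<and> agree a t t' \<and> nice a b t'"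
proof -
  have "finite {p. fst p < a \<and> t p \<noteq> e b p}"
    using node_diff[OF assms(1) node_e[OF assms(2)]] .
  from extend_raw[OF this ok_e assms(2)] show ?thesis unfolding node_def by blast
qed

text \<open>The members of the line: nodes whose depth becomes negative for the first time at some
  position \<^term>\<open>(a, n)\<close>.\<close>

lemma ex_antichain:
  "\<exists>x. (\<forall>a. node e (sc a) (x a)) \<and> (\<forall>a b. a < b \<longrightarrow> \<not> agree (sc a) (x a) (x b))"
proof -
  define o' :: 'k where "o' = (LEAST x. True)"
  have o': "o' \<le> a" for a unfolding o'_def by (rule Least_le) simp
  have dep0: "dep t (o', 0::nat) = 0" for t
  proof -
    have "\<not> (\<exists>p. p < (o', 0::nat))" using o' by (simp add: pos_less_height not_less)
    then show ?thesis by (subst dep_unfold) (rule if_not_P)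
  qed
  have "\<exists>x k. node e (sc a) x \<and> (\<forall>p\<le>(a, 0). 0 \<le> dep x p) \<and> dep x (a, k) < 0" for a
  proof -
    have "node e o' (e o')" by (rule node_e) simp
    then obtain t where t: "node e a t" "nice o' a t" using extend_nice o' by blast
    have pos: "0 \<le> dep t p" if "p \<le> (a, 0)" for p
    proof -
      have "(o', 0) \<le> p" using o'[of "fst p"] by (simp add: pos_height_le)
      then show ?thesis using t(2) that dep0 unfolding nice_def by metis
    qed
    \<comment> \<open>The \<open>k + 1\<close> values \<open>0\<close>, each of weight
      \<open>-1\<close>, take the depth from \<open>k\<close> to \<open>-1\<close>. Up to the height
      of its last block a member has nonnegative depth, so \<open>x b\<close> cannot repeat the
      negative depth of \<open>x a\<close> inside block \<open>a < b\<close>.\<close>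
    define k where "k = nat (dep t (a, 0))"
    define x where "x p = (if fst p < a then t p else if snd p \<le> k then 0 else 1)" for p
    have "node e (sc a) x"
    proof (rule node_change[OF node_paste[OF t(1) _ node_e[of "sc a" "sc a"]]])
      show "finite {p. fst p < sc a \<and> x p \<noteq> (if fst p < a then t p else e (sc a) p)}"
      proof (rule finite_subset)
        show "{p. fst p < sc a \<and> x p \<noteq> (if fst p < a then t p else e (sc a) p)} \<subseteq> Pair a ` {..k}"
        proof
          fix p assume p: "p \<in> {p. fst p < sc a \<and> x p \<noteq> (if fst p < a then t p else e (sc a) p)}"
          obtain c n where c: "p = (c, n)" by (cases p)
          with p have "c = a" by (auto simp: x_def less_sc_iff split: if_splits)
          with p c have "n \<le> k" by (auto simp: x_def e_sc split: if_splits)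
          with \<open>c = a\<close> c show "p \<in> Pair a ` {..k}" by simp
        qed
      qed simp
    qed (use sc_gt[of a] in auto)
    moreover have ag: "agree a t x" by (simp add: agree_def x_def)
    have "0 \<le> dep x p" if "p \<le> (a, 0)" for p
      using pos[OF that] agree_dep[OF ag that] by simp
    moreover have "dep x (a, n) = int k - int n" if "n \<le> Suc k" for n
      using that
    proof (induction n)
      case 0
      then show ?case using agree_dep[OF ag order_refl] pos[OF order_refl] by (simp add: k_def)
    next
      case (Suc n)
      then show ?case by (simp add: dep_Suc x_def)
    qed
    from this[of "Suc k"] have "dep x (a, Suc k) < 0" by simp
    ultimately show ?thesis by blast
  qed
  then obtain x k where x: "\<And>a. node e (sc a) (x a)" "\<And>a p. p \<le> (a, 0) \<Longrightarrow> 0 \<le> dep (x a) p"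
    "\<And>a. dep (x a) (a, k a) < 0" by metis
  have "\<not> agree (sc a) (x a) (x b)" if "a < b" for a b
  proof
    assume ag: "agree (sc a) (x a) (x b)"
    have "dep (x a) (a, k a) = dep (x b) (a, k a)"
      using sc_gt[of a] by (intro agree_dep[OF ag]) auto
    moreover have "0 \<le> dep (x b) (a, k a)" using that by (intro x(2)) auto
    ultimately show False using x(3)[of a] by simp
  qed
  with x(1) show ?thesis by blast
qed

end

section \<open>Genericity and sealing\<close>

locale tree = coherent_tree +
  assumes generic: "\<And>U.
      (\<And>c u u'. U c u \<Longrightarrow> agree c u u' \<Longrightarrow> U c u') \<Longrightarrow>
      (\<And>c u. node e c u \<Longrightarrow> \<exists>c' u'. c < c' \<and> node e c' u' \<and> agree c u u' \<and> nice c c' u' \<and> U c' u') \<Longrightarrow>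
      \<exists>d. \<forall>t. node e d t \<longrightarrow> (\<exists>c<d. U c t)"
begin

text \<open>The nodes having no extension in \<^term>\<open>X\<close> are not nicely dense, for otherwise by genericity
  some level would consist of such nodes.\<close>

lemma sealing:
  assumes X: "\<And>c x. (c, x) \<in> X \<Longrightarrow> node e c x" "\<And>b. \<exists>c x. (c, x) \<in> X \<and> b \<le> c"
  shows "\<exists>a w. node e a w \<and> (\<forall>b u. a \<le> b \<longrightarrow> node e b u \<longrightarrow> agree a w u \<longrightarrow> nice a b u \<longrightarrow>
     (\<exists>c x. (c, x) \<in> X \<and> b \<le> c \<and> agree b u x))"
proof (rule ccontr)
  define U where "U b u \<longleftrightarrow> \<not> (\<exists>c x. (c, x) \<in> X \<and> b \<le> c \<and> agree b u x)" for b u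
  assume "\<not> ?thesis"
  then have *: "\<exists>b u. a \<le> b \<and> node e b u \<and> agree a w u \<and> nice a b u \<and> U b u" if "node e a w" for a w
    unfolding U_def using that by blast
  have "\<exists>d. \<forall>t. node e d t \<longrightarrow> (\<exists>c<d. U c t)"
  proof (rule generic)
    fix c u u' assume "U c u" "agree c u u'"
    then show "U c u'" unfolding U_def using agree_trans by blast
  next
    fix a w assume "node e a w"
    then obtain b u where b: "a \<le> b" "node e b u" "agree a w u" "nice a b u" "U b u" using * by blast
    \<comment> \<open>Genericity wants a strictly greater height, whereas \<open>b = a\<close> is
      possible here. One more block is appended; the property \<open>U\<close> passes to
      extensions.\<close>
    have "b \<le> sc b" using sc_gt less_imp_le by blast
    then obtain u' where u': "node e (sc b) u'" "agree b u u'" "nice b (sc b) u'"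
      using extend_nice[OF b(2)] by blast
    have "U (sc b) u'"
      unfolding U_def
    proof
      assume "\<exists>c x. (c, x) \<in> X \<and> sc b \<le> c \<and> agree (sc b) u' x"
      then obtain c x where c: "(c, x) \<in> X" "sc b \<le> c" "agree (sc b) u' x" by blast
      have "b \<le> c" using c(2) \<open>b \<le> sc b\<close> by simp
      moreover have "agree b u x"
        using u'(2) agree_mono[OF c(3) \<open>b \<le> sc b\<close>] by (rule agree_trans)
      ultimately show False using b(5) c(1) unfolding U_def by blast
    qed
    moreover have "nice a (sc b) u'"
      using nice_cong[OF u'(2) b(4)] u'(3) b(1) by (rule nice_trans)
    moreover have "agree a w u'" using b(3) agree_mono[OF u'(2) b(1)] by (rule agree_trans)
    moreover have "a < sc b" using b(1) sc_gt by (rule le_less_trans)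
    ultimately show "\<exists>c' u'. a < c' \<and> node e c' u' \<and> agree a w u' \<and> nice a c' u' \<and> U c' u'"
      using u'(1) by blast
  qed
  then obtain d where d: "\<And>t. node e d t \<Longrightarrow> \<exists>c<d. U c t" by blast
  obtain c x where c: "(c, x) \<in> X" "d \<le> c" using X(2) by blast
  obtain b where "b < d" "U b x" using d[OF node_mono[OF X(1)[OF c(1)] c(2)]] by blast
  moreover have "b \<le> c" using \<open>b < d\<close> c(2) by simp
  moreover have "agree b x x" by (simp add: agree_def)
  ultimately show False using c(1) unfolding U_def by blast
qed

end

section \<open>Lines from coherent trees\<close>

locale tree_line = tree K e for K :: "'k::wellorder itself" and e +
  fixes x :: "'k \<Rightarrow> 'k \<times> nat \<Rightarrow> int"
  assumes node_x: "\<And>a. node e (sc a) (x a)"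
    and x_incomparable: "\<And>a b. a < b \<Longrightarrow> \<not> agree (sc a) (x a) (x b)"
begin

abbreviation lt :: "'k set \<Rightarrow> 'k \<Rightarrow> 'k \<Rightarrow> bool" where
  "lt A a b \<equiv> lexl A (x a) (x b)"

lemma x_first_difference:
  assumes "a \<noteq> b"
  obtains p where "fst p \<le> a" "fst p \<le> b" "\<And>q. q < p \<Longrightarrow> x a q = x b q" "x a p \<noteq> x b p"
proof -
  have "\<exists>p. fst p \<le> a \<and> fst p \<le> b \<and> x a p \<noteq> x b p"
  proof (rule linorder_cases)
    assume "a < b"
    then show ?thesis using x_incomparable[of a b] by (auto simp: agree_def less_sc_iff)
  next
    assume "b < a"
    then obtain p where "fst p \<le> b" "x b p \<noteq> x a p"
      using x_incomparable[of b a] by (auto simp: agree_def less_sc_iff)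
    then show ?thesis using \<open>b < a\<close> by (intro exI[of _ p]) auto
  qed (use assms in blast)
  then obtain p' where p': "fst p' \<le> a" "fst p' \<le> b" "x a p' \<noteq> x b p'" by blast
  then have "x a \<noteq> x b" by auto
  then obtain p where p: "\<And>q. q < p \<Longrightarrow> x a q = x b q" "x a p \<noteq> x b p"
    using first_difference by metis
  have "p \<le> p'" using p(1) p'(3) by (meson not_le)
  then have "fst p \<le> fst p'" by (cases p; cases p') auto
  with p p' show ?thesis by (intro that[of p]) auto
qed

lemma inj_x: "inj x"
  by (metis injI x_first_difference)

lemma x_extends_node:
  assumes "unbdd S"
  shows "\<exists>a w. node e a w \<and> (\<forall>b u. a \<le> b \<longrightarrow> node e b u \<longrightarrow> agree a w u \<longrightarrow> nice a b u \<longrightarrow>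
     (\<exists>c\<in>S. b \<le> sc c \<and> agree b u (x c)))"
proof -
  define X where "X = (\<lambda>c. (sc c, x c)) ` S"
  have 1: "node e c y" if "(c, y) \<in> X" for c y using that node_x by (auto simp: X_def)
  have 2: "\<exists>c y. (c, y) \<in> X \<and> b \<le> c" for b
  proof -
    obtain c where "c \<in> S" "b < c" using assms unfolding unbdd_def by blast
    moreover have "b \<le> sc c" using \<open>b < c\<close> sc_gt[of c] by simp
    ultimately show ?thesis unfolding X_def by blast
  qed
  have 3: "(\<exists>c y. (c, y) \<in> X \<and> b \<le> c \<and> agree b u y) \<longleftrightarrow> (\<exists>c\<in>S. b \<le> sc c \<and> agree b u (x c))" for b u
    unfolding X_def by blast
  show ?thesis using sealing[OF 1 2] unfolding 3 by blast
qed

subsection \<open>Bounded sets are sigma-scattered\<close>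

text \<open>Induction on the number of differences from \<open>f\<close>. Among the members with a
  given value and a given side of \<open>f\<close> at their first difference \<open>g a\<close>, an
  earlier first difference means lying farther from \<open>f\<close>, so \<open>g\<close> is
  monotone or antitone. On a fibre of \<open>g\<close> one difference is absorbed by changing
  \<open>f\<close> there.\<close>

lemma sigS_finite_difference:
  assumes "\<And>a. a \<in> S \<Longrightarrow> finite {p. fst p < sc a \<and> x a p \<noteq> f p} \<and> card {p. fst p < sc a \<and> x a p \<noteq> f p} = n"
  shows "sigS (lt A) S"
  using assms
proof (induction n arbitrary: f S)
  case 0
  have "a = b" if "a \<in> S" "b \<in> S" for a b
  proof (rule ccontr)
    assume "a \<noteq> b"
    then obtain p where p: "fst p \<le> a" "fst p \<le> b" "x a p \<noteq> x b p" using x_first_difference by metis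
    have "{p. fst p < sc a \<and> x a p \<noteq> f p} = {}" "{p. fst p < sc b \<and> x b p \<noteq> f p} = {}"
      using 0[OF that(1)] 0[OF that(2)] by (metis card_0_eq)+
    moreover have "fst p < sc a" "fst p < sc b" using p(1,2) by (simp_all add: less_sc_iff)
    ultimately have "x a p = f p" "x b p = f p" by blast+
    with p(3) show False by simp
  qed
  then have "\<not> lt A a b" if "a \<in> S" "b \<in> S" for a b
    using that lexl_irrefl[of A "x a"] by metis
  then show ?case by (rule sigS_antichain)
next
  case (Suc n)
  define D where "D a = {p. fst p < sc a \<and> x a p \<noteq> f p}" for a
  define g where "g a = (LEAST p. p \<in> D a)" for a
  have fin: "finite (D a)" "card (D a) = Suc n" if "a \<in> S" for a
    using Suc.prems[OF that] by (auto simp: D_def)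
  have gD: "g a \<in> D a" if "a \<in> S" for a
  proof -
    have "D a \<noteq> {}" using fin(2)[OF that] by auto
    then show ?thesis unfolding g_def by (metis LeastI ex_in_conv)
  qed
  have below: "x a q = f q" if "a \<in> S" "q < g a" for a q
  proof -
    have "q \<notin> D a" using not_less_Least[OF that(2)[unfolded g_def]] .
    moreover have "fst q < sc a"
    proof -
      have "fst q \<le> fst (g a)" using that(2) by (cases q; cases "g a") auto
      moreover have "fst (g a) < sc a" using gD[OF that(1)] by (simp add: D_def)
      ultimately show ?thesis by (rule le_less_trans)
    qed
    ultimately show ?thesis by (simp add: D_def)
  qed
  \<comment> \<open>\<open>up a\<close> says that \<open>x a\<close> comes after \<open>f\<close> in
    the order \<open>lexl A\<close>.\<close>
  define up where "up a \<longleftrightarrow> (if fst (g a) \<in> A then x a (g a) < f (g a) else f (g a) < x a (g a))" for a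
  have cmp: "if up a then lt A b a else lt A a b" if "a \<in> S" "b \<in> S" "g a < g b" for a b
  proof -
    have eq: "\<And>q. q < g a \<Longrightarrow> x a q = x b q"
    proof -
      fix q assume "q < g a"
      moreover have "q < g b" using \<open>q < g a\<close> that(3) by (rule less_trans)
      ultimately show "x a q = x b q" using below[OF that(1)] below[OF that(2)] by simp
    qed
    have xb: "x b (g a) = f (g a)" using below[OF that(2,3)] .
    have xa: "x a (g a) \<noteq> f (g a)" using gD[OF that(1)] by (simp add: D_def)
    show ?thesis
    proof (cases "up a")
      case True
      then have "lt A b a"
        unfolding up_def using eq xb by (intro lexlI[of "g a"]) auto
      with True show ?thesis by simp
    next
      case False
      then have "lt A a b"
        unfolding up_def using eq xb xa by (intro lexlI[of "g a"]) (auto split: if_splits)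
      with False show ?thesis by simp
    qed
  qed
  define R where "R m = {a\<in>S. to_nat (x a (g a), up a) = m}" for m
  have "sigS (lt A) (R m)" for m
  proof (cases "R m = {}")
    case True
    then show ?thesis by (intro sigS_antichain) auto
  next
    case False
    then obtain c where c: "c \<in> R m" by blast
    define v where "v = x c (g c)"
    have R: "a \<in> S \<and> x a (g a) = v \<and> up a = up c" if "a \<in> R m" for a
      using that c by (auto simp: R_def v_def)
    show ?thesis
    proof (rule sigS_monotone[where g = g])
      have "g b \<le> g a" if "up c" "a \<in> R m" "b \<in> R m" "lt A a b" for a b
      proof (rule ccontr)
        assume "\<not> g b \<le> g a"
        then have "lt A b a" using cmp[of a b] R[OF that(2)] R[OF that(3)] that(1) by simp
        with that(4) show False using lexl_asym by blast
      qed
      moreover have "g a \<le> g b" if "\<not> up c" "a \<in> R m" "b \<in> R m" "lt A a b" for a b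
      proof (rule ccontr)
        assume "\<not> g a \<le> g b"
        then have "lt A b a" using cmp[of b a] R[OF that(2)] R[OF that(3)] that(1) by simp
        with that(4) show False using lexl_asym by blast
      qed
      ultimately show "(\<forall>a\<in>R m. \<forall>b\<in>R m. lt A a b \<longrightarrow> g a \<le> g b) \<or> (\<forall>a\<in>R m. \<forall>b\<in>R m. lt A a b \<longrightarrow> g b \<le> g a)"
        by blast
      fix p
      show "sigS (lt A) {a\<in>R m. g a = p}"
      proof (rule Suc.IH[where f = "f(p := v)"])
        fix a assume "a \<in> {a\<in>R m. g a = p}"
        then have a: "a \<in> S" "x a p = v" "g a = p" using R by auto
        then have "p \<in> D a" using gD by metis
        have "{q. fst q < sc a \<and> x a q \<noteq> (f(p := v)) q} = D a - {p}"
          using a(2) by (auto simp: D_def)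
        then show "finite {q. fst q < sc a \<and> x a q \<noteq> (f(p := v)) q} \<and>
            card {q. fst q < sc a \<and> x a q \<noteq> (f(p := v)) q} = n"
          using fin[OF a(1)] \<open>p \<in> D a\<close> by simp
      qed
    qed
  qed
  then have "sigS (lt A) (\<Union>m. R m)" by (rule sigS_UN)
  moreover have "S \<subseteq> (\<Union>m. R m)" by (auto simp: R_def)
  ultimately show ?case by (rule sigS_subset)
qed

lemma bounded_imp_sigS:
  assumes "\<not> unbdd S"
  shows "sigS (lt A) S"
proof -
  obtain b where b: "\<And>a. a \<in> S \<Longrightarrow> a \<le> b"
    using assms unfolding unbdd_def by (meson not_le)
  define D where "D a = {p. fst p < sc a \<and> x a p \<noteq> e (sc b) p}" for a
  have fin: "finite (D a)" if "a \<in> S" for a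
  proof -
    have "sc a \<le> sc b" using b[OF that] sc_gt[of b] by (intro sc_le) simp
    then show ?thesis unfolding D_def using node_diff[OF node_x node_e] by blast
  qed
  have "sigS (lt A) {a\<in>S. card (D a) = n}" for n
    by (rule sigS_finite_difference[where f = "e (sc b)" and n = n]) (use fin in \<open>auto simp: D_def\<close>)
  then have "sigS (lt A) (\<Union>n. {a\<in>S. card (D a) = n})" by (rule sigS_UN)
  then show ?thesis by (rule sigS_subset) auto
qed

subsection \<open>Unbounded sets are not\<close>

lemma node_block:
  assumes "node e a w" "finite {n. s n \<noteq> 1}"
  shows "node e (sc a) (\<lambda>p. if fst p < a then w p else s (snd p))"
proof (rule node_change[OF node_paste[OF assms(1) _ node_e[of "sc a" "sc a"]]])
  show "finite {p. fst p < sc a \<and> (if fst p < a then w p else s (snd p)) \<noteq> (if fst p < a then w p else e (sc a) p)}"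
  proof (rule finite_subset[of _ "Pair a ` {n. s n \<noteq> 1}"])
    show "{p. fst p < sc a \<and> (if fst p < a then w p else s (snd p)) \<noteq> (if fst p < a then w p else e (sc a) p)}
      \<subseteq> Pair a ` {n. s n \<noteq> 1}"
    proof
      fix p assume p: "p \<in> {p. fst p < sc a \<and> (if fst p < a then w p else s (snd p)) \<noteq> (if fst p < a then w p else e (sc a) p)}"
      obtain c n where c: "p = (c, n)" by (cases p)
      with p have "c = a" by (auto simp: less_sc_iff split: if_splits)
      with p c have "s n \<noteq> 1" by (auto simp: e_sc)
      with \<open>c = a\<close> c show "p \<in> Pair a ` {n. s n \<noteq> 1}" by simp
    qed
  qed (use assms(2) in simp)
qed (use sc_gt[of a] in auto)

lemma nice_block:
  assumes "node e a w" "finite {n. s n \<noteq> 1}" "\<And>n. 0 \<le> wt (s n)"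
  shows "nice a (sc a) (\<lambda>p. if fst p < a then w p else s (snd p))"
  using node_ok[OF node_block[OF assms(1,2)]]
proof (rule nice_if_nonneg)
  fix z assume "(a, 0::nat) \<le> z" "z < (sc a, 0)"
  then have "\<not> fst z < a" by (simp add: pos_height_le)
  then show "0 \<le> wt (if fst z < a then w z else s (snd z))" using assms(3) by simp
qed

text \<open>Above the node \<open>w\<close> supplied by \<open>x_extends_node\<close>, the block at
  \<open>h\<close> may be filled with any values of nonnegative weight, almost all equal to
  \<open>1\<close>. Applying \<open>raise\<close> to the finitely many nonzero digits of a rational
  gives such values, and sends the digit \<open>0\<close> to the default \<open>1\<close>.\<close>

lemma unbdd_imp_not_noQ:
  assumes "unbdd S"
  shows "\<not> noQ (lt A) S"
proof -
  obtain h w where w: "node e h w" "\<And>b u. h \<le> b \<Longrightarrow> node e b u \<Longrightarrow> agree h w u \<Longrightarrow> nice h b u \<Longrightarrow>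
     \<exists>c\<in>S. b \<le> sc c \<and> agree b u (x c)"
    using x_extends_node[OF assms] by blast
  \<comment> \<open>The negation undoes the reversal of the order at the heights in
    \<open>A\<close>.\<close>
  define r :: "rat \<Rightarrow> rat" where "r q = (if h \<in> A then - q else q)" for q
  define s where "s q n = 3 * digit (r q) n + 1" for q n
  define u where "u q = (\<lambda>p. if fst p < h then w p else s q (snd p))" for q
  have s: "finite {n. s q n \<noteq> 1}" "0 \<le> wt (s q n)" for q n
  proof -
    show "finite {n. s q n \<noteq> 1}" using finite_digit[of "r q"] by (simp add: s_def)
    have "s q n = raise (digit (r q) n)" by (simp add: s_def raise_def)
    then show "0 \<le> wt (s q n)" using wt_ge[of "digit (r q) n"] by simp
  qed
  have "\<exists>c\<in>S. agree (sc h) (u q) (x c)" for q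
  proof -
    have "h \<le> sc h" using sc_gt[of h] by simp
    moreover have "node e (sc h) (u q)" unfolding u_def using w(1) s(1) by (rule node_block)
    moreover have "nice h (sc h) (u q)" unfolding u_def using w(1) s by (rule nice_block)
    moreover have "agree h w (u q)" by (simp add: agree_def u_def)
    ultimately show ?thesis using w(2) by blast
  qed
  then obtain f where f: "\<And>q. f q \<in> S" "\<And>q. agree (sc h) (u q) (x (f q))" by metis
  have "lt A (f q) (f q')" if "q < q'" for q q'
  proof -
    have "\<exists>n. (\<forall>m<n. s q m = s q' m) \<and> (if h \<in> A then s q' n < s q n else s q n < s q' n)"
    proof (cases "h \<in> A")
      case True
      then have "r q' < r q" using that by (simp add: r_def)
      then obtain n where "\<And>m. m < n \<Longrightarrow> digit (r q') m = digit (r q) m" "digit (r q') n < digit (r q) n"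
        by (rule digit_less) blast
      with True show ?thesis unfolding s_def by (intro exI[of _ n]) simp
    next
      case False
      then have "r q < r q'" using that by (simp add: r_def)
      then obtain n where "\<And>m. m < n \<Longrightarrow> digit (r q) m = digit (r q') m" "digit (r q) n < digit (r q') n"
        by (rule digit_less) blast
      with False show ?thesis unfolding s_def by (intro exI[of _ n]) simp
    qed
    then obtain n where n: "\<And>m. m < n \<Longrightarrow> s q m = s q' m" "if h \<in> A then s q' n < s q n else s q n < s q' n"
      by blast
    have xu: "x (f q) p = u q p" if "fst p \<le> h" for p q
      using agreeD[OF f(2)[of q], of p] that by (simp add: less_sc_iff)
    show ?thesis
    proof (rule lexlI[of "(h, n)"])
      fix p assume p: "p < (h, n)"
      then have "fst p \<le> h" by (cases p) auto
      then show "x (f q) p = x (f q') p" using p n(1) by (cases p) (auto simp: xu u_def)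
    next
      show "if fst (h, n) \<in> A then x (f q') (h, n) < x (f q) (h, n) else x (f q) (h, n) < x (f q') (h, n)"
        using n(2) by (simp add: xu u_def)
    qed
  qed
  with f(1) show ?thesis unfolding noQ_def by blast
qed

lemma sigS_iff_bounded: "sigS (lt A) S \<longleftrightarrow> \<not> unbdd S"
proof
  assume "sigS (lt A) S"
  then obtain F :: "nat \<Rightarrow> 'k set" where F: "S \<subseteq> (\<Union>n. F n)" "\<And>n. noQ (lt A) (F n)"
    unfolding sigS_def by blast
  show "\<not> unbdd S"
  proof
    assume "unbdd S"
    define g where "g a = (SOME n. a \<in> F n)" for a
    have g: "a \<in> F (g a)" if "a \<in> S" for a
      unfolding g_def using F(1) that by (metis UN_E someI_ex subsetD)
    obtain n where n: "unbdd {a\<in>S. g a = n}"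
      using unbdd_pigeonhole[OF \<open>unbdd S\<close> small_nat, of g] by blast
    have "{a\<in>S. g a = n} \<subseteq> F n" using g by auto
    then show False using unbdd_imp_not_noQ[OF n] noQ_subset[OF F(2)[of n]] by blast
  qed
qed (rule bounded_imp_sigS)

subsection \<open>Rigidity\<close>

lemma small_nodes: "\<exists>I :: ('k \<times> nat \<Rightarrow> int) set. small K I \<and> (\<forall>t. node e d t \<longrightarrow> (\<exists>s\<in>I. agree d t s))"
proof -
  define app where "app l p = (case map_of l p of None \<Rightarrow> e d p | Some v \<Rightarrow> v)"
    for l :: "(('k \<times> nat) \<times> int) list" and p
  have "small K (lists (({..<d} \<times> (UNIV :: nat set)) \<times> (UNIV :: int set)))"
    by (intro small_lists small_Times small_lessThan small_countable) auto
  then have "small K (app ` lists (({..<d} \<times> UNIV) \<times> UNIV))" by (rule small_image)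
  moreover have "\<exists>s\<in>app ` lists (({..<d} \<times> UNIV) \<times> UNIV). agree d t s" if t: "node e d t" for t
  proof -
    define M where "M = {p. fst p < d \<and> t p \<noteq> e d p}"
    have "finite M" using t by (simp add: M_def node_def)
    then obtain l0 where l0: "set l0 = M" using finite_list by blast
    define l where "l = map (\<lambda>p. (p, t p)) l0"
    have "app l p = t p" if "fst p < d" for p
      using that by (auto simp: app_def l_def map_of_map_restrict l0 restrict_map_def M_def)
    moreover have "l \<in> lists (({..<d} \<times> UNIV) \<times> UNIV)"
      using l0 by (auto simp: l_def M_def)
    ultimately show ?thesis unfolding agree_def by (metis imageI)
  qed
  ultimately show ?thesis by blast
qed

text \<open>Coherence forces an embedding to change a stationary set of members only below a fixed
  height; sealing then yields two such members which first differ at a position where \<^term>\<open>A\<close>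
  and \<^term>\<open>B\<close> disagree and where their images have the same two values.\<close>

lemma rigid:
  assumes f: "\<And>a b. lt A a b \<Longrightarrow> lt B (f a) (f b)" and AB: "unbdd {d. (d \<in> A) \<noteq> (d \<in> B)}"
  shows False
proof -
  have inj: "a = b" if "f a = f b" for a b
    using that f[of a b] f[of b a] lexl_total[of "x a" "x b" A] lexl_irrefl inj_eq[OF inj_x] by metis
  define S where "S d = {a. d < a \<and> a \<le> f a \<and> (\<forall>p. fst p < a \<and> x a p \<noteq> x (f a) p \<longrightarrow> fst p < d)}" for d
  have "\<exists>d. unbdd (S d)"
  proof (rule ccontr)
    assume "\<not> ?thesis"
    then have "\<forall>d. \<exists>b. \<forall>a\<in>S d. a \<le> b" unfolding unbdd_def by (metis not_le)
    then obtain g where g: "\<And>d a. a \<in> S d \<Longrightarrow> a \<le> g d" by metis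
    \<comment> \<open>\<open>h\<close> inverts \<open>f\<close>, so a closure point \<open>d\<close>
      of \<open>h\<close> satisfies \<open>d \<le> f d\<close>. The finitely many differences below
      the limit \<open>d\<close> end below some \<open>c < d\<close>, so \<open>d\<close> belongs to
      \<open>S c\<close>, against \<open>g c < d\<close>. This does the work of pressing
      down.\<close>
    define h where "h b = (if \<exists>a. f a = b then THE a. f a = b else b)" for b
    have h: "h (f a) = a" for a
      unfolding h_def using inj by (metis (mono_tags, lifting) the_equality)
    obtain d where d: "d \<in> closed_under (\<lambda>b. max (g b) (h b))"
      using unbdd_closed_under unfolding unbdd_def by blast
    have "d \<le> f d"
    proof (rule ccontr)
      assume "\<not> d \<le> f d"
      then have "h (f d) < d" using closed_underD[OF d, of "f d"] by simp
      then show False by (simp add: h)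
    qed
    define M where "M = {p. fst p < d \<and> x d p \<noteq> x (f d) p}"
    have "finite M"
      unfolding M_def
    proof (rule node_diff)
      show "node e d (x d)" by (rule node_mono[OF node_x]) (simp add: sc_gt less_imp_le)
      have "d \<le> sc (f d)" using \<open>d \<le> f d\<close> sc_gt[of "f d"] by simp
      then show "node e d (x (f d))" by (rule node_mono[OF node_x])
    qed
    have "\<exists>c<d. \<forall>p\<in>M. fst p < c"
      using \<open>finite M\<close> M_def
    proof -
      have lim: "d \<in> acc UNIV" using d by (simp add: closed_under_def)
      obtain o' where "o' < d" using lim by (auto simp: acc_UNIV_iff)
      define c where "c = Max (insert o' (fst ` M))"
      have "c \<in> insert o' (fst ` M)" unfolding c_def using \<open>finite M\<close> by (intro Max_in) auto
      then have "c < d" using \<open>o' < d\<close> by (auto simp: M_def)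
      moreover have "fst p \<le> c" if "p \<in> M" for p
        unfolding c_def using \<open>finite M\<close> that by (intro Max_ge) auto
      ultimately show ?thesis using sc_less_limit[OF lim] less_sc_iff by blast
    qed
    then obtain c where c: "c < d" "\<forall>p\<in>M. fst p < c" by blast
    then have "d \<in> S c" using \<open>d \<le> f d\<close> unfolding S_def M_def by blast
    then have "d \<le> g c" by (rule g)
    moreover have "g c < d" using closed_underD[OF d c(1)] by simp
    ultimately show False by simp
  qed
  then obtain d where d: "unbdd (S d)" by blast
  obtain I :: "('k \<times> nat \<Rightarrow> int) set" where I: "small K I" "\<And>t. node e d t \<Longrightarrow> \<exists>s\<in>I. agree d t s"
    using small_nodes by blast
  \<comment> \<open>Level \<open>d\<close> has few nodes, so unboundedly many images share their
    part \<open>v\<close> below \<open>d\<close>. Together with membership in \<open>S d\<close>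
    this determines \<open>x (f a)\<close> below height \<open>a\<close> from
    \<open>x a\<close>.\<close>
  define g where "g a = (SOME s. s \<in> I \<and> agree d (x (f a)) s)" for a
  have g: "g a \<in> I \<and> agree d (x (f a)) (g a)" if "a \<in> S d" for a
  proof -
    have "d < a" "a \<le> f a" using that by (auto simp: S_def)
    then have "d \<le> sc (f a)" using sc_gt[of "f a"] by simp
    then have "\<exists>s\<in>I. agree d (x (f a)) s" using I(2) node_mono[OF node_x] by blast
    then show ?thesis unfolding g_def by (metis (mono_tags, lifting) someI_ex)
  qed
  obtain v where v: "unbdd {a\<in>S d. g a = v}"
    using unbdd_pigeonhole[OF d I(1), of g] g by blast
  define X where "X = (\<lambda>a. (a, x a)) ` {a\<in>S d. g a = v}"
  have "\<exists>h w. node e h w \<and> (\<forall>b u. h \<le> b \<longrightarrow> node e b u \<longrightarrow> agree h w u \<longrightarrow> nice h b u \<longrightarrow>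
     (\<exists>c y. (c, y) \<in> X \<and> b \<le> c \<and> agree b u y))"
  proof (rule sealing)
    show "node e c y" if "(c, y) \<in> X" for c y
      using that node_mono[OF node_x less_imp_le[OF sc_gt]] by (auto simp: X_def)
    show "\<exists>c y. (c, y) \<in> X \<and> b \<le> c" for b
    proof -
      obtain c where "c \<in> {a\<in>S d. g a = v}" "b < c" using v unfolding unbdd_def by blast
      then show ?thesis unfolding X_def by (metis (no_types, lifting) image_eqI less_imp_le)
    qed
  qed
  then obtain h w where w: "node e h w" "\<And>b u. h \<le> b \<Longrightarrow> node e b u \<Longrightarrow> agree h w u \<Longrightarrow> nice h b u \<Longrightarrow>
     \<exists>c y. (c, y) \<in> X \<and> b \<le> c \<and> agree b u y" by blast
  obtain k where k: "max d h < k" "(k \<in> A) \<noteq> (k \<in> B)" using AB unfolding unbdd_def by blast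
  then have hk: "h \<le> k" by (metis less_imp_le max_less_iff_conj)
  obtain u where u: "node e k u" "agree h w u" "nice h k u" using extend_nice[OF w(1) hk] by blast
  \<comment> \<open>The value \<open>i\<close> will be \<open>1\<close> and \<open>4\<close>. Their
    weights \<open>0\<close> and \<open>1\<close> are nonnegative, so both continuations of
    \<open>u\<close> through block \<open>k\<close> are nice and lead to members of the sealed
    set.\<close>
  have ex: "\<exists>a\<in>S d. g a = v \<and> agree (sc k) (\<lambda>p. if fst p < k then u p else if snd p = 0 then i else 1) (x a) \<and> k < a"
    if i: "0 \<le> wt i" for i
  proof -
    define s where "s n = (if n = 0 then i else 1)" for n :: nat
    have s: "finite {n. s n \<noteq> 1}" "\<And>n. 0 \<le> wt (s n)"
      using i by (auto simp: s_def)
    define u' where "u' = (\<lambda>p. if fst p < k then u p else s (snd p))"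
    have n: "node e (sc k) u'" unfolding u'_def using u(1) s(1) by (rule node_block)
    have ag: "agree k u u'" by (simp add: agree_def u'_def)
    have "nice k (sc k) u'" unfolding u'_def using u(1) s by (rule nice_block)
    from nice_trans[OF nice_cong[OF ag u(3)] this hk] have "nice h (sc k) u'" .
    moreover have "agree h w u'" using u(2) agree_mono[OF ag hk] by (rule agree_trans)
    moreover have "h \<le> sc k" using hk sc_gt[of k] by simp
    ultimately obtain c y where c: "(c, y) \<in> X" "sc k \<le> c" "agree (sc k) u' y" using w(2) n by blast
    have "c \<in> S d" "g c = v" "y = x c" using c(1) by (auto simp: X_def)
    moreover have "k < c" using sc_gt c(2) by (rule less_le_trans)
    moreover have "(\<lambda>p. if fst p < k then u p else if snd p = 0 then i else 1) = u'"
      by (rule ext) (simp add: u'_def s_def)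
    ultimately show ?thesis using c(3) by blast
  qed
  obtain a where a: "a \<in> S d" "g a = v"
    "agree (sc k) (\<lambda>p. if fst p < k then u p else if snd p = 0 then 1 else 1) (x a)" "k < a"
    using ex[of 1] unfolding wt_1 by blast
  have "(0::int) \<le> wt 4" by simp
  from ex[OF this] obtain b where b: "b \<in> S d" "g b = v"
    "agree (sc k) (\<lambda>p. if fst p < k then u p else if snd p = 0 then 4 else 1) (x b)" "k < b"
    by blast
  have xa: "x a p = (if fst p < k then u p else 1)" if "fst p \<le> k" for p
    using agreeD[OF a(3), of p] that by (auto simp: less_sc_iff)
  have xb: "x b p = (if fst p < k then u p else if snd p = 0 then 4 else 1)" if "fst p \<le> k" for p
    using agreeD[OF b(3), of p] that by (auto simp: less_sc_iff)
  have xf: "x (f c) p = (if fst p < d then v p else x c p)" if "c \<in> S d" "g c = v" "k < c" "fst p \<le> k" for c p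
  proof (cases "fst p < d")
    case True
    then show ?thesis using g[OF that(1)] that(2) by (auto simp: agree_def)
  next
    case False
    moreover have "fst p < c" using that(4,3) by (rule le_less_trans)
    ultimately show ?thesis using that(1) unfolding S_def by auto
  qed
  have "d < k" using k(1) by (metis max_less_iff_conj)
  then have dk: "\<not> k < d" by (rule less_not_sym)
  have 1: "\<And>q. q < (k, 0) \<Longrightarrow> x a q = x b q" "x a (k, 0) = 1" "x b (k, 0) = 4"
    using xa xb by (auto simp: pos_less_height)
  have 2: "\<And>q. q < (k, 0) \<Longrightarrow> x (f a) q = x (f b) q" "x (f a) (k, 0) = 1" "x (f b) (k, 0) = 4"
    using xf[OF a(1,2,4)] xf[OF b(1,2,4)] xa xb dk by (auto simp: pos_less_height)
  have "lt A a b \<longleftrightarrow> k \<notin> A" using lexl_iff[of "(k, 0)" "x a" "x b" A] 1 by auto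
  moreover have "lt A b a \<longleftrightarrow> k \<in> A" using lexl_iff[of "(k, 0)" "x b" "x a" A] 1 by auto
  moreover have "lt B (f a) (f b) \<longleftrightarrow> k \<notin> B" using lexl_iff[of "(k, 0)" "x (f a)" "x (f b)" B] 2 by auto
  moreover have "lt B (f b) (f a) \<longleftrightarrow> k \<in> B" using lexl_iff[of "(k, 0)" "x (f b)" "x (f a)" B] 2 by auto
  ultimately show False using f[of a b] f[of b a] k(2) by blast
qed

end

subsection \<open>Minimality\<close>

definition lift :: "'k::wellorder \<Rightarrow> int \<Rightarrow> ('k \<times> nat \<Rightarrow> int) \<Rightarrow> 'k \<times> nat \<Rightarrow> int" where
  "lift h b u = wfrec {(x, y). x < y} (\<lambda>f p. if (h, 0) \<le> p \<and> dep f p = b then raise (u p) else u p)"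

lemma lift_unfold:
  "lift h b u p = (if (h, 0) \<le> p \<and> dep (lift h b u) p = b then raise (u p) else u p)"
proof -
  let ?H = "\<lambda>f p. if (h, 0) \<le> p \<and> dep f p = b then raise (u p) else u p"
  have "lift h b u p = ?H (cut (lift h b u) {(x, y). x < y} p) p"
    unfolding lift_def by (rule wfrec[OF wf_less_rel])
  moreover have "dep (cut (lift h b u) {(x, y). x < y} p) p = dep (lift h b u) p"
    by (rule dep_cong) (simp add: cut_apply del: less_prod_simp)
  ultimately show ?thesis by simp
qed

lemma lift_eq_below:
  assumes "\<And>q. q < p \<Longrightarrow> s q = t q" "q < p"
  shows "lift h b s q = lift h b t q"
  using assms(2)
proof (induction q rule: less_induct)
  case (less q)
  have "dep (lift h b s) q = dep (lift h b t) q"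
    by (rule dep_cong) (use less in \<open>meson less_trans\<close>)
  then show ?case using assms(1)[OF less.prems] by (simp only: lift_unfold[of h b s q] lift_unfold[of h b t q])
qed

text \<open>At the first difference the results agree so far and have the same depth. Hence both
  values are raised or neither is, and \<open>raise\<close> is strictly increasing.\<close>

lemma lift_less_iff:
  assumes "\<And>q. q < p \<Longrightarrow> s q = t q"
  shows "lift h b s p < lift h b t p \<longleftrightarrow> s p < t p"
proof -
  have "dep (lift h b s) p = dep (lift h b t) p"
    using lift_eq_below[OF assms] by (intro dep_cong)
  then show ?thesis by (simp only: lift_unfold[of h b s p] lift_unfold[of h b t p]) simp
qed

lemma finite_if_initial_segments_bounded:
  fixes M :: "'p::wellorder set"
  assumes "\<And>z. z \<in> M \<Longrightarrow> finite {y\<in>M. y < z} \<and> card {y\<in>M. y < z} \<le> N"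
  shows "finite M"
proof (rule ccontr)
  assume "infinite M"
  then obtain F where F: "finite F" "card F = Suc (Suc N)" "F \<subseteq> M"
    using infinite_arbitrarily_large by blast
  define z where "z = Max F"
  have "F \<noteq> {}" using F(2) by auto
  then have z: "z \<in> F" "\<And>y. y \<in> F \<Longrightarrow> y \<le> z" using F(1) by (auto simp: z_def)
  have "F - {z} \<subseteq> {y\<in>M. y < z}" using z F(3) by (auto simp: le_less)
  moreover have "z \<in> M" using z(1) F(3) by blast
  ultimately have "card (F - {z}) \<le> N"
    using assms[of z] card_mono order_trans by metis
  then show False using F z(1) by simp
qed

lemma strict_mono_le_self:
  fixes \<pi> :: "'k::wellorder \<Rightarrow> 'k"
  assumes "strict_mono \<pi>"
  shows "a \<le> \<pi> a"
proof (induction a rule: less_induct)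
  case (less a)
  show ?case
  proof (rule ccontr)
    assume "\<not> a \<le> \<pi> a"
    then have "\<pi> a < a" by simp
    with less have "\<pi> a \<le> \<pi> (\<pi> a)" by blast
    moreover have "\<pi> (\<pi> a) < \<pi> a" using assms \<open>\<pi> a < a\<close> by (rule strict_monoD)
    ultimately show False by simp
  qed
qed

context coherent_tree
begin

text \<open>Each modified position raises the difference of the two depths by one, while at modified
  positions the new depth is the constant \<^term>\<open>b\<close>; infinitely many of them would drive the
  old depth to minus infinity.\<close>

lemma lift_node:
  assumes u: "node e c u" and hc: "h \<le> c" and b: "b = dep u (h, 0)"
  shows "node e c (lift h b u) \<and> nice h c (lift h b u) \<and> agree h u (lift h b u)"
proof -
  define v where "v = lift h b u"
  have v: "v p = (if (h, 0) \<le> p \<and> dep v p = b then raise (u p) else u p)" for p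
    unfolding v_def by (rule lift_unfold)
  have rne: "raise z \<noteq> z" for z unfolding raise_def by presburger
  have ag: "agree h u v"
    unfolding agree_def
  proof (intro allI impI)
    fix p :: "'k \<times> nat" assume "fst p < h"
    then have "\<not> (h, 0::nat) \<le> p" by (simp add: pos_height_le not_le)
    then show "u p = v p" using v[of p] by simp
  qed
  have dvh: "dep v (h, 0) = b" using agree_dep[OF ag order_refl] b by simp
  have P: "finite {p. p < q \<and> v p \<noteq> u p} \<and> ok v q \<and> b \<le> dep v q" if "(h, 0) \<le> q" "q \<le> (c, 0)" for q
    using that
  proof (induction q rule: less_induct)
    case (less q)
    define M where "M = {p. p < q \<and> v p \<noteq> u p}"
    have M: "(h, 0) \<le> z \<and> dep v z = b \<and> v z = raise (u z) \<and> z < q" if "z \<in> M" for z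
      using that v[of z] by (auto simp: M_def split: if_splits)
    have oku: "ok u q" using node_ok[OF u] less.prems(2) by (rule ok_mono)
    have seg: "finite {y\<in>M. y < z} \<and> dep v z = dep u z + card {y\<in>M. y < z}" if "z < q" "(h, 0) \<le> z" for z
    proof -
      have eq: "{y\<in>M. y < z} = {p. p < z \<and> v p \<noteq> u p}"
        using that(1) unfolding M_def by (auto intro: less_trans simp del: less_prod_simp)
      have "z \<le> (c, 0)" using that(1) less.prems(2) by simp
      then have fin: "finite {y\<in>M. y < z}" using less.IH[OF that] eq by simp
      have "dep v z = dep u z + (\<Sum>y\<in>{y\<in>{y\<in>M. y < z}. y < z}. wt (v y) - wt (u y))"
      proof -
        have "ok u z" using ok_mono[OF oku] that(1) by simp
        from dep_finite_change[OF fin this, of v] show ?thesis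
          using that(1) by (auto simp: M_def simp del: less_prod_simp)
      qed
      also have "{y\<in>{y\<in>M. y < z}. y < z} = {y\<in>M. y < z}" by blast
      also have "(\<Sum>y\<in>{y\<in>M. y < z}. wt (v y) - wt (u y)) = (\<Sum>y\<in>{y\<in>M. y < z}. 1)"
        by (rule sum.cong) (use M in auto)
      finally show ?thesis using fin by simp
    qed
    have finM: "finite M"
    proof (cases "(h, 0) < q")
      case False
      then have "M = {}" using M by (meson all_not_in_conv le_less_trans)
      then show ?thesis by simp
    next
      case True
      \<comment> \<open>Beyond \<open>a\<close> the old depth never falls below
        \<open>dep u q\<close>. At a modified position the new depth is \<open>b\<close>, so at most
        \<open>b - dep u q\<close> modifications can precede it.\<close>
      obtain a where a: "a < q" "\<forall>p. a < p \<and> p \<le> q \<longrightarrow> dep u q \<le> dep u p"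
        using dep_eventually_ge[OF oku True] by blast
      define a' where "a' = max a (h, 0)"
      have a': "a' < q" "(h, 0) \<le> a'" using a(1) True by (auto simp: a'_def)
      have "finite {y\<in>M. a' < y}"
      proof (rule finite_if_initial_segments_bounded)
        fix z assume z: "z \<in> {y\<in>M. a' < y}"
        then have z': "z < q" "(h, 0) \<le> z" "dep v z = b" using M by auto
        have "a < z" using z by (auto simp: a'_def simp del: less_prod_simp)
        then have "dep u q \<le> dep u z" using a(2) z'(1) by simp
        then have "int (card {y\<in>M. y < z}) \<le> b - dep u q" using seg[OF z'(1,2)] z'(3) by simp
        then have "card {y\<in>M. y < z} \<le> nat (b - dep u q)" by linarith
        moreover have sub: "{y\<in>{y\<in>M. a' < y}. y < z} \<subseteq> {y\<in>M. y < z}" by blast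
        moreover have "finite {y\<in>M. y < z}" using seg[OF z'(1,2)] by blast
        ultimately show "finite {y\<in>{y\<in>M. a' < y}. y < z} \<and> card {y\<in>{y\<in>M. a' < y}. y < z} \<le> nat (b - dep u q)"
          by (meson card_mono finite_subset order_trans)
      qed
      moreover have "finite {y\<in>M. y < a'}" using seg[OF a'] by blast
      moreover have "M \<subseteq> insert a' ({y\<in>M. y < a'} \<union> {y\<in>M. a' < y})"
        using linorder_cases[of _ a'] by blast
      ultimately show ?thesis by (meson finite_UnI finite_insert finite_subset)
    qed
    have okv: "ok v q" using dep_finite_change[OF finM oku, of v] by (auto simp: M_def simp del: less_prod_simp)
    have "b \<le> dep v q"
      using okv less.prems(1)
    proof (rule dep_ge_limit)
      fix z assume z: "(h, 0) \<le> z" "z < q"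
      then have "z \<le> (c, 0)" using less.prems(2) by simp
      then have "b \<le> dep v z" using less.IH[OF z(2,1)] by blast
      \<comment> \<open>Weights are at least \<open>-1\<close>, so from a depth above
        \<open>b\<close> one step cannot pass below \<open>b\<close>; at depth \<open>b\<close> the
        raised value has nonnegative weight.\<close>
      then show "b \<le> dep v z + wt (v z)"
        using v[of z] z(1) wt_ge[of "u z"] wt_ge[of "v z"] by (cases "dep v z = b") auto
    qed (use dvh in simp)
    with finM okv show ?case by (simp add: M_def)
  qed
  have hc': "(h, 0) \<le> (c, 0::nat)" using hc by auto
  have "node e c v"
  proof (rule node_change[OF u])
    show "finite {p. fst p < c \<and> v p \<noteq> u p}"
      using P[OF hc' order_refl] by (simp only: pos_less_height)
  qed
  moreover have "nice h c v" unfolding nice_def using P dvh by simp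
  ultimately show ?thesis using ag by (simp add: v_def)
qed

text \<open>Moves the part below \<^term>\<open>\<theta>\<close> of a node into \<^term>\<open>{h..<\<theta>}\<close>, relative to \<^term>\<open>e \<theta>\<close>,
  with a change of sign where \<^term>\<open>\<pi>\<close> crosses between \<^term>\<open>A\<close> and its complement.\<close>

definition move :: "'k set \<Rightarrow> 'k \<Rightarrow> ('k \<times> nat \<Rightarrow> int) \<Rightarrow> 'k \<Rightarrow> ('k \<Rightarrow> 'k) \<Rightarrow> ('k \<times> nat \<Rightarrow> int) \<Rightarrow> 'k \<times> nat \<Rightarrow> int" where
  "move A h w \<theta> \<pi> t p =
     (if fst p < h then w p
      else if \<theta> \<le> fst p then t p
      else if fst p \<in> range \<pi> then
        (let a = inv \<pi> (fst p) in
         e \<theta> p + (if a \<in> A \<longleftrightarrow> fst p \<in> A then 1 else -1) * (t (a, snd p) - e \<theta> (a, snd p)))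
      else e \<theta> p)"

lemma move_node:
  assumes w: "node e h w" and "h \<le> \<theta>" "\<theta> \<le> c" and t: "node e c t" and \<pi>: "strict_mono \<pi>"
  shows "node e c (move A h w \<theta> \<pi> t)"
proof (rule node_change[OF node_paste[OF node_e[of \<theta> \<theta>] assms(3) t]])
  have inj: "inj \<pi>" using \<pi> by (rule strict_mono_imp_inj_on)
  let ?D1 = "{p. fst p < h \<and> w p \<noteq> e \<theta> p}" and ?D2 = "{p. fst p < \<theta> \<and> t p \<noteq> e \<theta> p}"
  have fin: "finite ?D1" "finite ?D2"
    using node_diff[OF w node_e[OF assms(2)]] node_mono[OF t assms(3)] by (auto simp: node_def)
  show "finite {p. fst p < c \<and> move A h w \<theta> \<pi> t p \<noteq> (if fst p < \<theta> then e \<theta> p else t p)}"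
  proof (rule finite_subset)
    show "{p. fst p < c \<and> move A h w \<theta> \<pi> t p \<noteq> (if fst p < \<theta> then e \<theta> p else t p)}
       \<subseteq> ?D1 \<union> (\<lambda>p. (\<pi> (fst p), snd p)) ` ?D2"
    proof
      fix p assume "p \<in> {p. fst p < c \<and> move A h w \<theta> \<pi> t p \<noteq> (if fst p < \<theta> then e \<theta> p else t p)}"
      then have ne: "move A h w \<theta> \<pi> t p \<noteq> (if fst p < \<theta> then e \<theta> p else t p)" by blast
      show "p \<in> ?D1 \<union> (\<lambda>p. (\<pi> (fst p), snd p)) ` ?D2"
      proof (cases "fst p < h")
        case True
        moreover have "fst p < \<theta>" using True assms(2) by (rule less_le_trans)
        ultimately show ?thesis using ne by (simp add: move_def)
      next
        case False
        with ne have lt: "fst p < \<theta>" by (auto simp: move_def split: if_splits)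
        with ne False have r: "fst p \<in> range \<pi>" by (auto simp: move_def split: if_splits)
        then obtain a where a: "fst p = \<pi> a" by blast
        then have "inv \<pi> (fst p) = a" by (simp add: inv_f_f[OF inj])
        then have "move A h w \<theta> \<pi> t p = e \<theta> p + (if a \<in> A \<longleftrightarrow> fst p \<in> A then 1 else -1) * (t (a, snd p) - e \<theta> (a, snd p))"
          using False lt r by (simp add: move_def not_le[symmetric])
        then have "t (a, snd p) \<noteq> e \<theta> (a, snd p)" using ne lt by auto
        moreover have "a \<le> \<pi> a" using \<pi> by (rule strict_mono_le_self)
        then have "a < \<theta>" using lt a by simp
        ultimately have "(a, snd p) \<in> ?D2" by simp
        then show ?thesis using a by (intro UnI2 image_eqI[of _ _ "(a, snd p)"]) (auto simp: prod_eq_iff)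
      qed
    qed
  qed (use fin in simp)
qed simp

lemma move_agree: "agree h w (move A h w \<theta> \<pi> t)"
  by (simp add: agree_def move_def)

text \<open>A first difference at height \<open>a < \<theta>\<close> is carried to height
  \<open>\<pi> a\<close>, where the sign restores the direction if exactly one of the two heights is
  in \<open>A\<close>. One at or above \<open>\<theta>\<close> stays in place, because everything
  the moved parts refer to lies below \<open>\<theta>\<close>.\<close>

lemma move_first_difference:
  assumes \<pi>: "strict_mono \<pi>" "\<And>a. h \<le> \<pi> a" "\<And>a. a < \<theta> \<Longrightarrow> \<pi> a < \<theta>" and h: "h \<le> \<theta>"
    and eq: "\<And>q. q < p \<Longrightarrow> s q = t q"
    and lt: "if fst p \<in> A then t p < s p else s p < t p"
  shows "\<exists>p'. (fst p' < \<theta> \<or> fst p' = fst p) \<and> (\<forall>q<p'. move A h w \<theta> \<pi> s q = move A h w \<theta> \<pi> t q) \<and>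
     (if fst p' \<in> A then move A h w \<theta> \<pi> t p' < move A h w \<theta> \<pi> s p' else move A h w \<theta> \<pi> s p' < move A h w \<theta> \<pi> t p')"
proof (cases "fst p < \<theta>")
  case False
  show ?thesis
  proof (intro exI[of _ p] conjI allI impI)
    fix q assume q: "q < p"
    have "s (a, n) = t (a, n)" if "a < \<theta>" for a n
      using that False by (intro eq) (auto simp: less_prod_def not_less)
    moreover have "inv \<pi> (fst q) < \<theta>" if "fst q < \<theta>" "fst q \<in> range \<pi>"
      using strict_mono_le_self[OF \<pi>(1), of "inv \<pi> (fst q)"] that by (simp add: f_inv_into_f)
    ultimately show "move A h w \<theta> \<pi> s q = move A h w \<theta> \<pi> t q"
      using eq[OF q] by (auto simp: move_def Let_def not_le)
  qed (use False h lt in \<open>auto simp: move_def not_less\<close>)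
next
  case True
  obtain a n where p: "p = (a, n)" by (cases p)
  have inj: "inj \<pi>" using \<pi>(1) by (rule strict_mono_imp_inj_on)
  have a: "\<pi> a < \<theta>" "\<not> \<pi> a < h" using \<pi>(2)[of a] \<pi>(3) True p by (auto simp: not_less)
  show ?thesis
  proof (intro exI[of _ "(\<pi> a, n)"] conjI allI impI)
    fix q assume q: "q < (\<pi> a, n)"
    obtain b m where b: "q = (b, m)" by (cases q)
    have "b < \<theta>" using q b a(1) by auto
    moreover have "s (c, m) = t (c, m)" if "b = \<pi> c" for c
    proof (rule eq)
      show "(c, m) < p"
        using q b p that strict_mono_less[OF \<pi>(1)] strict_mono_less_eq[OF \<pi>(1)] by simp
    qed
    ultimately show "move A h w \<theta> \<pi> s q = move A h w \<theta> \<pi> t q"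
      unfolding b by (auto simp: move_def Let_def inv_f_f[OF inj])
  qed (use a lt p in \<open>auto simp: move_def Let_def inv_f_f[OF inj] split: if_splits\<close>)
qed

end

section \<open>Embedding the line into its unbounded subsets\<close>

context tree_line
begin

text \<open>Writing \<open>w\<close> over the part below \<open>h\<close> would lose the differences
  there, so the part below a closure point \<open>\<theta>\<close> of \<open>\<pi>\<close> is spread
  out beyond \<open>h\<close> while the rest is kept. \<open>lift\<close> then turns the result into
  a nice extension of \<open>w\<close>, and some member indexed in \<open>R\<close> extends
  that.\<close>

lemma embeds_into_unbdd:
  assumes "unbdd R"
  shows "\<exists>f. (\<forall>a. f a \<in> R) \<and> (\<forall>a b. lt A a b \<longrightarrow> lt A (f a) (f b))"
proof -
  obtain h w where w: "node e h w" "\<And>b u. h \<le> b \<Longrightarrow> node e b u \<Longrightarrow> agree h w u \<Longrightarrow> nice h b u \<Longrightarrow>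
     \<exists>c\<in>R. b \<le> sc c \<and> agree b u (x c)"
    using x_extends_node[OF assms] by blast
  obtain \<pi> :: "'k \<Rightarrow> 'k" where \<pi>: "strict_mono \<pi>" "\<And>a. h \<le> \<pi> a" using strict_mono_above[of h] by blast
  obtain \<theta> where \<theta>: "\<theta> \<in> closed_under (\<lambda>y. max h (\<pi> y))"
    using unbdd_closed_under unfolding unbdd_def by blast
  have h\<theta>: "h \<le> \<theta>" using closed_under_gt[OF \<theta>] by simp
  have \<pi>\<theta>: "\<pi> a < \<theta>" if "a < \<theta>" for a using closed_underD[OF \<theta> that] by simp
  \<comment> \<open>Moving refers to all heights below \<open>\<theta>\<close>, so a short member is
    first prolonged to height \<open>\<theta>\<close>.\<close>
  define c where "c a = max (sc a) \<theta>" for a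
  have "\<exists>y. node e (c a) y \<and> agree (sc a) (x a) y" for a
    using extend_nice[OF node_x[of a], of "c a"] by (auto simp: c_def)
  then obtain y where y: "\<And>a. node e (c a) (y a)" "\<And>a. agree (sc a) (x a) (y a)" by metis
  define m where "m a = move A h w \<theta> \<pi> (y a)" for a
  have m: "node e (c a) (m a)" "agree h w (m a)" for a
    unfolding m_def using y(1)[of a] w(1) h\<theta> \<pi>(1) by (auto intro!: move_node move_agree simp: c_def)
  define v where "v a = lift h (dep w (h, 0)) (m a)" for a
  have hc: "h \<le> c a" for a using h\<theta> by (auto simp: c_def le_max_iff_disj)
  have v: "node e (c a) (v a) \<and> nice h (c a) (v a) \<and> agree h w (v a)" for a
    using lift_node[OF m(1) hc agree_dep[OF m(2) order_refl]] agree_trans[OF m(2)] unfolding v_def by blast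
  have "\<exists>b\<in>R. agree (c a) (v a) (x b)" for a
    using w(2)[OF hc, of a "v a"] v[of a] by blast
  then obtain f where f: "\<And>a. f a \<in> R" "\<And>a. agree (c a) (v a) (x (f a))" by metis
  have "lt A (f a) (f b)" if ab: "lt A a b" for a b
  proof -
    have "a \<noteq> b" using ab lexl_irrefl by blast
    then obtain p where p: "fst p \<le> a" "fst p \<le> b" "\<And>q. q < p \<Longrightarrow> x a q = x b q" "x a p \<noteq> x b p"
      using x_first_difference by metis
    have xy: "y d q = x d q" if "q \<le> p" "d = a \<or> d = b" for d q
    proof -
      have "fst q \<le> fst p" using that(1) by (cases q; cases p) auto
      then have "fst q < sc d" using that(2) p(1,2) by (auto simp: less_sc_iff)
      then show ?thesis using agreeD[OF y(2)] by metis
    qed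
    have "if fst p \<in> A then x b p < x a p else x a p < x b p"
      using lexl_iff[of p "x a" "x b" A] p(3,4) ab by blast
    then have "if fst p \<in> A then y b p < y a p else y a p < y b p" by (simp add: xy)
    moreover have "y a q = y b q" if "q < p" for q using that p(3) xy by simp
    ultimately obtain p' where p': "fst p' < \<theta> \<or> fst p' = fst p" "\<And>q. q < p' \<Longrightarrow> m a q = m b q"
      "if fst p' \<in> A then m b p' < m a p' else m a p' < m b p'"
      using move_first_difference[OF \<pi> \<pi>\<theta> h\<theta>, of p "y a" "y b" A w] unfolding m_def by blast
    have xv: "x (f d) q = v d q" if "q \<le> p'" "d = a \<or> d = b" for d q
    proof -
      have "fst q \<le> fst p'" using that(1) by (cases q; cases p') auto
      moreover have "fst p' < c d"
        using p'(1) that(2) p(1,2) by (auto simp: c_def less_max_iff_disj less_sc_iff)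
      ultimately have "fst q < c d" by simp
      then show ?thesis using agreeD[OF f(2)] by metis
    qed
    show ?thesis
    proof (rule lexlI[of p'])
      fix q assume "q < p'"
      then show "x (f a) q = x (f b) q"
        using lift_eq_below[of p' "m a" "m b", OF p'(2)] xv by (simp add: v_def)
    next
      show "if fst p' \<in> A then x (f b) p' < x (f a) p' else x (f a) p' < x (f b) p'"
        using p'(3) lift_less_iff[of p' "m a" "m b", OF p'(2)] lift_less_iff[of p' "m b" "m a", OF p'(2)[symmetric]]
        by (simp add: xv v_def)
    qed
  qed
  with f(1) show ?thesis by blast
qed

lemma minimal:
  "minimal_non_sigma_scattered (rel_of (lt A))"
  unfolding minimal_non_sigma_scattered_def
proof (intro conjI allI impI)
  have ss: "sigma_scattered (Restr (rel_of (lt A)) X) \<longleftrightarrow> \<not> unbdd X" for X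
    using sigma_scattered_rel_of[of "lt A" X] lexl_irrefl sigS_iff_bounded by metis
  have "unbdd (UNIV :: 'k set)" unfolding unbdd_def using ex_gt by blast
  moreover have "Restr (rel_of (lt A)) UNIV = rel_of (lt A)" by simp
  ultimately show "\<not> sigma_scattered (rel_of (lt A))" using ss[of UNIV] by simp
  fix X assume "\<not> sigma_scattered (Restr (rel_of (lt A)) X)"
  then obtain f where f: "\<And>a. f a \<in> X" "\<And>a b. lt A a b \<Longrightarrow> lt A (f a) (f b)"
    using ss embeds_into_unbdd by metis
  show "lin_embeds (rel_of (lt A)) (Restr (rel_of (lt A)) X)"
    unfolding lin_embeds_def Field_Restr_rel_of
  proof (intro exI[of _ f] conjI allI impI)
    fix a b assume "(a, b) \<in> rel_of (lt A) \<and> a \<noteq> b"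
    then have "lt A (f a) (f b)" using f(2) by (auto simp: rel_of_def)
    then show "(f a, f b) \<in> Restr (rel_of (lt A)) X" "f a \<noteq> f b"
      using f(1) lexl_irrefl[of A "x (f b)"] by (auto simp: rel_of_def)
  qed (use f(1) in auto)
qed

lemma not_lin_embeds:
  assumes "unbdd {d. (d \<in> A) \<noteq> (d \<in> B)}"
  shows "\<not> lin_embeds (rel_of (lt A)) (rel_of (lt B))"
proof
  assume "lin_embeds (rel_of (lt A)) (rel_of (lt B))"
  then obtain f where f: "\<forall>a b. (a, b) \<in> rel_of (lt A) \<and> a \<noteq> b \<longrightarrow> (f a, f b) \<in> rel_of (lt B) \<and> f a \<noteq> f b"
    unfolding lin_embeds_def by (elim exE conjE)
  have "lt B (f a) (f b)" if "lt A a b" for a b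
  proof -
    have "a \<noteq> b" using that lexl_irrefl by blast
    with spec[OF spec[OF f, of a], of b] that show ?thesis by (auto simp: rel_of_def)
  qed
  then show False using assms by (rule rigid)
qed

end

section \<open>The tree built along the proxy sequence\<close>

type_synonym 'k mods = "(('k \<times> nat) \<times> int) list"

definition overwrite :: "'k mods \<Rightarrow> ('k \<times> nat \<Rightarrow> int) \<Rightarrow> 'k \<times> nat \<Rightarrow> int" where
  "overwrite l m p = (case map_of l p of None \<Rightarrow> m p | Some v \<Rightarrow> v)"

definition below :: "'k::wellorder \<Rightarrow> 'k mods \<Rightarrow> bool" where
  "below a l \<longleftrightarrow> (\<forall>q\<in>set l. fst (fst q) < a)"

lemma overwrite_cong: "m p = m' p \<Longrightarrow> overwrite l m p = overwrite l m' p"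
  by (simp add: overwrite_def split: option.split)

lemma overwrite_above:
  assumes "below a l" "a \<le> fst p"
  shows "overwrite l m p = m p"
proof -
  have "p \<notin> fst ` set l" using assms by (auto simp: below_def)
  then have "map_of l p = None" by (simp add: map_of_eq_None_iff)
  then show ?thesis by (simp add: overwrite_def)
qed

lemma below_mono: "below a l \<Longrightarrow> a \<le> b \<Longrightarrow> below b l"
  by (auto simp: below_def)

lemma overwrite_repr:
  fixes t f :: "'k::wellorder \<times> nat \<Rightarrow> int"
  assumes "finite {p. fst p < a \<and> t p \<noteq> f p}"
  shows "\<exists>l. below a l \<and> agree a t (overwrite l f)"
proof -
  let ?M = "{p. fst p < a \<and> t p \<noteq> f p}"
  obtain l0 where l0: "set l0 = ?M" using finite_list[OF assms] by blast
  define l where "l = map (\<lambda>p. (p, t p)) l0"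
  have "overwrite l f p = t p" if "fst p < a" for p
    using that by (auto simp: overwrite_def l_def map_of_map_restrict l0 restrict_map_def)
  moreover have "below a l" using l0 by (auto simp: below_def l_def)
  ultimately show ?thesis unfolding agree_def by metis
qed

text \<open>The single visit \<^term>\<open>z\<close> to depth \<open>0\<close> in each interval of \<open>C d\<close> makes the depth \<open>0\<close> at the limit
  points of \<open>C d\<close>, and allows to recover these points from the zeros of the depth.\<close>

definition good :: "('k::wellorder \<times> nat \<Rightarrow> int) \<Rightarrow> 'k \<Rightarrow> 'k \<Rightarrow> ('k \<times> nat \<Rightarrow> int) \<Rightarrow> ('k \<times> nat \<Rightarrow> int) \<Rightarrow> bool" where
  "good s c b f m \<longleftrightarrow> agree c s m \<and> finite {p. fst p < b \<and> m p \<noteq> f p} \<and> ok m (b, 0) \<and>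
     (\<exists>z. (c, 0) \<le> z \<and> z < (b, 0) \<and> dep m z = 0 \<and> (\<forall>p. (c, 0) \<le> p \<and> p \<le> (b, 0) \<and> p \<noteq> z \<longrightarrow> 0 < dep m p))"

lemma good_cong:
  assumes "agree c s s'"
  shows "good s c b f m \<longleftrightarrow> good s' c b f m"
proof -
  have "agree c s m \<longleftrightarrow> agree c s' m"
    using agree_trans[OF assms, of m] agree_trans[OF agree_sym[OF assms], of m] by blast
  then show ?thesis by (simp only: good_def)
qed

lemma good_agree:
  assumes "good s c b f m" "agree b m m'"
  shows "\<exists>z. (c, 0) \<le> z \<and> z < (b, 0) \<and> dep m' z = 0 \<and> (\<forall>p. (c, 0) \<le> p \<and> p \<le> (b, 0) \<and> p \<noteq> z \<longrightarrow> 0 < dep m' p)"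
proof -
  obtain z where z: "(c, 0) \<le> z" "z < (b, 0)" "dep m z = 0" "\<forall>p. (c, 0) \<le> p \<and> p \<le> (b, 0) \<and> p \<noteq> z \<longrightarrow> 0 < dep m p"
    using assms(1) unfolding good_def by blast
  have "dep m' p = dep m p" if "p \<le> (b, 0)" for p using agree_dep[OF assms(2) that] by simp
  with z show ?thesis by (intro exI[of _ z]) simp
qed

locale proxy_seq = regular_uncountable K for K :: "'k::wellorder itself" +
  fixes C :: "'k \<Rightarrow> 'k set" and N :: "'k \<Rightarrow> ('k \<times> 'k mods \<times> bool) set" and cd :: "'k \<times> 'k mods \<times> bool \<Rightarrow> 'k"
  assumes club_C: "\<And>d. d \<in> acc UNIV \<Longrightarrow> club_below d (C d)"
    and coherent_C: "\<And>c d. c \<in> acc (C d) \<Longrightarrow> C c = C d \<inter> {..<c}"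
    and hit_C: "\<And>B. (\<And>i. unbdd (B i)) \<Longrightarrow> stationary {d. \<forall>i<d. isLub UNIV (nacc (C d) \<inter> B i) d}"
    and guess: "\<And>X h. \<exists>b\<in>closed_under h. \<forall>a l i. a < b \<longrightarrow> below b l \<longrightarrow> ((a, l, i) \<in> N b \<longleftrightarrow> (a, l, i) \<in> X)"
    and inj_cd: "inj cd"
begin

section \<open>Intervals between consecutive points of the clubs\<close>

definition bt :: 'k where "bt = (LEAST x. True)"

lemma bt_le: "bt \<le> a"
  unfolding bt_def by (rule Least_le) simp

lemma not_less_bt: "\<not> a < bt"
  using bt_le by (simp add: not_less)

text \<open>The least ordinal is added because the recursion along \<open>C d\<close> has to start
  there, whether or not it belongs to \<open>C d\<close>.\<close>

definition CC :: "'k \<Rightarrow> 'k set" where "CC d = insert bt (C d)"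

definition consec :: "'k \<Rightarrow> 'k \<Rightarrow> 'k \<Rightarrow> bool" where
  "consec d c b \<longleftrightarrow> c \<in> CC d \<and> b \<in> C d \<and> c < b \<and> (\<forall>y\<in>C d. \<not> (c < y \<and> y < b))"

lemma C_less: "d \<in> acc UNIV \<Longrightarrow> y \<in> C d \<Longrightarrow> y < d"
  using club_C unfolding club_below_def by blast

lemma C_cofinal:
  assumes "d \<in> acc UNIV" "y < d"
  shows "\<exists>b\<in>C d. y < b"
proof -
  have "C d \<subseteq> {..<d}" "isLub UNIV (C d) d" using club_C[OF assms(1)] unfolding club_below_def by blast+
  then show ?thesis using isLub_iff[of "C d" d] assms(2) by blast
qed

lemma C_closed:
  assumes "d \<in> acc UNIV" "b < d" "\<And>y. y < b \<Longrightarrow> \<exists>x\<in>C d. y < x \<and> x < b" "a < b"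
  shows "b \<in> acc (C d)"
proof -
  have "isLub UNIV (C d \<inter> {..<b}) b \<and> (\<exists>g. g < b) \<longrightarrow> b \<in> C d"
    using club_C[OF assms(1)] assms(2) unfolding club_below_def by blast
  moreover have "isLub UNIV (C d \<inter> {..<b}) b" unfolding isLub_Int_iff using assms(3) by blast
  ultimately have "b \<in> C d" using assms(4) by blast
  then show ?thesis unfolding acc_iff using assms(3,4) by blast
qed

lemma CC_less: "d \<in> acc UNIV \<Longrightarrow> y \<in> CC d \<Longrightarrow> y < d"
  unfolding CC_def acc_UNIV_iff using C_less[of d y] bt_le by (auto simp: acc_UNIV_iff intro: le_less_trans)

text \<open>\<open>c\<close> is the supremum of the points of \<open>CC d\<close> that are at most
  \<open>y\<close>, and is one of them because \<open>C d\<close> is closed in \<open>d\<close>;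
  \<open>b\<close> is the next point of \<open>C d\<close> above \<open>y\<close>.\<close>

lemma consec_exists:
  assumes d: "d \<in> acc UNIV" and y: "y < d"
  shows "\<exists>c b. consec d c b \<and> c \<le> y \<and> y < b"
proof -
  define P where "P u \<longleftrightarrow> (\<forall>z\<in>CC d. z \<le> y \<longrightarrow> z \<le> u)" for u
  define c where "c = (LEAST u. P u)"
  have "P y" by (simp add: P_def)
  then have Pc: "P c" and cy: "c \<le> y" unfolding c_def by (auto intro: LeastI Least_le)
  have cC: "c \<in> CC d"
  proof (rule ccontr)
    assume nc: "c \<notin> CC d"
    have "bt < c" using nc bt_le[of c] by (auto simp: CC_def le_less)
    have "\<exists>x\<in>C d. u < x \<and> x < c" if "u < c" for u
    proof -
      have "\<not> P u" using not_less_Least[OF that[unfolded c_def]] .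
      then obtain z where z: "z \<in> CC d" "z \<le> y" "u < z" by (auto simp: P_def not_le)
      then have "z \<le> c" using Pc by (simp add: P_def)
      with z nc have "z < c" by (metis le_less)
      moreover have "z \<in> C d" using z not_less_bt by (auto simp: CC_def)
      ultimately show ?thesis using z by blast
    qed
    then have "c \<in> acc (C d)" using C_closed[OF d _ _ \<open>bt < c\<close>] cy y by simp
    then show False using nc by (simp add: acc_iff CC_def)
  qed
  define b where "b = (LEAST b. b \<in> C d \<and> y < b)"
  have "\<exists>b. b \<in> C d \<and> y < b" using C_cofinal[OF d y] by blast
  then have b: "b \<in> C d \<and> y < b" unfolding b_def by (rule LeastI_ex)
  have "\<not> (c < x \<and> x < b)" if "x \<in> C d" for x
  proof
    assume x: "c < x \<and> x < b"
    show False
    proof (cases "x \<le> y")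
      case True
      then have "x \<le> c" using Pc that by (simp add: P_def CC_def)
      with x show False by (meson leD)
    next
      case False
      then have "b \<le> x" unfolding b_def using that by (intro Least_le) simp
      with x show False by (meson leD)
    qed
  qed
  then show ?thesis using cC b cy unfolding consec_def by (meson le_less_trans)
qed

lemma consec_unique:
  assumes "consec d c b" "consec d c' b'" "c \<le> y" "y < b" "c' \<le> y" "y < b'"
  shows "c = c' \<and> b = b'"
proof -
  have 1: "c' \<le> c" if "consec d c b" "consec d c' b'" "c \<le> y" "y < b" "c' \<le> y" "y < b'" for c b c' b'
  proof (rule ccontr)
    assume "\<not> c' \<le> c"
    then have "c < c'" by simp
    moreover have "c' < b" using that by simp
    moreover have "c' \<in> C d" using that(2) \<open>c < c'\<close> not_less_bt by (auto simp: consec_def CC_def)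
    ultimately show False using that(1) by (auto simp: consec_def)
  qed
  have 2: "b \<le> b'" if "consec d c b" "consec d c b'" for b b'
    using that unfolding consec_def by (meson not_le)
  have "c = c'" using 1[OF assms(1,2) assms(3-6)] 1[OF assms(2,1) assms(5,6,3,4)] by simp
  with 2[of b b'] 2[of b' b] assms(1,2) show ?thesis by simp
qed

lemma consec_from:
  assumes "d \<in> acc UNIV" "y \<in> CC d"
  shows "\<exists>b. consec d y b"
proof -
  obtain c b where c: "consec d c b" "c \<le> y" "y < b" using consec_exists[OF assms(1) CC_less[OF assms]] by blast
  have "y = c"
  proof (rule ccontr)
    assume "y \<noteq> c"
    then have "c < y" using c by simp
    moreover have "y \<in> C d" using assms(2) \<open>c < y\<close> not_less_bt by (auto simp: CC_def)
    ultimately show False using c by (auto simp: consec_def)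
  qed
  with c(1) show ?thesis by blast
qed

lemma consec_to:
  assumes "d \<in> acc UNIV" "b \<in> C d" "b \<notin> acc (C d)" "b \<noteq> bt"
  shows "\<exists>c. consec d c b"
proof -
  have "bt < b" using assms(4) bt_le[of b] by simp
  have "b < d" using C_less assms(1,2) .
  then obtain y where y: "y < b" "\<And>x. x \<in> C d \<Longrightarrow> \<not> (y < x \<and> x < b)"
    using C_closed[OF assms(1) _ _ \<open>bt < b\<close>] assms(3) by blast
  obtain c b' where c: "consec d c b'" "c \<le> y" "y < b'"
    using consec_exists[OF assms(1), of y] y(1) \<open>b < d\<close> by (meson less_trans)
  have "b' = b"
  proof (rule linorder_cases)
    assume "b' < b" then show ?thesis using y(2)[of b'] c by (auto simp: consec_def)
  next
    assume "b < b'"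
    moreover have "c < b" using c(2) y(1) by simp
    ultimately show ?thesis using c(1) assms(2) by (auto simp: consec_def)
  qed
  with c(1) show ?thesis by blast
qed

lemma consec_acc:
  assumes "c \<in> acc (C d)" "b < c"
  shows "consec c a b \<longleftrightarrow> consec d a b"
  using coherent_C[OF assms(1)] assms(2) unfolding consec_def CC_def by auto

text \<open>\<open>N b\<close> guesses a set which codes a modification list \<^term>\<open>l\<close> (tag \<open>False\<close>) and a set of nodes
  \<open>overwrite l' (F a)\<close> (tag \<open>True\<close>); after the modification \<^term>\<open>m\<close> has to extend a node of that set.\<close>

definition hits :: "('k \<Rightarrow> 'k \<times> nat \<Rightarrow> int) \<Rightarrow> 'k \<Rightarrow> 'k \<Rightarrow> ('k \<times> nat \<Rightarrow> int) \<Rightarrow> bool" where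
  "hits F c b m \<longleftrightarrow> (\<exists>l a l'. (bt, l, False) \<in> N b \<and> below b l \<and> (a, l', True) \<in> N b \<and> below b l' \<and>
     c < a \<and> a < b \<and> agree a (overwrite l m) (overwrite l' (F a)))"

section \<open>Choice of branch segments and recursive definition of the branches\<close>

definition pick :: "('k \<Rightarrow> 'k \<times> nat \<Rightarrow> int) \<Rightarrow> ('k \<times> nat \<Rightarrow> int) \<Rightarrow> 'k \<Rightarrow> 'k \<Rightarrow> 'k \<times> nat \<Rightarrow> int" where
  "pick F s c b = (SOME m. good s c b (F b) m \<and>
     ((\<exists>m'. good s c b (F b) m' \<and> hits F c b m') \<longrightarrow> hits F c b m))"

lemma hits_cong:
  assumes "\<And>a. a < b \<Longrightarrow> F a = F' a"
  shows "hits F c b m \<longleftrightarrow> hits F' c b m"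
  unfolding hits_def using assms by (metis (no_types, lifting))

lemma hits_agree:
  assumes "hits F c b m" "agree b m m'"
  shows "hits F c b m'"
proof -
  obtain l a l' where h: "(bt, l, False) \<in> N b" "below b l" "(a, l', True) \<in> N b" "below b l'"
     "c < a" "a < b" "agree a (overwrite l m) (overwrite l' (F a))"
    using assms(1) unfolding hits_def by blast
  have "overwrite l m' p = overwrite l' (F a) p" if "fst p < a" for p
  proof -
    have "m p = m' p" using agreeD[OF assms(2)] that h(6) by simp
    then show ?thesis using agreeD[OF h(7) that] overwrite_cong by metis
  qed
  with h show ?thesis unfolding hits_def agree_def by blast
qed

text \<open>The height \<open>d\<close> of the branch does not enter, only what has been built below
  \<open>c\<close> and the branches up to \<open>b\<close>. Clubs that agree up to \<open>b\<close>
  therefore lead to the same segment.\<close>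

lemma pick_cong:
  assumes "\<And>a. a \<le> b \<Longrightarrow> F a = F' a" "agree c s s'"
  shows "pick F s c b = pick F' s' c b"
proof -
  have 1: "hits F c b m \<longleftrightarrow> hits F' c b m" for m using assms(1) by (intro hits_cong) simp
  have 2: "good s c b (F b) m \<longleftrightarrow> good s' c b (F' b) m" for m
    using good_cong[OF assms(2)] assms(1)[OF order_refl] by simp
  show ?thesis unfolding pick_def 1 2 ..
qed

lemma pick_good:
  assumes "\<exists>m. good s c b (F b) m"
  shows "good s c b (F b) (pick F s c b)"
    and "(\<exists>m'. good s c b (F b) m' \<and> hits F c b m') \<Longrightarrow> hits F c b (pick F s c b)"
proof -
  have "\<exists>m. good s c b (F b) m \<and> ((\<exists>m'. good s c b (F b) m' \<and> hits F c b m') \<longrightarrow> hits F c b m)"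
    using assms by blast
  from someI_ex[OF this] show "good s c b (F b) (pick F s c b)"
    "(\<exists>m'. good s c b (F b) m' \<and> hits F c b m') \<Longrightarrow> hits F c b (pick F s c b)"
    unfolding pick_def by blast+
qed

text \<open>Recursion over pairs \<open>(d, p)\<close> in lexicographic order: a segment of
  \<open>e d\<close> over the interval from \<open>c\<close> to \<open>b\<close> uses the branches
  up to \<open>b < d\<close> and \<open>e d\<close> itself before \<open>c\<close>. The guards, with
  the default \<open>0\<close>, only keep all references below \<open>(d, p)\<close>.\<close>

definition estep :: "('k \<times> 'k \<times> nat \<Rightarrow> int) \<Rightarrow> 'k \<times> 'k \<times> nat \<Rightarrow> int" where
  "estep E = (\<lambda>(d, p).
     if d \<in> acc UNIV then
       (case (SOME cb. consec d (fst cb) (snd cb) \<and> fst cb \<le> fst p \<and> fst p < snd cb) of (c, b) \<Rightarrow>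
         pick (\<lambda>d' q. if d' < d then E (d', q) else 0) (\<lambda>q. if fst q < c \<and> fst q < fst p then E (d, q) else 0) c b p)
     else if \<exists>a. d = sc a then (let a = (SOME a. d = sc a) in if a < d \<and> fst p < a then E (a, p) else 1)
     else 1)"

definition e :: "'k \<Rightarrow> 'k \<times> nat \<Rightarrow> int" where
  "e d p = wfrec {(x, y). x < y} estep (d, p)"

lemma e_unfold: "e d p = estep (\<lambda>(d, p). e d p) (d, p)"
proof -
  let ?E = "wfrec {(x, y). x < y} estep" and ?R = "{(x, y :: 'k \<times> 'k \<times> nat). x < y}"
  have lt1: "(d', q) < (d, p)" if "d' < d" for d' q using that by (cases q; cases p) auto
  have lt2: "(d, q) < (d, p)" if "fst q < fst p" for q using that by (cases q; cases p) auto
  have "?E (d, p) = estep (cut ?E ?R (d, p)) (d, p)"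
    by (rule wfrec[OF wf_less_rel])
  also have "\<dots> = estep ?E (d, p)"
  proof -
    have 1: "(\<lambda>d' q. if d' < d then cut ?E ?R (d, p) (d', q) else 0) = (\<lambda>d' q. if d' < d then ?E (d', q) else 0)"
      by (intro ext) (simp add: cut_apply lt1 del: less_prod_simp)
    have 2: "(\<lambda>q. if fst q < c \<and> fst q < fst p then cut ?E ?R (d, p) (d, q) else 0) =
        (\<lambda>q. if fst q < c \<and> fst q < fst p then ?E (d, q) else 0)" for c
      by (intro ext) (simp add: cut_apply lt2 del: less_prod_simp)
    have 3: "(if a < d \<and> fst p < a then cut ?E ?R (d, p) (a, p) else 1) = (if a < d \<and> fst p < a then ?E (a, p) else 1)" for a
      by (simp add: cut_apply lt1 del: less_prod_simp)
    show ?thesis unfolding estep_def case_prod_conv Let_def 1 2 3 ..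
  qed
  finally show ?thesis unfolding e_def by (simp add: case_prod_unfold)
qed

lemma sc_inject [simp]: "sc a = sc b \<longleftrightarrow> a = b"
  using less_sc_iff[of a b] less_sc_iff[of b a] less_sc_iff[of a a] less_sc_iff[of b b] by (metis order_antisym order_refl)

lemma sc_not_limit: "sc a \<notin> acc UNIV"
proof
  assume "sc a \<in> acc UNIV"
  then obtain x where "a < x" "x < sc a" using sc_gt[of a] by (auto simp: acc_UNIV_iff)
  then show False by (simp add: less_sc_iff)
qed

lemma e_sc_unfold: "e (sc a) p = (if fst p < a then e a p else 1)"
proof -
  have "(SOME b. sc a = sc b) = a" by simp
  then show ?thesis
    by (subst e_unfold) (simp add: estep_def sc_not_limit sc_gt)
qed

lemma e_limit_unfold:
  assumes d: "d \<in> acc UNIV" and cb: "consec d c b" "c \<le> fst p" "fst p < b"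
  shows "e d p = pick e (e d) c b p"
proof -
  have "(SOME cb. consec d (fst cb) (snd cb) \<and> fst cb \<le> fst p \<and> fst p < snd cb) = (c, b)"
  proof (rule some_equality)
    fix cb' assume "consec d (fst cb') (snd cb') \<and> fst cb' \<le> fst p \<and> fst p < snd cb'"
    then show "cb' = (c, b)" using consec_unique[OF cb(1)] cb(2,3) by (metis prod.collapse)
  qed (use cb in simp)
  then have ed: "e d p = pick (\<lambda>d' q. if d' < d then e d' q else 0) (\<lambda>q. if fst q < c \<and> fst q < fst p then e d q else 0) c b p"
    using d by (subst e_unfold) (simp add: estep_def cong: if_cong)
  have "b < d" using C_less[OF d] cb(1) by (simp add: consec_def)
  have "pick (\<lambda>d' q. if d' < d then e d' q else 0) (\<lambda>q. if fst q < c \<and> fst q < fst p then e d q else 0) c b = pick e (e d) c b"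
  proof (rule pick_cong)
    fix a assume "a \<le> b"
    then have "a < d" using \<open>b < d\<close> by (rule le_less_trans)
    then show "(\<lambda>q. if a < d then e a q else 0) = e a" by simp
  qed (use cb(2) in \<open>auto simp: agree_def\<close>)
  with ed show ?thesis by simp
qed

text \<open>Below a limit point \<open>c\<close> of \<open>C d\<close> the clubs \<open>C c\<close>
  and \<open>C d\<close> have the same intervals, so the recursion makes the same choices on both
  branches.\<close>

lemma e_acc:
  assumes d: "d \<in> acc UNIV" and c: "c \<in> acc (C d)"
  shows "agree c (e c) (e d)"
proof -
  have lim: "c \<in> acc UNIV" using c by (rule acc_subset_UNIV)
  have "\<forall>n. e c (y, n) = e d (y, n)" if "y < c" for y
    using that
  proof (induction y rule: less_induct)
    case (less y)
    obtain a b where ab: "consec c a b" "a \<le> y" "y < b" using consec_exists[OF lim less.prems] by blast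
    have "b < c" using C_less[OF lim] ab(1) by (simp add: consec_def)
    then have ab': "consec d a b" using consec_acc[OF c] ab(1) by blast
    have "agree a (e c) (e d)"
      unfolding agree_def
    proof (intro allI impI)
      fix p :: "'k \<times> nat" assume "fst p < a"
      then have "fst p < y" "fst p < c" using ab(2) less.prems by auto
      then show "e c p = e d p" using less.IH[of "fst p"] by (metis prod.collapse)
    qed
    then have "pick e (e c) a b = pick e (e d) a b" by (intro pick_cong) auto
    then show ?case
      using e_limit_unfold[OF lim ab(1)] e_limit_unfold[OF d ab'] ab(2,3) by simp
  qed
  then show ?thesis unfolding agree_def by (metis prod.collapse)
qed

text \<open>In block \<^term>\<open>c\<close>, descend to depth \<open>0\<close> by values of weight \<open>-1\<close>, then ascend once by weight \<open>1\<close>.\<close>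

lemma ex_start:
  assumes s: "ok s (c, 0)" "0 \<le> dep s (c, 0)"
  shows "\<exists>m k. agree c s m \<and> ok m (sc c, 0) \<and> dep m (c, k) = 0 \<and> dep m (sc c, 0) = 1 \<and>
     (\<forall>p. (c, 0) \<le> p \<and> p \<le> (sc c, 0) \<and> p \<noteq> (c, k) \<longrightarrow> 0 < dep m p) \<and> finite {n. m (c, n) \<noteq> 1}"
proof -
  define k where "k = nat (dep s (c, 0))"
  define m where "m p = (if fst p < c then s p else if snd p < k then 0 else if snd p = k then 4 else 1)" for p
  have ag: "agree c s m" by (simp add: agree_def m_def)
  have okc: "ok m (c, 0)" using s(1) ok_cong[of "(c, 0)" s m] ag by (simp add: agree_def pos_less_height)
  have mv: "m (c, n) = (if n < k then 0 else if n = k then 4 else 1)" for n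
    by (simp add: m_def)
  have d1: "dep m (c, n) = int k - int n" if "n \<le> k" for n
    using that
  proof (induction n)
    case 0
    then show ?case using agree_dep[OF ag order_refl] s(2) by (simp add: k_def)
  next
    case (Suc n)
    then show ?case by (simp add: dep_Suc mv)
  qed
  have d2: "dep m (c, n) = 1" if "Suc k \<le> n" for n
    using that
  proof (induction n rule: dec_induct)
    case base
    then show ?case using d1[of k] by (simp add: dep_Suc mv)
  next
    case (step n)
    then show ?case by (simp add: dep_Suc mv)
  qed
  have h: "ok m (sc c, 0) \<and> dep m (sc c, 0) = dep m (c, Suc k)"
    using okc sc_gt[of c] by (rule dep_height_eq) (auto simp: less_sc_iff mv)
  have "0 < dep m p" if "(c, 0) \<le> p \<and> p \<le> (sc c, 0) \<and> p \<noteq> (c, k)" for p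
  proof (cases "p = (sc c, 0)")
    case False
    obtain a n where p: "p = (a, n)" by (cases p)
    have "p < (sc c, 0)" using conjunct1[OF conjunct2[OF that]] False by (rule le_neq_trans)
    then have "a = c" using that p by (auto simp: pos_less_height pos_height_le less_sc_iff)
    then have "n \<noteq> k" using that p by simp
    then show ?thesis using d1[of n] d2[of n] p \<open>a = c\<close> by (cases "n < k") auto
  qed (use h d2 in simp)
  moreover have "finite {n. m (c, n) \<noteq> 1}"
    by (rule finite_subset[of _ "{..k}"]) (auto simp: m_def)
  moreover have "dep m (c, k) = 0" "dep m (sc c, 0) = 1" using d1[of k] d2[of "Suc k"] h by simp_all
  ultimately show ?thesis using ag conjunct1[OF h] by blast
qed

text \<open>The only zero is placed in block \<open>c\<close> by \<open>ex_start\<close>, which ends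
  at depth \<open>1\<close>; a nice extension from \<open>sc c\<close> to \<open>b\<close> keeps the
  depth positive from there on.\<close>

lemma ex_good:
  fixes c b :: 'k
  assumes s: "ok s (c, 0)" "0 \<le> dep s (c, 0)" and f: "ok f (b, 0)" "finite {p. fst p < c \<and> s p \<noteq> f p}"
    "finite {n. f (c, n) \<noteq> 1}" and cb: "c < b"
  shows "\<exists>m. good s c b f m"
proof -
  obtain m k where m: "agree c s m" "ok m (sc c, 0)" "dep m (c, k) = 0" "dep m (sc c, 0) = 1"
     "\<And>p. (c, 0) \<le> p \<and> p \<le> (sc c, 0) \<and> p \<noteq> (c, k) \<Longrightarrow> 0 < dep m p" "finite {n. m (c, n) \<noteq> 1}"
    using ex_start[OF s] by blast
  have "finite {p. fst p < sc c \<and> m p \<noteq> f p}"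
  proof (rule finite_subset)
    show "{p. fst p < sc c \<and> m p \<noteq> f p} \<subseteq> {p. fst p < c \<and> s p \<noteq> f p} \<union> Pair c ` ({n. m (c, n) \<noteq> 1} \<union> {n. f (c, n) \<noteq> 1})"
    proof
      fix p assume p: "p \<in> {p. fst p < sc c \<and> m p \<noteq> f p}"
      obtain a n where an: "p = (a, n)" by (cases p)
      show "p \<in> {p. fst p < c \<and> s p \<noteq> f p} \<union> Pair c ` ({n. m (c, n) \<noteq> 1} \<union> {n. f (c, n) \<noteq> 1})"
      proof (cases "a < c")
        case True
        then show ?thesis using p an agreeD[OF m(1), of p] by simp
      next
        case False
        then have "a = c" using p an by (simp add: less_sc_iff)
        then have "m (c, n) \<noteq> 1 \<or> f (c, n) \<noteq> 1" using p an by auto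
        then show ?thesis using an \<open>a = c\<close> by blast
      qed
    qed
  qed (use f m(6) in simp)
  from extend_raw[OF this f(1) sc_le[OF cb]] obtain t where t: "agree (sc c) m t"
    "finite {p. fst p < b \<and> t p \<noteq> f p}" "ok t (b, 0)" "nice (sc c) b t" by blast
  have dt: "dep t p = dep m p" if "p \<le> (sc c, 0)" for p using agree_dep[OF t(1) that] by simp
  have "good s c b f t"
    unfolding good_def
  proof (intro conjI exI[of _ "(c, k)"] allI impI)
    show "agree c s t" using m(1) agree_mono[OF t(1)] sc_gt[of c] agree_trans less_imp_le by blast
    show "dep t (c, k) = 0" using dt[of "(c, k)"] m(3) sc_gt[of c] by simp
    fix p assume p: "(c, 0) \<le> p \<and> p \<le> (b, 0) \<and> p \<noteq> (c, k)"
    show "0 < dep t p"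
    proof (cases "p \<le> (sc c, 0)")
      case True
      then show ?thesis using dt m(5) p by simp
    next
      case False
      then have "(sc c, 0) \<le> p" by simp
      then have "dep t (sc c, 0) \<le> dep t p" using t(4) p unfolding nice_def by blast
      then show ?thesis using dt[OF order_refl] m(4) by simp
    qed
  qed (use t cb in auto)
  then show ?thesis by blast
qed

section \<open>Coherence and nonnegative depth of the branches\<close>

definition inv :: "'k \<Rightarrow> bool" where
  "inv d \<longleftrightarrow> (\<forall>a\<le>d. finite {p. fst p < a \<and> e a p \<noteq> e d p}) \<and> ok (e d) (d, 0) \<and> (\<forall>p\<le>(d, 0). 0 \<le> dep (e d) p)"

lemma e_block: "finite {n. e b (c, n) \<noteq> 1}" if "inv b" "c < b"
proof -
  have "finite {p. fst p < sc c \<and> e (sc c) p \<noteq> e b p}"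
    using that sc_le[of c b] by (simp add: inv_def)
  then have "finite (Pair c -` {p. fst p < sc c \<and> e (sc c) p \<noteq> e b p})"
    by (rule finite_vimageI) (simp add: inj_on_def)
  moreover have "{n. e b (c, n) \<noteq> 1} \<subseteq> Pair c -` {p. fst p < sc c \<and> e (sc c) p \<noteq> e b p}"
    by (auto simp: e_sc_unfold sc_gt)
  ultimately show ?thesis by (rule finite_subset[rotated])
qed

lemma finite_ne_trans:
  fixes s t u :: "'k \<times> nat \<Rightarrow> int"
  assumes "finite {p. fst p < a \<and> s p \<noteq> t p}" "finite {p. fst p < b \<and> t p \<noteq> u p}" "a \<le> b"
  shows "finite {p. fst p < a \<and> s p \<noteq> u p}"
proof (rule finite_subset[OF _ finite_UnI[OF assms(1,2)]])
  have "fst p < b" if "fst p < a" for p :: "'k \<times> nat"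
    using that assms(3) by (rule less_le_trans)
  then show "{p. fst p < a \<and> s p \<noteq> u p} \<subseteq> {p. fst p < a \<and> s p \<noteq> t p} \<union> {p. fst p < b \<and> t p \<noteq> u p}"
    by auto
qed

lemma finite_ne_sym: "finite {p. P p \<and> s p \<noteq> t p} \<Longrightarrow> finite {p. P p \<and> t p \<noteq> (s p :: int)}"
  by (simp add: eq_commute)

text \<open>The form in which the invariant is carried along \<open>C d\<close>, when
  \<open>e d\<close> is under control only below its point \<open>b\<close>.\<close>

definition inv_at :: "'k \<Rightarrow> 'k \<Rightarrow> bool" where
  "inv_at d b \<longleftrightarrow> finite {p. fst p < b \<and> e d p \<noteq> e b p} \<and> ok (e d) (b, 0) \<and> (\<forall>p\<le>(b, 0). 0 \<le> dep (e d) p)"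

lemma consec_step:
  assumes d: "d \<in> acc UNIV" and cb: "consec d c b" and at: "inv_at d c" and ib: "inv b"
  shows "inv_at d b" and "good (e d) c b (e b) (pick e (e d) c b)" and "agree b (pick e (e d) c b) (e d)"
proof -
  have "c < b" using cb by (simp add: consec_def)
  have "\<exists>m. good (e d) c b (e b) m"
  proof (rule ex_good)
    have "finite {p. fst p < c \<and> e c p \<noteq> e b p}" using ib \<open>c < b\<close> by (simp add: inv_def)
    moreover have "finite {p. fst p < c \<and> e d p \<noteq> e c p}" using at by (simp add: inv_at_def)
    ultimately show "finite {p. fst p < c \<and> e d p \<noteq> e b p}" using finite_ne_trans[OF _ _ order_refl] by blast
    show "0 \<le> dep (e d) (c, 0)" "ok (e d) (c, 0)" "ok (e b) (b, 0)" using at ib by (simp_all add: inv_at_def inv_def)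
    show "finite {n. e b (c, n) \<noteq> 1}" using ib \<open>c < b\<close> by (rule e_block)
  qed fact
  then show g: "good (e d) c b (e b) (pick e (e d) c b)" by (rule pick_good(1))
  show ag: "agree b (pick e (e d) c b) (e d)"
    unfolding agree_def
  proof (intro allI impI)
    fix p :: "'k \<times> nat" assume p: "fst p < b"
    show "pick e (e d) c b p = e d p"
    proof (cases "fst p < c")
      case True
      then show ?thesis using g unfolding good_def agree_def by simp
    next
      case False
      then show ?thesis using e_limit_unfold[OF d cb _ p] by simp
    qed
  qed
  show "inv_at d b"
    unfolding inv_at_def
  proof (intro conjI allI impI)
    have "finite {p. fst p < b \<and> pick e (e d) c b p \<noteq> e b p}" using g by (simp add: good_def)
    moreover have "{p. fst p < b \<and> e d p \<noteq> e b p} = {p. fst p < b \<and> pick e (e d) c b p \<noteq> e b p}"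
      using ag by (auto simp: agree_def)
    ultimately show "finite {p. fst p < b \<and> e d p \<noteq> e b p}" by (simp only:)
    have "ok (pick e (e d) c b) (b, 0)" using g by (simp add: good_def)
    then show "ok (e d) (b, 0)" using ok_cong[of "(b, 0)" "pick e (e d) c b" "e d"] ag by (simp add: pos_less_height agree_def)
    fix p :: "'k \<times> nat" assume p: "p \<le> (b, 0)"
    show "0 \<le> dep (e d) p"
    proof (cases "p \<le> (c, 0)")
      case True
      then show ?thesis using at by (simp add: inv_at_def)
    next
      case False
      obtain z where "dep (e d) z = 0" "\<forall>p. (c, 0) \<le> p \<and> p \<le> (b, 0) \<and> p \<noteq> z \<longrightarrow> 0 < dep (e d) p"
        using good_agree[OF g ag] by blast
      then show ?thesis using p False by (metis less_imp_le linear order_refl)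
    qed
  qed
qed

text \<open>Induction along \<open>CC d\<close>: at a limit point \<open>b\<close> the branch
  \<open>e d\<close> coincides with \<open>e b\<close> by \<open>e_acc\<close>, at a successor point
  the new segment is good by \<open>consec_step\<close>, and at the least ordinal there is nothing
  to check.\<close>

lemma inv_at_limit:
  assumes d: "d \<in> acc UNIV" and IH: "\<And>b. b < d \<Longrightarrow> inv b" and b: "b \<in> CC d"
  shows "inv_at d b"
  using b
proof (induction b rule: less_induct)
  case (less b)
  have bd: "b < d" using d less.prems by (rule CC_less)
  show ?case
  proof (cases "b = bt")
    case True
    have nl: "\<not> (\<exists>q. q < (b, 0::nat))" using not_less_bt True by (simp add: pos_less_height)
    have "dep (e d) (b, 0) = 0" using nl by (subst dep_unfold) (rule if_not_P)
    then have "0 \<le> dep (e d) p" if "p \<le> (b, 0::nat)" for p using that nl by (metis le_less order_refl)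
    moreover have "ok (e d) (b, 0)" unfolding ok_def using nl by (metis less_le_trans)
    ultimately show ?thesis using not_less_bt True by (simp add: inv_at_def)
  next
    case False
    then have bC: "b \<in> C d" using less.prems by (simp add: CC_def)
    show ?thesis
    proof (cases "b \<in> acc (C d)")
      case True
      have ag: "agree b (e b) (e d)" using d True by (rule e_acc)
      have ib: "inv b" using IH[OF bd] .
      have "{p. fst p < b \<and> e d p \<noteq> e b p} = {}" using ag by (auto simp: agree_def)
      then have "finite {p. fst p < b \<and> e d p \<noteq> e b p}" by (metis finite.emptyI)
      moreover have "ok (e d) (b, 0)"
        using ib ok_cong[of "(b, 0)" "e b" "e d"] ag by (simp add: inv_def pos_less_height agree_def)
      moreover have "0 \<le> dep (e d) p" if "p \<le> (b, 0)" for p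
      proof -
        have "0 \<le> dep (e b) p" using ib that by (simp add: inv_def)
        then show ?thesis using agree_dep[OF ag that] by simp
      qed
      ultimately show ?thesis by (simp add: inv_at_def)
    next
      case False
      then obtain c where c: "consec d c b" using consec_to[OF d bC _ \<open>b \<noteq> bt\<close>] by blast
      then have "inv_at d c" using less.IH[of c] by (simp add: consec_def)
      then show ?thesis using consec_step(1)[OF d c _ IH[OF bd]] by blast
    qed
  qed
qed

lemma consec_good:
  assumes d: "d \<in> acc UNIV" and IH: "\<And>b. b < d \<Longrightarrow> inv b" and cb: "consec d c b"
  shows "good (e d) c b (e b) (pick e (e d) c b)" "agree b (pick e (e d) c b) (e d)"
proof -
  have "c \<in> CC d" "b < d" using cb C_less[OF d] by (auto simp: consec_def)
  then show "good (e d) c b (e b) (pick e (e d) c b)" "agree b (pick e (e d) c b) (e d)"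
    using consec_step(2,3)[OF d cb] inv_at_limit[OF d IH] IH by blast+
qed

lemma zeros_cofinal_aux:
  assumes d: "d \<in> acc UNIV" and IH: "\<And>b. b < d \<Longrightarrow> inv b" and y: "y < d"
  shows "\<exists>z. (y, 0) < z \<and> z < (d, 0) \<and> dep (e d) z = 0"
proof -
  obtain y' where y': "y' \<in> C d" "y < y'" using C_cofinal[OF d y] by blast
  obtain b where b: "consec d y' b" using consec_from[OF d] y'(1) by (auto simp: CC_def)
  obtain z where z: "(y', 0) \<le> z" "z < (b, 0)" "dep (e d) z = 0"
    using good_agree[OF consec_good[OF d IH b]] by blast
  have "b < d" using b C_less[OF d] by (simp add: consec_def)
  then have "(b, 0) < (d, 0::nat)" by simp
  with z(2) have "z < (d, 0)" by (rule less_trans)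
  moreover have "(y, 0) < (y', 0::nat)" using y'(2) by simp
  then have "(y, 0) < z" using z(1) by (rule less_le_trans)
  ultimately show ?thesis using z(3) by blast
qed

lemma inv_limit:
  assumes d: "d \<in> acc UNIV" and IH: "\<And>b. b < d \<Longrightarrow> inv b"
  shows "inv d" and "dep (e d) (d, 0) = 0"
proof -
  have at: "inv_at d b" if "b \<in> C d" for b using inv_at_limit[OF d IH] that by (simp add: CC_def)
  have low: "ok (e d) p \<and> 0 \<le> dep (e d) p" if "p < (d, 0)" for p
  proof -
    obtain b where b: "b \<in> C d" "fst p < b" using C_cofinal[OF d, of "fst p"] \<open>p < (d, 0)\<close> by (auto simp: pos_less_height)
    have "p \<le> (b, 0)" using b(2) by (simp add: pos_less_height less_imp_le del: less_eq_prod_simp)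
    then show ?thesis using at[OF b(1)] ok_mono by (auto simp: inv_at_def)
  qed
  obtain o' where o': "o' < d" using d by (auto simp: acc_UNIV_iff)
  have L: "lev (e d) (dep (e d)) (d, 0) 0"
    unfolding lev_def
  proof (intro conjI allI impI)
    show "\<exists>a<(d, 0). \<forall>z. a \<le> z \<and> z < (d, 0) \<longrightarrow> 0 \<le> dep (e d) z + wt (e d z)"
    proof (intro exI[of _ "(o', 0)"] conjI allI impI)
      fix z assume z: "(o', 0) \<le> z \<and> z < (d, 0::nat)"
      obtain a n where an: "z = (a, n)" by (cases z)
      have "(a, Suc n) < (d, 0::nat)" using z an by auto
      then show "0 \<le> dep (e d) z + wt (e d z)" using low[of "(a, Suc n)"] an by (simp add: dep_Suc)
    qed (use o' in simp)
  next
    fix a assume a: "a < (d, 0::nat)"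
    then have "sc (fst a) < d" using sc_less_limit[OF d] by (simp only: pos_less_height)
    then obtain z where z: "(sc (fst a), 0) < z" "z < (d, 0)" "dep (e d) z = 0"
      using zeros_cofinal_aux[OF d IH] by blast
    have "a < (sc (fst a), 0)" using sc_gt by (simp only: pos_less_height)
    then have "a < z" using z(1) by (rule less_trans)
    \<comment> \<open>The lower limit concerns the sums after positions. The zero at
      \<open>z\<close> is itself such a lower limit, hence some \<open>z'\<close> between
      \<open>a\<close> and \<open>z\<close> has a sum of at most \<open>0\<close>.\<close>
    moreover have "lev (e d) (dep (e d)) z (dep (e d) z)"
      using conjunct1[OF low[OF z(2)]] order_refl \<open>a < z\<close> by (rule okD)
    ultimately obtain z' where "a \<le> z'" "z' < z" "dep (e d) z' + wt (e d z') \<le> 0"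
      unfolding lev_def z(3) by blast
    then show "\<exists>z'. a \<le> z' \<and> z' < (d, 0) \<and> dep (e d) z' + wt (e d z') \<le> 0"
      using less_trans[OF _ z(2)] by blast
  qed
  have od: "(o', 0) < (d, 0::nat)" using o' by simp
  show D: "dep (e d) (d, 0) = 0" using od L by (rule dep_eqI)
  show "inv d"
    unfolding inv_def
  proof (intro conjI allI impI)
    have "ok (e d) p" if "p < (d, 0)" for p using low[OF that] by blast
    then show "ok (e d) (d, 0)" using od L by (rule okI)
    show "0 \<le> dep (e d) p" if "p \<le> (d, 0)" for p
      using that low[of p] D by (cases "p = (d, 0)") (auto simp: le_less)
    fix a assume "a \<le> d"
    show "finite {p. fst p < a \<and> e a p \<noteq> e d p}"
    proof (cases "a = d")
      case False
      then have "a < d" using \<open>a \<le> d\<close> by simp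
      then obtain b where b: "b \<in> C d" "a < b" using C_cofinal[OF d] by blast
      have "inv b" using IH C_less[OF d b(1)] by blast
      then have "finite {p. fst p < a \<and> e a p \<noteq> e b p}" using b(2) by (simp add: inv_def)
      moreover have "finite {p. fst p < b \<and> e d p \<noteq> e b p}"
        using at[OF b(1)] unfolding inv_at_def by blast
      then have "finite {p. fst p < b \<and> e b p \<noteq> e d p}" by (rule finite_ne_sym)
      ultimately show ?thesis using finite_ne_trans less_imp_le[OF b(2)] by blast
    qed simp
  qed
qed

lemma inv_all: "inv d"
proof (induction d rule: less_induct)
  case (less d)
  show ?case
  proof (cases d rule: not_limit_cases)
    case 1
    then show ?thesis using less by (rule inv_limit(1))
  next
    case 2
    have nl: "\<not> (\<exists>q. q < (d, 0::nat))" using 2 by (simp add: pos_less_height)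
    have "dep (e d) (d, 0) = 0" using nl by (subst dep_unfold) (rule if_not_P)
    then have "0 \<le> dep (e d) p" if "p \<le> (d, 0::nat)" for p using that nl by (metis le_less order_refl)
    moreover have "ok (e d) (d, 0)" unfolding ok_def using nl by (metis less_le_trans)
    ultimately show ?thesis using 2 by (auto simp: inv_def le_less)
  next
    case (3 a)
    have ia: "inv a" using less 3 sc_gt by blast
    have ag: "agree a (e a) (e d)" by (simp add: agree_def 3 e_sc_unfold)
    have oka: "ok (e d) (a, 0)"
      using ia ok_cong[of "(a, 0)" "e a" "e d"] ag by (simp add: inv_def pos_less_height agree_def)
    have h: "ok (e d) (d, 0) \<and> dep (e d) (d, 0) = dep (e d) (a, 0)"
      by (rule dep_height_eq[OF oka]) (auto simp: 3 sc_gt less_sc_iff e_sc_unfold)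
    have low: "0 \<le> dep (e d) p" if "p \<le> (a, 0)" for p
    proof -
      have "0 \<le> dep (e a) p" using ia that by (simp add: inv_def)
      then show ?thesis using agree_dep[OF ag that] by simp
    qed
    have block: "dep (e d) (a, n) = dep (e d) (a, 0)" for n
      by (induction n) (auto simp: dep_Suc 3 e_sc_unfold)
    show ?thesis
      unfolding inv_def
    proof (intro conjI allI impI)
      show "ok (e d) (d, 0)" using h ..
      fix p assume p: "p \<le> (d, 0::nat)"
      show "0 \<le> dep (e d) p"
      proof (cases "p = (d, 0)")
        case False
        obtain b n where bn: "p = (b, n)" by (cases p)
        have "p < (d, 0)" using p False by (rule le_neq_trans)
        then have "b \<le> a" using bn 3 by (simp add: pos_less_height less_sc_iff)
        show ?thesis
        proof (cases "b = a")
          case True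
          then show ?thesis using bn low[OF order_refl] block[of n] by simp
        next
          case False
          with \<open>b \<le> a\<close> have "b < a" by (rule le_neq_trans)
          then show ?thesis using bn by (intro low) simp
        qed
      qed (use h low in auto)
    next
      fix b assume "b \<le> d"
      show "finite {p. fst p < b \<and> e b p \<noteq> e d p}"
      proof (cases "b = d")
        case False
        then have "b \<le> a" using \<open>b \<le> d\<close> 3 by (metis le_less less_sc_iff)
        then have "{p. fst p < b \<and> e b p \<noteq> e d p} = {p. fst p < b \<and> e b p \<noteq> e a p}"
          using ag by (auto simp: agree_def)
        then show ?thesis using ia \<open>b \<le> a\<close> by (simp add: inv_def)
      qed simp
    qed
  qed
qed

sublocale coherent_tree K e
proof
  show "finite {p. fst p < a \<and> e a p \<noteq> e b p}" if "a \<le> b" for a b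
    using inv_all[of b] that by (simp add: inv_def)
  show "ok (e a) (a, 0)" for a using inv_all[of a] by (simp add: inv_def)
  show "e (sc a) (a, n) = 1" for a n by (simp add: e_sc_unfold)
qed

end

section \<open>Genericity of the constructed tree\<close>

context proxy_seq
begin

lemma small_below: "small K {l. below (a :: 'k) l}"
proof -
  have "small K (UNIV :: nat set)" "small K (UNIV :: int set)" by (rule small_countable, simp)+
  then have "small K (lists (({..<a} \<times> (UNIV :: nat set)) \<times> (UNIV :: int set)))"
    using small_lessThan[of a] by (intro small_lists small_Times)
  moreover have "{l. below a l} \<subseteq> lists (({..<a} \<times> (UNIV :: nat set)) \<times> (UNIV :: int set))"
    by (auto simp: below_def)
  ultimately show ?thesis by (rule small_subset)
qed

lemma node_repr: "node e c u \<Longrightarrow> \<exists>l. below c l \<and> agree c u (overwrite l (e c))"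
  unfolding node_def by (rule overwrite_repr)

lemma node_overwrite:
  assumes "node e c m"
  shows "node e c (overwrite l m)"
proof (rule node_change[OF assms])
  show "finite {p. fst p < c \<and> overwrite l m p \<noteq> m p}"
  proof (rule finite_subset)
    show "{p. fst p < c \<and> overwrite l m p \<noteq> m p} \<subseteq> fst ` set l"
      by (auto simp: overwrite_def map_of_eq_None_iff split: option.splits)
  qed simp
qed

lemma consec_node:
  assumes d: "d \<in> acc UNIV" and cb: "consec d c b"
  shows "good (e d) c b (e b) (pick e (e d) c b)" "agree b (pick e (e d) c b) (e d)"
  using consec_good[OF d inv_all cb] by blast+

text \<open>Begin as in \<open>ex_start\<close>, apply the modification \<open>l\<close>, follow a
  nice extension into the guessed set, and undo \<open>l\<close>. As \<open>l\<close> acts below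
  \<open>c\<close>, undoing it shifts the depths from \<open>sc c\<close> on by a constant. Niceness
  is relative, so these depths stay at least \<open>1\<close> and no second zero arises.\<close>

lemma ex_good_hit:
  assumes d: "d \<in> acc UNIV" and cb: "consec d c b" and lim: "b \<in> acc UNIV"
    and l: "below c l" "(bt, l, False) \<in> N b"
    and U: "\<And>a u. a < b \<Longrightarrow> node e a u \<Longrightarrow> \<exists>a' u' l'. a < a' \<and> a' < b \<and> node e a' u' \<and> agree a u u' \<and> nice a a' u' \<and>
       below a' l' \<and> agree a' u' (overwrite l' (e a')) \<and> (a', l', True) \<in> N b"
  shows "\<exists>m. good (e d) c b (e b) m \<and> hits e c b m"
proof -
  have "c < b" "b < d" using cb C_less[OF d] by (auto simp: consec_def)
  then have "c < d" by simp
  have nd: "node e c (e d)" using \<open>c < d\<close> by (intro node_e) simp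
  have pos: "0 \<le> dep (e d) (c, 0)" using inv_all[of d] \<open>c < d\<close> by (simp add: inv_def)
  obtain m k where m: "agree c (e d) m" "dep m (c, k) = 0" "dep m (sc c, 0) = 1"
     "\<And>p. (c, 0) \<le> p \<and> p \<le> (sc c, 0) \<and> p \<noteq> (c, k) \<Longrightarrow> 0 < dep m p" "finite {n. m (c, n) \<noteq> 1}"
    using ex_start[OF node_ok[OF nd] pos] by blast
  have c_sc: "c \<le> sc c" using sc_gt[of c] by simp
  have nm: "node e (sc c) m"
  proof (rule node_change[OF node_paste[OF nd c_sc node_e[of "sc c" "sc c"]]])
    show "finite {p. fst p < sc c \<and> m p \<noteq> (if fst p < c then e d p else e (sc c) p)}"
    proof (rule finite_subset)
      show "{p. fst p < sc c \<and> m p \<noteq> (if fst p < c then e d p else e (sc c) p)} \<subseteq> Pair c ` {n. m (c, n) \<noteq> 1}"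
      proof
        fix p assume p: "p \<in> {p. fst p < sc c \<and> m p \<noteq> (if fst p < c then e d p else e (sc c) p)}"
        obtain a n where an: "p = (a, n)" by (cases p)
        have "\<not> a < c" using p an agreeD[OF m(1), of p] by auto
        then have "a = c" using p an by (simp add: less_sc_iff)
        then show "p \<in> Pair c ` {n. m (c, n) \<noteq> 1}" using p an by (auto simp: e_sc)
      qed
    qed (use m(5) in simp)
  qed simp
  have "sc c < b" using sc_less_limit[OF lim \<open>c < b\<close>] .
  then obtain a u l' where u: "sc c < a" "a < b" "node e a u" "agree (sc c) (overwrite l m) u" "nice (sc c) a u"
      "below a l'" "agree a u (overwrite l' (e a))" "(a, l', True) \<in> N b"
    using U[OF _ node_overwrite[OF nm, of l]] by blast
  define m2 where "m2 p = (if fst p < sc c then m p else u p)" for p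
  have nm2: "node e a m2" unfolding m2_def using nm less_imp_le[OF u(1)] u(3) by (rule node_paste)
  obtain t where t: "node e b t" "agree a m2 t" "nice a b t"
    using extend_nice[OF nm2 less_imp_le[OF u(2)]] by blast
  have ag1: "agree (sc c) m t"
    using agree_mono[OF t(2) less_imp_le[OF u(1)]] by (simp add: agree_def m2_def)
  have d1: "dep t p = dep m p" if "p \<le> (sc c, 0)" for p using agree_dep[OF ag1 that] by simp
  have d2: "1 \<le> dep t p" if "(sc c, 0) \<le> p" "p \<le> (a, 0)" for p
  proof -
    have "dep m2 p - dep u p = dep m2 (sc c, 0) - dep u (sc c, 0)"
      by (rule dep_tail[OF nm2 u(3) _ that]) (simp add: m2_def pos_height_le leD)
    moreover have "dep m2 q = dep t q" if "q \<le> (a, 0)" for q using agree_dep[OF t(2) that] .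
    moreover have "dep u (sc c, 0) \<le> dep u p" using u(5) that unfolding nice_def by blast
    moreover have "(sc c, 0) \<le> (a, 0::nat)" using u(1) by simp
    ultimately show ?thesis using that d1[OF order_refl] m(3) by simp
  qed
  have d3: "1 \<le> dep t p" if "(a, 0) \<le> p" "p \<le> (b, 0)" for p
  proof -
    have "dep t (a, 0) \<le> dep t p" using t(3) that unfolding nice_def by blast
    moreover have "1 \<le> dep t (a, 0)" using u(1) by (intro d2) auto
    ultimately show ?thesis by simp
  qed
  have "good (e d) c b (e b) t"
    unfolding good_def
  proof (intro conjI exI[of _ "(c, k)"] allI impI)
    show "agree c (e d) t" using m(1) agree_mono[OF ag1 c_sc] by (rule agree_trans)
    show "finite {p. fst p < b \<and> t p \<noteq> e b p}" using t(1) by (simp add: node_def)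
    show "ok t (b, 0)" using t(1) by (rule node_ok)
    show "dep t (c, k) = 0" using d1[of "(c, k)"] m(2) sc_gt[of c] by simp
    fix p assume p: "(c, 0) \<le> p \<and> p \<le> (b, 0) \<and> p \<noteq> (c, k)"
    show "0 < dep t p"
    proof (cases "p \<le> (sc c, 0)")
      case True
      then show ?thesis using d1 m(4) p by simp
    next
      case False
      then have "1 \<le> dep t p" using d2[of p] d3[of p] p by (metis linear)
      then show ?thesis by simp
    qed
  qed (use \<open>c < b\<close> in auto)
  moreover have "hits e c b t"
    unfolding hits_def
  proof (intro exI conjI)
    show "(bt, l, False) \<in> N b" "(a, l', True) \<in> N b" "a < b" by fact+
    show "below b l" using l(1) less_imp_le[OF \<open>c < b\<close>] by (rule below_mono)
    show "below b l'" using u(6) less_imp_le[OF u(2)] by (rule below_mono)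
    show "c < a" using sc_gt u(1) by (rule less_trans)
    have "overwrite l t p = u p" if "fst p < a" for p
    proof (cases "fst p < sc c")
      case True
      then have "t p = m p" using ag1 by (simp add: agree_def)
      then have "overwrite l t p = overwrite l m p" by (rule overwrite_cong)
      then show ?thesis using u(4) True by (simp add: agree_def)
    next
      case False
      then have "c \<le> fst p" using c_sc by simp
      then have "overwrite l t p = t p" by (rule overwrite_above[OF l(1)])
      also have "\<dots> = m2 p" using t(2) that by (simp add: agree_def)
      finally show ?thesis using False by (simp add: m2_def)
    qed
    then show "agree a (overwrite l t) (overwrite l' (e a))" using u(7) by (simp add: agree_def)
  qed
  ultimately show ?thesis by blast
qed

text \<open>A node \<open>t\<close> of level \<open>d\<close> is a modification of
  \<open>e d\<close> by a list \<open>l\<close> that ends below \<open>d\<close>. The interval of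
  \<open>C d\<close> before a suitable successor point \<open>b\<close> was filled with
  \<open>l\<close> in mind: the guess at \<open>b\<close> names \<open>l\<close> and describes
  \<open>U\<close> below \<open>b\<close>, so after the modification the branch passes through
  \<open>U\<close>.\<close>

lemma generic_e:
  assumes cong: "\<And>c u u'. U c u \<Longrightarrow> agree c u u' \<Longrightarrow> U c u'"
    and dense: "\<And>c u. node e c u \<Longrightarrow> \<exists>c' u'. c < c' \<and> node e c' u' \<and> agree c u u' \<and> nice c c' u' \<and> U c' u'"
  shows "\<exists>d. \<forall>t. node e d t \<longrightarrow> (\<exists>c<d. U c t)"
proof -
  have "\<exists>c' u'. c < c' \<and> node e c' u' \<and> agree c (overwrite l (e c)) u' \<and> nice c c' u' \<and> U c' u'" for c l
    by (rule dense[OF node_overwrite[OF node_e[OF order_refl]]])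
  then obtain hc hu where h: "\<And>c l. c < hc c l \<and> node e (hc c l) (hu c l) \<and> agree c (overwrite l (e c)) (hu c l) \<and>
      nice c (hc c l) (hu c l) \<and> U (hc c l) (hu c l)" by metis
  have "\<exists>b. \<forall>l\<in>{l. below c l}. hc c l < b" for c by (rule smallD[OF small_below])
  then obtain g where g: "\<And>c l. below c l \<Longrightarrow> hc c l < g c" by (metis mem_Collect_eq)
  have "\<exists>b. \<forall>l\<in>{l. below (sc c) l}. cd (bt, l, False) < b" for c by (rule smallD[OF small_below])
  then obtain g2 where g2: "\<And>c l. below (sc c) l \<Longrightarrow> cd (bt, l, False) < g2 c" by (metis mem_Collect_eq)
  define X where "X l = {(a, l', True) | a l'. U a (overwrite l' (e a))} \<union> {(bt, l, False)}" for l
  \<comment> \<open>Closure under \<open>g\<close> ensures that nodes below height \<open>b\<close>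
    have extensions in \<open>U\<close> still below \<open>b\<close>, so that a segment ending at
    \<open>b\<close> is able to meet the guessed set.\<close>
  define R where "R l = {b\<in>closed_under g. below b l \<and>
     (\<forall>a l' i. a < b \<longrightarrow> below b l' \<longrightarrow> ((a, l', i) \<in> N b \<longleftrightarrow> (a, l', i) \<in> X l))}" for l
  \<comment> \<open>One set for each modification, placed at the index that codes it. Closure of
    \<open>d\<close> under \<open>g2\<close> will put the relevant index below
    \<open>d\<close>.\<close>
  define B where "B i = (if \<exists>l. i = cd (bt, l, False) then R (SOME l. i = cd (bt, l, False)) else UNIV)" for i
  have BR: "B (cd (bt, l, False)) = R l" for l
  proof -
    have "(SOME l'. cd (bt, l, False) = cd (bt, l', False)) = l"
      using inj_eq[OF inj_cd] by simp
    then show ?thesis by (auto simp: B_def)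
  qed
  have unR: "unbdd (R l)" for l
    unfolding unbdd_def
  proof
    fix y
    have "finite (set l)" by simp
    define r where "r = Max (insert y ((\<lambda>q. fst (fst q)) ` set l))"
    have r: "y \<le> r" "\<And>q. q \<in> set l \<Longrightarrow> fst (fst q) \<le> r" unfolding r_def by auto
    obtain b where b: "b \<in> closed_under (\<lambda>x. max r (g x))"
      "\<forall>a l' i. a < b \<longrightarrow> below b l' \<longrightarrow> ((a, l', i) \<in> N b \<longleftrightarrow> (a, l', i) \<in> X l)"
      using guess[of "\<lambda>x. max r (g x)" "X l"] by blast
    have rb: "r < b" using b(1) by (rule closed_under_gt)
    have "below b l" unfolding below_def using r(2) rb le_less_trans by blast
    moreover have "b \<in> closed_under g" using b(1) by (simp add: closed_under_def)
    ultimately have "b \<in> R l" using b(2) by (simp add: R_def)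
    moreover have "y < b" using r(1) rb by simp
    ultimately show "\<exists>b\<in>R l. y < b" by blast
  qed
  have "unbdd (B i)" for i
  proof (cases "\<exists>l. i = cd (bt, l, False)")
    case False
    then have "B i = UNIV" by (simp add: B_def)
    then show ?thesis unfolding unbdd_def using ex_gt by auto
  qed (use unR in \<open>simp add: B_def\<close>)
  then have "stationary {d. \<forall>i<d. isLub UNIV (nacc (C d) \<inter> B i) d}" by (rule hit_C)
  then obtain d where d: "\<And>i. i < d \<Longrightarrow> isLub UNIV (nacc (C d) \<inter> B i) d" "d \<in> closed_under g2"
    using stationary_closed_under[of "{d. \<forall>i<d. isLub UNIV (nacc (C d) \<inter> B i) d}" g2] by blast
  have lim: "d \<in> acc UNIV" using d(2) by (simp add: closed_under_def)
  have "\<exists>c<d. U c t" if t: "node e d t" for t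
  proof -
    obtain l where l: "below d l" "agree d t (overwrite l (e d))" using node_repr[OF t] by blast
    obtain r where r: "r < d" "below (sc r) l"
    proof -
      obtain o' where "o' < d" using lim by (auto simp: acc_UNIV_iff)
      define r where "r = Max (insert o' ((\<lambda>q. fst (fst q)) ` set l))"
      have "r \<in> insert o' ((\<lambda>q. fst (fst q)) ` set l)" unfolding r_def by (intro Max_in) auto
      then have "r < d" using \<open>o' < d\<close> l(1) by (auto simp: below_def)
      moreover have "below (sc r) l" unfolding below_def less_sc_iff r_def by auto
      ultimately show ?thesis using that by blast
    qed
    define i where "i = cd (bt, l, False)"
    have "i < d" using g2[OF r(2)] closed_underD[OF d(2) r(1)] unfolding i_def by (rule less_trans)
    then have lub: "isLub UNIV (nacc (C d) \<inter> R l) d" using d(1)[of i] BR[of l] by (simp add: i_def)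
    have sub: "nacc (C d) \<inter> R l \<subseteq> {..<d}" using C_less[OF lim] by (auto simp: nacc_def)
    \<comment> \<open>A point of \<open>C d\<close> between \<open>r\<close> and \<open>b\<close>
      forces the predecessor \<open>c\<close> of \<open>b\<close> above \<open>r\<close>, so that
      the list \<open>l\<close> changes nothing from \<open>c\<close> on.\<close>
    obtain b0 where b0: "b0 \<in> C d" "r < b0" using C_cofinal[OF lim r(1)] by blast
    obtain b where b: "b \<in> nacc (C d)" "b \<in> R l" "b0 < b"
      using lub C_less[OF lim b0(1)] unfolding isLub_iff[OF sub] by blast
    have "b \<noteq> bt" using b(3) not_less_bt by blast
    then obtain c where c: "consec d c b" using consec_to[OF lim] b(1) by (auto simp: nacc_def)
    have "b0 \<le> c" using c b0(1) b(3) by (auto simp: consec_def not_less)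
    have limb: "b \<in> acc UNIV" using b(2) by (simp add: R_def closed_under_def)
    have Nb: "(a, l', i) \<in> N b \<longleftrightarrow> (a, l', i) \<in> X l" if "a < b" "below b l'" for a l' i
      using b(2) that by (simp add: R_def)
    have lc: "below c l"
    proof (rule below_mono[OF r(2)])
      show "sc r \<le> c" using sc_le[OF b0(2)] \<open>b0 \<le> c\<close> by simp
    qed
    have lb: "below b l" using b(2) by (simp add: R_def)
    have "bt < b" using \<open>b \<noteq> bt\<close> bt_le[of b] by simp
    have "\<exists>m. good (e d) c b (e b) m \<and> hits e c b m"
    proof (rule ex_good_hit[OF lim c limb lc])
      show "(bt, l, False) \<in> N b" using Nb[OF \<open>bt < b\<close> lb] by (simp add: X_def)
      fix a u assume a: "a < b" "node e a u"
      obtain k where k: "below a k" "agree a u (overwrite k (e a))" using node_repr[OF a(2)] by blast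
      define a' where "a' = hc a k"
      define u' where "u' = hu a k"
      have h': "a < a'" "node e a' u'" "agree a (overwrite k (e a)) u'" "nice a a' u'" "U a' u'"
        using h[of a k] by (simp_all add: a'_def u'_def)
      have "g a < b" using b(2) a(1) by (simp add: R_def closed_under_def)
      with g[OF k(1)] have "a' < b" unfolding a'_def by (rule less_trans)
      obtain l' where l': "below a' l'" "agree a' u' (overwrite l' (e a'))" using node_repr[OF h'(2)] by blast
      have "U a' (overwrite l' (e a'))" using h'(5) l'(2) by (rule cong)
      then have "(a', l', True) \<in> X l" by (auto simp: X_def)
      moreover have "below b l'" using l'(1) less_imp_le[OF \<open>a' < b\<close>] by (rule below_mono)
      ultimately have "(a', l', True) \<in> N b" using Nb \<open>a' < b\<close> by blast
      moreover have "agree a u u'" using k(2) h'(3) by (rule agree_trans)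
      ultimately show "\<exists>a' u' l'. a < a' \<and> a' < b \<and> node e a' u' \<and> agree a u u' \<and> nice a a' u' \<and>
       below a' l' \<and> agree a' u' (overwrite l' (e a')) \<and> (a', l', True) \<in> N b"
        using h' l' \<open>a' < b\<close> by blast
    qed
    then have "hits e c b (pick e (e d) c b)"
      by (intro pick_good(2)) auto
    then have "hits e c b (e d)" using consec_node(2)[OF lim c] by (rule hits_agree)
    then obtain l1 a l' where hh: "(bt, l1, False) \<in> N b" "below b l1" "(a, l', True) \<in> N b" "below b l'"
       "c < a" "a < b" "agree a (overwrite l1 (e d)) (overwrite l' (e a))"
      unfolding hits_def by blast
    \<comment> \<open>\<open>X l\<close> has a single entry with tag \<open>False\<close>, so the
      modification served by this interval is the one belonging to \<open>t\<close>.\<close>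
    have "l1 = l" using Nb[OF \<open>bt < b\<close> hh(2)] hh(1) by (simp add: X_def)
    have "U a (overwrite l' (e a))" using Nb[OF hh(6,4)] hh(3) by (simp add: X_def)
    moreover have "a < d" using hh(6) C_less[OF lim] c by (meson consec_def less_trans)
    have "agree a (overwrite l' (e a)) t"
      using agree_sym[OF hh(7)] agree_sym[OF agree_mono[OF l(2) less_imp_le[OF \<open>a < d\<close>]]]
      unfolding \<open>l1 = l\<close> by (rule agree_trans)
    ultimately have "U a t" by (rule cong)
    with \<open>a < d\<close> show ?thesis by blast
  qed
  then show ?thesis by blast
qed

sublocale tree K e
  by standard (rule generic_e)

end

section \<open>Specialness and Countryman lines\<close>

locale labelled_proxy_seq = proxy_seq K C N cd for K :: "'k::wellorder itself" and C N cd +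
  fixes lab :: "'k \<Rightarrow> 'l"
  assumes lab: "\<And>c d. d \<in> acc UNIV \<Longrightarrow> c \<in> acc (C d) \<Longrightarrow> lab c \<noteq> lab d"
begin

text \<open>\<open>col\<close> records the successive heights from which a node follows the branches \<open>e d\<close>; comparing depths
  there shows that two limit heights with equal colours would have equal labels although one is a limit
  point of the club of the other.\<close>

definition base :: "'k \<Rightarrow> ('k \<times> nat \<Rightarrow> int) \<Rightarrow> 'k" where
  "base d t = (SOME a. a < d \<and> (\<forall>p. a \<le> fst p \<and> fst p < d \<longrightarrow> t p = e d p))"

definition col :: "'k \<Rightarrow> ('k \<times> nat \<Rightarrow> int) \<Rightarrow> (int \<times> 'l) option list" where
  "col = wfrec {(a, b). a < b} (\<lambda>F d t.
     if d \<in> acc UNIV then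
       Some (dep (e d) (base d t, 0), lab d) # (if base d t < d then F (base d t) t else [])
     else if \<exists>a. d = sc a then None # F (SOME a. d = sc a) t
     else [])"

lemma col_unfold: "col d t = (
     if d \<in> acc UNIV then
       Some (dep (e d) (base d t, 0), lab d) # (if base d t < d then col (base d t) t else [])
     else if \<exists>a. d = sc a then None # col (SOME a. d = sc a) t
     else [])"
proof -
  let ?H = "\<lambda>F d t. if d \<in> acc UNIV then
       Some (dep (e d) (base d t, 0), lab d) # (if base d t < d then F (base d t) t else [])
     else if \<exists>a. d = sc a then None # F (SOME a. d = sc a) t
     else []"
  have "col d = ?H (cut col {(a, b). a < b} d) d"
    unfolding col_def by (rule wfrec[OF wf_less_rel])
  moreover have "?H (cut col {(a, b). a < b} d) d t = ?H col d t"
  proof -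
    have "(SOME a. d = sc a) < d" if "\<exists>a. d = sc a"
      using someI_ex[OF that] sc_gt by metis
    then show ?thesis by (simp add: cut_apply)
  qed
  ultimately show ?thesis by simp
qed

lemma col_sc: "col (sc a) t = None # col a t"
  by (subst col_unfold) (simp add: sc_not_limit)

lemma col_limit:
  assumes d: "d \<in> acc UNIV" and t: "node e d t"
  shows "base d t < d" "\<And>p. base d t \<le> fst p \<Longrightarrow> fst p < d \<Longrightarrow> t p = e d p"
    "col d t = Some (dep (e d) (base d t, 0), lab d) # col (base d t) t"
proof -
  let ?M = "{p. fst p < d \<and> t p \<noteq> e d p}"
  obtain o' where "o' < d" using d by (auto simp: acc_UNIV_iff)
  define r where "r = Max (insert o' (fst ` ?M))"
  have fin: "finite (insert o' (fst ` ?M))" using t by (simp add: node_def)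
  have "r \<in> insert o' (fst ` ?M)" unfolding r_def using fin by (intro Max_in) auto
  then have "r < d" using \<open>o' < d\<close> by auto
  moreover have "t p = e d p" if "sc r \<le> fst p" "fst p < d" for p
  proof (rule ccontr)
    assume "t p \<noteq> e d p"
    then have "fst p \<le> r" unfolding r_def using fin that(2) by (intro Max_ge) auto
    then show False using that(1) sc_gt[of r] by (meson leD le_less_trans)
  qed
  ultimately have "\<exists>a. a < d \<and> (\<forall>p. a \<le> fst p \<and> fst p < d \<longrightarrow> t p = e d p)"
    using sc_less_limit[OF d] by blast
  from someI_ex[OF this] have b: "base d t < d \<and> (\<forall>p. base d t \<le> fst p \<and> fst p < d \<longrightarrow> t p = e d p)"
    unfolding base_def .
  then show "base d t < d" "\<And>p. base d t \<le> fst p \<Longrightarrow> fst p < d \<Longrightarrow> t p = e d p" by blast+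
  show "col d t = Some (dep (e d) (base d t, 0), lab d) # col (base d t) t"
    using d b by (subst col_unfold) simp
qed

lemma base_cong:
  assumes "agree d s t"
  shows "base d s = base d t"
proof -
  have "(\<forall>p. a \<le> fst p \<and> fst p < d \<longrightarrow> s p = e d p) \<longleftrightarrow> (\<forall>p. a \<le> fst p \<and> fst p < d \<longrightarrow> t p = e d p)" for a
    using assms by (simp add: agree_def)
  then show ?thesis unfolding base_def by simp
qed

lemma col_cong: "agree d s t \<Longrightarrow> col d s = col d t"
proof (induction d rule: less_induct)
  case (less d)
  have IH: "col a s = col a t" if "a < d" for a
    using less.IH[OF that] agree_mono[OF less.prems less_imp_le[OF that]] by blast
  have "(SOME a. d = sc a) < d" if "\<exists>a. d = sc a"
    using someI_ex[OF that] sc_gt by metis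
  then show ?case
    using IH base_cong[OF less.prems] by (simp add: col_unfold[of d s] col_unfold[of d t])
qed

text \<open>Otherwise all heights from some \<open>y\<close> up to \<open>c\<close> belong to one
  interval of \<open>C d\<close>. The assumption then yields two zeros inside it, while a good
  segment has only one.\<close>

lemma acc_if_zeros_cofinal:
  assumes d: "d \<in> acc UNIV" and c: "c < d" "c \<in> acc UNIV" and "a < c"
    and z: "\<And>y. a \<le> y \<Longrightarrow> y < c \<Longrightarrow> \<exists>z. (y, 0) < z \<and> z < (c, 0) \<and> dep (e d) z = 0"
  shows "c \<in> acc (C d)"
proof (rule ccontr)
  assume "c \<notin> acc (C d)"
  then obtain x where x: "x < c" "\<And>w. w \<in> C d \<Longrightarrow> \<not> (x < w \<and> w < c)"
    using C_closed[OF d c(1) _ \<open>a < c\<close>] by blast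
  define y where "y = max x a"
  have y: "y < c" "a \<le> y" "x \<le> y" using x(1) \<open>a < c\<close> by (auto simp: y_def)
  have "y < d" using y(1) c(1) by (rule less_trans)
  then obtain g b where gb: "consec d g b" "g \<le> y" "y < b" using consec_exists[OF d] by blast
  have "b \<in> C d" using gb(1) by (simp add: consec_def)
  moreover have "x < b" using y(3) gb(3) by simp
  ultimately have "c \<le> b" using x(2)[of b] by (simp add: not_less)
  obtain z0 where z0: "\<forall>p. (g, 0) \<le> p \<and> p \<le> (b, 0) \<and> p \<noteq> z0 \<longrightarrow> 0 < dep (e d) p"
    using good_agree[OF consec_node[OF d gb(1)]] by blast
  have eq: "p = z0" if "(y, 0) < p" "p < (c, 0)" "dep (e d) p = 0" for p
  proof (rule ccontr)
    assume "p \<noteq> z0"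
    moreover have "(g, 0) \<le> p"
    proof -
      have "(g, 0) \<le> (y, 0::nat)" using gb(2) by auto
      then show ?thesis using less_imp_le[OF that(1)] by (rule order_trans)
    qed
    moreover have "p \<le> (b, 0)"
    proof -
      have "(c, 0) \<le> (b, 0::nat)" using \<open>c \<le> b\<close> by auto
      with less_imp_le[OF that(2)] show ?thesis by (rule order_trans)
    qed
    ultimately have "0 < dep (e d) p" using z0 by blast
    with that(3) show False by simp
  qed
  obtain z1 where z1: "(y, 0) < z1" "z1 < (c, 0)" "dep (e d) z1 = 0" using z[OF y(2,1)] by blast
  have "y \<le> fst z1" using less_imp_le[OF z1(1)] by (simp only: pos_height_le)
  have "fst z1 < c" using z1(2) by (simp only: pos_less_height)
  then have w: "sc (fst z1) < c" using c(2) sc_less_limit by blast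
  have "a \<le> sc (fst z1)" using y(2) \<open>y \<le> fst z1\<close> sc_gt[of "fst z1"] by simp
  then obtain z2 where z2: "(sc (fst z1), 0) < z2" "z2 < (c, 0)" "dep (e d) z2 = 0" using z[OF _ w] by blast
  have "z1 < (sc (fst z1), 0)" using sc_gt by (simp only: pos_less_height)
  then have "z1 < z2" using z2(1) by (rule less_trans)
  with z1(1) have "(y, 0) < z2" by (rule less_trans)
  then show False using eq[OF z1] eq[OF _ z2(2,3)] \<open>z1 < z2\<close> by simp
qed

text \<open>For limits \<open>c < d\<close> with equal colours the bases coincide by induction, say
  at \<open>a\<close>. Both branches follow \<open>t\<close> from \<open>a\<close> to
  \<open>c\<close>, and the colours record equal depths at \<open>a\<close>, so the depths agree up
  to \<open>c\<close>. Hence the cofinal zeros of \<open>e c\<close> are zeros of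
  \<open>e d\<close>, \<open>c\<close> is a limit point of \<open>C d\<close>, and the labels should
  differ. Heights of different kinds are told apart by the head of the list.\<close>

lemma col_inject:
  assumes "node e d t" "c \<le> d" "col c t = col d t"
  shows "c = d"
  using assms
proof (induction d arbitrary: c rule: less_induct)
  case (less d)
  show ?case
  proof (rule ccontr)
    assume "c \<noteq> d"
    then have cd: "c < d" using less.prems(2) by simp
    have nc: "node e c t" using less.prems(1,2) by (rule node_mono)
    have IH: "b = a" if "a < d" "b < d" "col a t = col b t" for a b
    proof (cases "a \<le> b")
      case True
      then show ?thesis using less.IH[OF that(2) node_mono[OF less.prems(1)] True that(3)] that(2) by simp
    next
      case False
      then have "b \<le> a" by simp
      then show ?thesis using less.IH[OF that(1) node_mono[OF less.prems(1)] _ that(3)[symmetric]] that(1) by simp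
    qed
    show False
    proof (cases d rule: not_limit_cases)
      case 2
      then show False using cd by blast
    next
      case (3 a)
      then have "col c t = None # col a t" using less.prems(3) by (simp add: col_sc)
      moreover have "\<exists>b. c = sc b"
      proof (cases c rule: not_limit_cases)
        case 1
        then show ?thesis using col_limit(3)[OF 1 nc] calculation by simp
      next
        case 2
        then have "c \<notin> acc UNIV" "\<nexists>b. c = sc b" using sc_gt by (auto simp: acc_UNIV_iff)
        then show ?thesis using calculation by (simp add: col_unfold[of c t])
      qed blast
      then obtain b where b: "c = sc b" by blast
      ultimately have "col a t = col b t" by (simp add: col_sc)
      moreover have "a < d" "b < d" using 3 b cd sc_gt less_trans by blast+
      ultimately have "b = a" using IH by blast
      then show False using 3 b cd by simp
    next
      case 1
      note d = this
      have D: "base d t < d" "\<And>p. base d t \<le> fst p \<Longrightarrow> fst p < d \<Longrightarrow> t p = e d p"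
        "col d t = Some (dep (e d) (base d t, 0), lab d) # col (base d t) t"
        using col_limit[OF d less.prems(1)] by blast+
      have limc: "c \<in> acc UNIV"
      proof (rule ccontr)
        assume "c \<notin> acc UNIV"
        then have "\<forall>v w. col c t \<noteq> Some v # w" by (simp add: col_unfold[of c t])
        then show False using D(3) less.prems(3) by simp
      qed
      have E: "base c t < c" "\<And>p. base c t \<le> fst p \<Longrightarrow> fst p < c \<Longrightarrow> t p = e c p"
        "col c t = Some (dep (e c) (base c t, 0), lab c) # col (base c t) t"
        using col_limit[OF limc nc] by blast+
      have eqs: "dep (e c) (base c t, 0) = dep (e d) (base d t, 0)" "lab c = lab d" "col (base c t) t = col (base d t) t"
        using D(3) E(3) less.prems(3) by simp_all
      define a where "a = base c t"
      have a: "a < c" "base d t = a" using IH[OF _ D(1) eqs(3)] E(1) cd by (auto simp: a_def)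
      have tail: "dep (e c) p = dep (e d) p" if "(a, 0) \<le> p" "p \<le> (c, 0)" for p
      proof -
        have "dep (e c) p - dep (e d) p = dep (e c) (a, 0) - dep (e d) (a, 0)"
        proof (rule dep_tail[OF node_e node_e _ that])
          fix z :: "'k \<times> nat" assume "(a, 0) \<le> z" "z < (c, 0)"
          then have z: "a \<le> fst z" "fst z < c" by (simp_all only: pos_height_le pos_less_height)
          then have "fst z < d" using cd by (meson less_trans)
          then show "e c z = e d z" using D(2)[of z] E(2)[of z] z a by (simp add: a_def)
        qed (use cd in auto)
        then show ?thesis using eqs(1) a by (simp add: a_def)
      qed
      have "c \<in> acc (C d)"
      proof (rule acc_if_zeros_cofinal[OF d cd limc a(1)])
        fix y assume y: "a \<le> y" "y < c"
        obtain z where z: "(y, 0) < z" "z < (c, 0)" "dep (e c) z = 0"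
          using zeros_cofinal_aux[OF limc inv_all y(2)] by blast
        have "(a, 0) \<le> (y, 0::nat)" using y(1) by auto
        then have "(a, 0) \<le> z" using less_imp_le[OF z(1)] by (rule order_trans)
        then have "dep (e d) z = 0" using tail[OF _ less_imp_le[OF z(2)]] z(3) by simp
        with z show "\<exists>z. (y, 0) < z \<and> z < (c, 0) \<and> dep (e d) z = 0" by blast
      qed
      then show False using lab[OF d] eqs(2) by blast
    qed
  qed
qed

lemma col_in_lists: "col d t \<in> lists (insert None (Some ` (UNIV \<times> range lab)))"
proof (induction d rule: less_induct)
  case (less d)
  have "(SOME a. d = sc a) < d" if "\<exists>a. d = sc a"
    using someI_ex[OF that] sc_gt by metis
  then show ?case using less by (subst col_unfold) auto
qed

end

locale labelled_line = labelled_proxy_seq K C N cd lab + tree_line K e x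
  for K :: "'k::wellorder itself" and C N cd and lab :: "'k \<Rightarrow> 'l" and x
begin

section \<open>Colours of pairs and the resulting chains\<close>

type_synonym 'm colour = "('m option list \<times> 'm option list \<times> nat \<times> int \<times> int) set"

text \<open>Heights enter only through \<open>col\<close>, since the positions themselves would
  require too many colours. Along one branch a height can be recovered from its
  \<open>col\<close>.\<close>

definition colour :: "'k \<Rightarrow> 'k \<Rightarrow> (int \<times> 'l) colour" where
  "colour a b = (\<lambda>p. (col (fst p) (x a), col (fst p) (x b), snd p, x a p, x b p)) `
     {p. fst p \<le> a \<and> fst p \<le> b \<and> x a p \<noteq> x b p}"

definition colours :: "(int \<times> 'l) colour set" where
  "colours = {F. finite F \<and> F \<subseteq> lists (insert None (Some ` (UNIV \<times> range lab))) \<times>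
     lists (insert None (Some ` (UNIV \<times> range lab))) \<times> UNIV \<times> UNIV \<times> UNIV}"

lemma colour_in_colours: "colour a b \<in> colours"
proof -
  have "finite {p. fst p < sc (min a b) \<and> x a p \<noteq> x b p}"
    by (intro node_diff node_mono[OF node_x] sc_le) (auto simp: less_sc_iff intro: le_less_trans[OF _ sc_gt])
  moreover have "{p. fst p < sc (min a b) \<and> x a p \<noteq> x b p} = {p. fst p \<le> a \<and> fst p \<le> b \<and> x a p \<noteq> x b p}"
    by (auto simp: less_sc_iff)
  ultimately show ?thesis using col_in_lists by (auto simp: colours_def colour_def)
qed

text \<open>Equal colours give a difference \<open>p'\<close> of \<open>x a'\<close> and
  \<open>x b'\<close> with the same entry. As \<open>x a\<close> and \<open>x a'\<close> agree
  before \<open>p\<close>, their colours at height \<open>fst p\<close> are equal, and injectivity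
  of \<open>col\<close> along \<open>x a'\<close> gives \<open>p' = p\<close>.\<close>

lemma colour_transfer:
  assumes c: "colour a b = colour a' b'" and p: "fst p \<le> a" "fst p \<le> a'" "fst p \<le> b" "fst p \<le> b'"
    and eq: "\<And>r. r < p \<Longrightarrow> x a r = x a' r" and ne: "x a p \<noteq> x b p"
  shows "x a p = x a' p \<and> x b p = x b' p"
proof -
  have "(col (fst p) (x a), col (fst p) (x b), snd p, x a p, x b p) \<in> colour a b"
    unfolding colour_def using p ne by blast
  then obtain p' where p': "fst p' \<le> a'" "col (fst p) (x a) = col (fst p') (x a')" "snd p = snd p'"
      "x a p = x a' p'" "x b p = x b' p'"
    unfolding c unfolding colour_def by blast
  have "agree (fst p) (x a) (x a')"
    unfolding agree_def
  proof (intro allI impI)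
    fix r :: "'k \<times> nat" assume "fst r < fst p"
    then have "r < p" by (cases r; cases p) auto
    then show "x a r = x a' r" by (rule eq)
  qed
  then have "col (fst p) (x a') = col (fst p') (x a')" using p'(2) col_cong by metis
  moreover have "node e a' (x a')" using node_mono[OF node_x less_imp_le[OF sc_gt]] .
  ultimately have "fst p = fst p'"
    using col_inject[OF node_mono[OF \<open>node e a' (x a')\<close>]] p(2) p'(1) by (metis linear)
  with p'(3) have "p = p'" by (simp add: prod_eq_iff)
  with p' show ?thesis by simp
qed

text \<open>The first differences \<open>p\<close> of \<open>x a\<close>, \<open>x a'\<close> and
  \<open>q\<close> of \<open>x b\<close>, \<open>x b'\<close> must coincide. At the smaller one, a
  difference between \<open>x a\<close> and \<open>x b\<close> would transfer to \<open>a'\<close>,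
  \<open>b'\<close> with the same two values, which is impossible; so \<open>x a\<close> equals
  \<open>x b\<close> there, and likewise \<open>x a'\<close> equals \<open>x b'\<close>. Both
  comparisons then concern the same values at the same place.\<close>

lemma colour_monotone:
  assumes c: "colour a b = colour a' b'" and ne: "a \<noteq> a'" "b \<noteq> b'"
  shows "lt A a a' \<longleftrightarrow> lt A b b'"
proof -
  obtain p where p: "fst p \<le> a" "fst p \<le> a'" "\<And>r. r < p \<Longrightarrow> x a r = x a' r" "x a p \<noteq> x a' p"
    using x_first_difference[OF ne(1)] by blast
  obtain q where q: "fst q \<le> b" "fst q \<le> b'" "\<And>r. r < q \<Longrightarrow> x b r = x b' r" "x b q \<noteq> x b' q"
    using x_first_difference[OF ne(2)] by blast
  have le: "fst u \<le> fst v" if "u < v" for u v :: "'k \<times> nat" using that by (cases u; cases v) auto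
  have "p = q"
  proof (rule linorder_cases)
    assume pq: "p < q"
    have h: "fst p \<le> b" "fst p \<le> b'" using le[OF pq] q(1,2) by auto
    have "x a p = x b p" using colour_transfer[OF c p(1,2) h p(3)] p(4) by blast
    moreover have "x a' p = x b' p"
      using colour_transfer[OF c[symmetric] p(2,1) h(2,1) p(3)[symmetric]] p(4) by metis
    ultimately show ?thesis using q(3)[OF pq] p(4) by simp
  next
    assume qp: "q < p"
    have h: "fst q \<le> a" "fst q \<le> a'" using le[OF qp] p(1,2) by auto
    have eq: "x a r = x a' r" if "r < q" for r using that qp p(3) less_trans by blast
    have "x a q = x b q" using colour_transfer[OF c h q(1,2) eq] q(4) by blast
    moreover have "x a' q = x b' q"
      using colour_transfer[OF c[symmetric] h(2,1) q(2,1) eq[symmetric]] q(4) by metis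
    ultimately show ?thesis using p(3)[OF qp] q(4) by simp
  qed
  then have h: "fst p \<le> b" "fst p \<le> b'" using q(1,2) by auto
  have "x a p = x b p" using colour_transfer[OF c p(1,2) h p(3)] p(4) by blast
  moreover have "x a' p = x b' p"
    using colour_transfer[OF c[symmetric] p(2,1) h(2,1) p(3)[symmetric]] p(4) by metis
  moreover have "lt A a a' \<longleftrightarrow> (if fst p \<in> A then x a' p < x a p else x a p < x a' p)"
    using p(3,4) by (rule lexl_iff)
  moreover have "lt A b b' \<longleftrightarrow> (if fst q \<in> A then x b' q < x b q else x b q < x b' q)"
    using q(3,4) by (rule lexl_iff)
  ultimately show ?thesis using \<open>p = q\<close> by simp
qed

lemma chain_if_same_colour:
  "{(a, b). colour a b = F} \<in> Chains (coordinatewise (rel_of (lt A)))"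
proof -
  have "((a, b), (a', b')) \<in> coordinatewise (rel_of (lt A)) \<or> ((a', b'), (a, b)) \<in> coordinatewise (rel_of (lt A))"
    if c: "colour a b = colour a' b'" for a b a' b'
  proof (cases "a = a' \<or> b = b'")
    case True
    then show ?thesis using lexl_total[of "x a" "x a'" A] lexl_total[of "x b" "x b'" A] inj_eq[OF inj_x]
      by (auto simp: coordinatewise_def rel_of_def)
  next
    case False
    then have "lt A a a' \<longleftrightarrow> lt A b b'" "lt A a' a \<longleftrightarrow> lt A b' b" "lt A a a' \<or> lt A a' a"
      using colour_monotone[OF c] colour_monotone[OF c[symmetric]] lexl_total[of "x a" "x a'" A] inj_eq[OF inj_x]
      by auto
    then show ?thesis by (auto simp: coordinatewise_def rel_of_def)
  qed
  then show ?thesis unfolding Chains_def by auto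
qed

end

section \<open>Counting the colours\<close>

lemma (in regular_uncountable) small_insert:
  fixes I :: "'i set"
  assumes "small K I"
  shows "small K (insert i I)"
  unfolding small_def
proof
  fix h :: "'i \<Rightarrow> 'k"
  obtain b where "\<forall>j\<in>I. h j < b" using smallD[OF assms] ..
  then show "\<exists>b. \<forall>j\<in>insert i I. h j < b"
    using sc_gt[of "h i"] by (intro exI[of _ "max b (sc (h i))"]) (auto simp: less_max_iff_disj)
qed

lemma (in regular_uncountable) card_less_if_small:
  assumes "Card_order (le_rel :: 'k rel)" "small K R"
  shows "|R| <o (le_rel :: 'k rel)"
proof (rule ccontr)
  assume "\<not> |R| <o (le_rel :: 'k rel)"
  then have "(le_rel :: 'k rel) \<le>o |R|"
    using assms(1) card_of_Well_order not_ordLess_iff_ordLeq unfolding card_order_on_def by blast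
  moreover have "|UNIV :: 'k set| =o (le_rel :: 'k rel)"
    using card_of_Field_ordIso[OF assms(1)] by simp
  ultimately have "|UNIV :: 'k set| \<le>o |R|" using ordIso_ordLeq_trans by blast
  then obtain g :: "'a \<Rightarrow> 'k" where g: "UNIV \<subseteq> g ` R"
    using card_of_ordLeq2[of "UNIV :: 'k set" R] by auto
  obtain b where b: "\<forall>r\<in>R. g r < b" using smallD[OF assms(2)] ..
  from g obtain r where "r \<in> R" "b = g r" by blast
  with b show False by blast
qed

text \<open>\<open>\<mu>\<close> is the number of colours. It is below \<open>\<kappa>\<close>
  because few labels give few finite sets of data, and every \<open>{..<a}\<close> injects into the
  colours through \<open>col\<close> along \<open>e a\<close>. Hence \<open>\<kappa>\<close> is the
  cardinal successor of \<open>\<mu>\<close>, and the colour classes are the required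
  chains.\<close>

lemma (in labelled_line) countryman_lt:
  assumes co: "Card_order (le_rel :: 'k rel)" and small_lab: "small K (range lab)"
  shows "countryman (le_rel :: 'k rel) (rel_of (lt A))"
proof -
  define Lab where "Lab = insert None (Some ` ((UNIV :: int set) \<times> range lab))"
  have smLab: "small K (lists Lab)"
  proof -
    have "small K (UNIV :: int set)" by (rule small_countable) simp
    then have "small K ((UNIV :: int set) \<times> range lab)" using small_lab by (rule small_Times)
    then have "small K (Some ` ((UNIV :: int set) \<times> range lab))" by (rule small_image)
    then have "small K Lab" unfolding Lab_def by (rule small_insert)
    then show ?thesis by (rule small_lists)
  qed
  define Q where "Q = lists Lab \<times> lists Lab \<times> (UNIV :: nat set) \<times> (UNIV :: int set) \<times> (UNIV :: int set)"
  have "small K Q"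
  proof -
    have "small K (UNIV :: nat set)" "small K (UNIV :: int set)" by (rule small_countable, simp)+
    with smLab show ?thesis unfolding Q_def by (intro small_Times)
  qed
  then have "small K (set ` lists Q)" by (intro small_image small_lists)
  moreover have "colours \<subseteq> set ` lists Q"
  proof
    fix F assume "F \<in> colours"
    then have "finite F" "F \<subseteq> Q" by (simp_all add: colours_def Q_def Lab_def)
    then show "F \<in> set ` lists Q" using finite_list[of F] by force
  qed
  ultimately have "small K colours" by (rule small_subset)
  with co have less: "|colours| <o (le_rel :: 'k rel)" by (rule card_less_if_small)
  have UNIV_k: "|UNIV :: 'k set| =o (le_rel :: 'k rel)"
    using card_of_Field_ordIso[OF co] by simp
  have "|colours| \<le>o |UNIV :: 'k set|"
    using less UNIV_k ordLess_ordIso_trans ordIso_symmetric ordLess_imp_ordLeq by blast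
  \<comment> \<open>The colours are copied into the type \<open>'k\<close>, over which
    \<open>countryman\<close> expects both the cardinal and the index set of the chains.\<close>
  then obtain j :: "(int \<times> 'l) colour \<Rightarrow> 'k" where j: "inj_on j colours"
    using card_of_ordLeq[of colours "UNIV :: 'k set"] by blast
  define \<mu> where "\<mu> = |j ` colours|"
  have jc: "|j ` colours| =o |colours|"
    using j card_of_ordIso[of colours "j ` colours"] ordIso_symmetric unfolding bij_betw_def by blast
  have F\<mu>: "Field \<mu> = j ` colours" by (simp add: \<mu>_def Field_card_of)
  have co\<mu>: "Card_order \<mu>" by (simp add: \<mu>_def card_of_Card_order)
  have "infinite colours"
  proof
    assume "finite colours"
    moreover have "range (\<lambda>n. {([], [], n, 0, 0)}) \<subseteq> colours" by (auto simp: colours_def)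
    ultimately have "finite (range (\<lambda>n. {([] :: (int \<times> 'l) option list, [] :: (int \<times> 'l) option list, n :: nat, 0 :: int, 0 :: int)}))"
      by (rule finite_subset[rotated])
    moreover have "inj (\<lambda>n. {([] :: (int \<times> 'l) option list, [] :: (int \<times> 'l) option list, n :: nat, 0 :: int, 0 :: int)})"
      by (auto simp: inj_def)
    ultimately show False using finite_imageD infinite_UNIV_nat by blast
  qed
  then have inf: "Cinfinite \<mu>"
    using co\<mu> finite_imageD[OF _ j] unfolding cinfinite_def F\<mu> by blast
  have \<mu>_less: "\<mu> <o (le_rel :: 'k rel)" unfolding \<mu>_def using jc less by (rule ordIso_ordLess_trans)
  have le1: "cardSuc \<mu> \<le>o (le_rel :: 'k rel)" using co\<mu> co \<mu>_less by (rule cardSuc_least)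
  have under: "|{..<a}| \<le>o \<mu>" for a :: 'k
  proof -
    define f where "f c = {(col c (e a), [] :: (int \<times> 'l) option list, 0 :: nat, 0 :: int, 0 :: int)}" for c
    have "inj_on f {..<a}"
    proof (rule inj_onI)
      fix c d assume cd: "c \<in> {..<a}" "d \<in> {..<a}" "f c = f d"
      then have eq: "col c (e a) = col d (e a)" by (simp add: f_def)
      have "node e c (e a)" "node e d (e a)" using cd by (auto intro: node_e)
      then show "c = d" using col_inject[of d "e a" c] col_inject[of c "e a" d] eq by (metis linear)
    qed
    moreover have "f ` {..<a} \<subseteq> colours" using col_in_lists by (auto simp: f_def colours_def)
    ultimately have "|{..<a}| \<le>o |colours|" using card_of_ordLeq by blast
    then show ?thesis unfolding \<mu>_def using jc ordIso_symmetric ordLeq_ordIso_trans by blast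
  qed
  have wo: "Well_order (le_rel :: 'k rel)" "Well_order (cardSuc \<mu>)"
    using co cardSuc_Card_order[OF co\<mu>] unfolding card_order_on_def by blast+
  have "\<not> cardSuc \<mu> <o (le_rel :: 'k rel)"
  proof
    assume "cardSuc \<mu> <o (le_rel :: 'k rel)"
    then obtain a :: 'k where a: "cardSuc \<mu> =o Restr le_rel (underS le_rel a)"
      using ordLess_iff_ordIso_Restr[OF wo] by blast
    have "|Field (cardSuc \<mu>)| \<le>o |Field (Restr (le_rel :: 'k rel) (underS le_rel a))|"
      using ordIso_imp_ordLeq[OF a] by (rule card_of_mono2)
    also have "|Field (Restr (le_rel :: 'k rel) (underS le_rel a))| \<le>o |{..<a}|"
      by (rule card_of_mono1) (auto simp: Field_def underS_def le_rel_def)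
    also have "|{..<a}| \<le>o \<mu>" by (rule under)
    finally have "|Field (cardSuc \<mu>)| \<le>o \<mu>" .
    moreover have "|Field (cardSuc \<mu>)| =o cardSuc \<mu>"
      using cardSuc_Card_order[OF co\<mu>] by (rule card_of_Field_ordIso)
    ultimately have "cardSuc \<mu> \<le>o \<mu>" using ordIso_symmetric ordIso_ordLeq_trans by blast
    then show False using cardSuc_greater[OF co\<mu>] not_ordLess_ordLeq by blast
  qed
  then have "(le_rel :: 'k rel) \<le>o cardSuc \<mu>" using not_ordLess_iff_ordLeq[OF wo] by blast
  then have \<kappa>: "(le_rel :: 'k rel) =o cardSuc \<mu>" using le1 ordIso_iff_ordLeq by blast
  have cover: "UNIV \<times> UNIV = (\<Union>i\<in>Field \<mu>. {(a, b). j (colour a b) = i})"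
    using colour_in_colours by (auto simp: F\<mu>)
  have chain: "{(a, b). j (colour a b) = i} \<in> Chains (coordinatewise (rel_of (lt A)))" if i: "i \<in> Field \<mu>" for i
  proof -
    obtain F where F: "F \<in> colours" "i = j F" using i by (auto simp: F\<mu>)
    have "j (colour a b) = i \<longleftrightarrow> colour a b = F" for a b
      using inj_on_eq_iff[OF j colour_in_colours F(1)] F(2) by simp
    then show ?thesis using chain_if_same_colour[of F A] by simp
  qed
  have "|Field (rel_of (lt A))| =o cardSuc \<mu>"
    using UNIV_k \<kappa> unfolding Field_rel_of by (rule ordIso_transitive)
  then show ?thesis
    unfolding countryman_def
  proof (intro conjI exI[of _ \<mu>] exI[of _ "\<lambda>i. {(a, b). j (colour a b) = i}"] ballI)
    show "Linear_order (rel_of (lt A))" using inj_x by (rule Linear_order_lexl)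
    show "Field (rel_of (lt A)) \<times> Field (rel_of (lt A)) = (\<Union>i\<in>Field \<mu>. {(a, b). j (colour a b) = i})"
      using cover by (simp only: Field_rel_of)
  qed (use inf \<kappa> chain in \<open>simp_all only:\<close>)
qed

section \<open>Cardinals\<close>

lemma le_rel_infinite:
  assumes "Card_order (le_rel :: 'k::wellorder rel)" "natLeq <o (le_rel :: 'k rel)"
  shows "infinite (UNIV :: 'k set)"
proof -
  have "natLeq \<le>o |UNIV :: 'k set|"
    using card_of_Field_ordIso[OF assms(1)] assms(2)
    by (metis Field_le_rel ordIso_symmetric ordLess_ordIso_trans ordLess_imp_ordLeq)
  then show ?thesis using infinite_iff_natLeq_ordLeq by blast
qed

lemma small_if_card_less:
  assumes co: "Card_order (le_rel :: 'k::wellorder rel)" and reg: "regularCard (le_rel :: 'k rel)"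
    and inf: "infinite (UNIV :: 'k set)" and less: "|I| <o (le_rel :: 'k rel)"
  shows "small TYPE('k) I"
  unfolding small_def
proof
  fix h :: "'a \<Rightarrow> 'k"
  have "|h ` I| <o (le_rel :: 'k rel)" using card_of_image less by (rule ordLeq_ordLess_trans)
  then have "\<not> |h ` I| =o (le_rel :: 'k rel)" using not_ordLess_ordIso by blast
  then have "\<not> cofinal (h ` I) (le_rel :: 'k rel)" using reg unfolding regularCard_def by auto
  then obtain b where b: "\<forall>i\<in>I. h i \<le> b" unfolding cofinal_iff unbdd_def by (auto simp: not_less)
  have "\<exists>c\<in>Field (le_rel :: 'k rel). b \<noteq> c \<and> (b, c) \<in> le_rel"
    using co inf by (intro infinite_Card_order_limit) auto
  then obtain c where "b \<noteq> c" "b \<le> c" by (auto simp: le_rel_def)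
  then have "b < c" by simp
  then show "\<exists>b. \<forall>i\<in>I. h i < b" using b le_less_trans by blast
qed

lemma regular_uncountable_le_rel:
  assumes co: "Card_order (le_rel :: 'k::wellorder rel)" and reg: "regularCard (le_rel :: 'k rel)"
    and unc: "natLeq <o (le_rel :: 'k rel)"
  shows "regular_uncountable TYPE('k)"
proof
  note sm = small_if_card_less[OF co reg le_rel_infinite[OF co unc]]
  fix a :: 'k
  have "|underS le_rel a| <o (le_rel :: 'k rel)" using co by (intro card_of_underS) auto
  moreover have "underS le_rel a = {..<a}" by (auto simp: underS_def le_rel_def)
  ultimately show "small TYPE('k) {..<a}" by (intro sm) simp
  show "small TYPE('k) (UNIV :: nat set)"
    using ordIso_ordLess_trans[OF card_of_nat unc] by (rule sm)
qed

lemma ex_pairing: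
  assumes "infinite (UNIV :: 'k set)"
  shows "\<exists>pr :: 'k \<times> 'k \<Rightarrow> 'k. inj pr"
proof -
  have "|(UNIV :: 'k set) \<times> (UNIV :: 'k set)| \<le>o |UNIV :: 'k set|"
    using card_of_Times_same_infinite[OF assms] ordIso_imp_ordLeq by blast
  then have "\<exists>f :: 'k \<times> 'k \<Rightarrow> 'k. inj_on f (UNIV \<times> UNIV) \<and> f ` (UNIV \<times> UNIV) \<subseteq> UNIV"
    by (simp only: card_of_ordLeq)
  then show ?thesis by auto
qed

lemma ex_code:
  assumes "infinite (UNIV :: 'k set)"
  shows "\<exists>c :: 'k \<times> 'k mods \<times> bool \<Rightarrow> 'k. inj c"
proof -
  obtain pr :: "'k \<times> 'k \<Rightarrow> 'k" where pr: "inj pr" using ex_pairing[OF assms] ..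
  obtain i :: "nat \<Rightarrow> 'k" where i: "inj i" using infinite_countable_subset[OF assms] by blast
  define f :: "('k \<times> nat) \<times> int \<Rightarrow> 'k" where
    "f q = pr (fst (fst q), pr (i (snd (fst q)), i (int_encode (snd q))))" for q
  have f: "q = q'" if "f q = f q'" for q q'
    using that inj_eq[OF pr] inj_eq[OF i] by (simp add: f_def prod_eq_iff int_encode_eq)
  \<comment> \<open>Iterated pairing is shown injective only between lists of equal length, so the
    length is coded separately in \<open>F\<close>.\<close>
  define enc :: "'k mods \<Rightarrow> 'k" where "enc l = foldr (\<lambda>q c. pr (f q, c)) l (i 0)" for l
  have enc: "l = l'" if "length l = length l'" "enc l = enc l'" for l l'
    using that
  proof (induction l l' rule: list_induct2)
    case (Cons q l q' l')
    then show ?case using inj_eq[OF pr] f by (simp add: enc_def)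
  qed simp
  define F where "F u = pr (fst u, pr (pr (i (length (fst (snd u))), enc (fst (snd u))), i (if snd (snd u) then 1 else 0)))"
    for u :: "'k \<times> 'k mods \<times> bool"
  have "inj F"
  proof (rule injI)
    fix u v assume "F u = F v"
    then have "fst u = fst v" "length (fst (snd u)) = length (fst (snd v))" "enc (fst (snd u)) = enc (fst (snd v))"
      "(if snd (snd u) then 1 else 0 :: nat) = (if snd (snd v) then 1 else 0)"
      using inj_eq[OF pr] inj_eq[OF i] by (simp_all add: F_def)
    then show "u = v" using enc[of "fst (snd u)" "fst (snd v)"] by (simp add: prod_eq_iff split: if_splits)
  qed
  then show ?thesis by blast
qed

lemma (in regular_uncountable) ex_guess:
  fixes cd :: "'k \<times> 'k mods \<times> bool \<Rightarrow> 'k"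
  assumes "diamond TYPE('k)" "inj cd"
  shows "\<exists>N :: 'k \<Rightarrow> ('k \<times> 'k mods \<times> bool) set. \<forall>X h. \<exists>b\<in>closed_under h. \<forall>a l i. a < b \<longrightarrow> below b l \<longrightarrow>
    ((a, l, i) \<in> N b \<longleftrightarrow> (a, l, i) \<in> X)"
proof -
  \<comment> \<open>The largest height mentioned anywhere in the code, so that
    \<open>rk c < b\<close> bounds both the ordinal and the modification list by
    \<open>b\<close>.\<close>
  define rk :: "'k \<times> 'k mods \<times> bool \<Rightarrow> 'k" where
    "rk c = Max (insert (fst c) ((\<lambda>q. fst (fst q)) ` set (fst (snd c))))" for c
  have rk: "rk c < b \<longleftrightarrow> fst c < b \<and> below b (fst (snd c))" for c b
    by (simp add: rk_def below_def)
  have "small K {c. rk c < a}" for a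
  proof (rule small_subset)
    have "small K (UNIV :: nat set)" "small K (UNIV :: int set)" "small K (UNIV :: bool set)" by (rule small_countable, simp)+
    then show "small K ({..<a} \<times> lists (({..<a} \<times> (UNIV :: nat set)) \<times> (UNIV :: int set)) \<times> (UNIV :: bool set))"
      using small_lessThan[of a] by (intro small_lists small_Times)
    show "{c. rk c < a} \<subseteq> {..<a} \<times> lists (({..<a} \<times> (UNIV :: nat set)) \<times> (UNIV :: int set)) \<times> (UNIV :: bool set)"
      by (fastforce simp: rk below_def)
  qed
  then obtain N where N: "\<And>X h. \<exists>b\<in>closed_under h. \<forall>c. rk c < b \<longrightarrow> (c \<in> N b \<longleftrightarrow> c \<in> X)"
    using diamond_guess[OF assms] by metis
  show ?thesis
  proof (intro exI[of _ N] allI)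
    fix X and h :: "'k \<Rightarrow> 'k"
    obtain b where b: "b \<in> closed_under h" "\<forall>c. rk c < b \<longrightarrow> (c \<in> N b \<longleftrightarrow> c \<in> X)" using N by blast
    have "(a, l, i) \<in> N b \<longleftrightarrow> (a, l, i) \<in> X" if "a < b" "below b l" for a l i
      using b(2) that rk[of "(a, l, i)" b] by simp
    with b(1) show "\<exists>b\<in>closed_under h. \<forall>a l i. a < b \<longrightarrow> below b l \<longrightarrow> ((a, l, i) \<in> N b \<longleftrightarrow> (a, l, i) \<in> X)" by blast
  qed
qed

lemma (in regular_uncountable) unbdd_range_inj:
  assumes "inj (f :: 'k \<Rightarrow> 'k)"
  shows "unbdd (range f)"
  unfolding unbdd_def
proof
  fix b
  have "\<exists>c. \<forall>v\<in>{..<sc b}. inv_into UNIV f v < c" by (rule smallD[OF small_lessThan])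
  then obtain c where c: "\<And>v. v \<le> b \<Longrightarrow> inv_into UNIV f v < c" by (metis lessThan_iff less_sc_iff)
  have "\<not> f c \<le> b"
  proof
    assume "f c \<le> b"
    then have "inv_into UNIV f (f c) < c" by (rule c)
    then show False using assms by (simp add: inv_f_f)
  qed
  then show "\<exists>a\<in>range f. b < a" by (auto simp: not_le)
qed

section \<open>Order types as labels\<close>

lemma initial_segment_less:
  fixes D :: "'k::wellorder set"
  assumes "Well_order (Restr le_rel D)" "c \<in> D"
  shows "Restr le_rel (D \<inter> {..<c}) <o Restr le_rel D"
proof -
  let ?r = "Restr (le_rel :: 'k rel) D"
  have F: "Field ?r = D" by (auto simp: Field_def le_rel_def)
  have "underS ?r c = D \<inter> {..<c}" using assms(2) by (auto simp: underS_def le_rel_def)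
  moreover have "Restr ?r (D \<inter> {..<c}) = Restr le_rel (D \<inter> {..<c})" by auto
  ultimately show ?thesis
    using underS_Restr_ordLess[OF assms(1), of c] F assms(2) by auto
qed

text \<open>The label of \<^term>\<open>d\<close> codes the order type of \<^term>\<open>C d\<close>.\<close>

lemma ex_label:
  fixes C :: "'k::wellorder \<Rightarrow> 'k set" and \<xi> :: "'x rel"
  assumes C: "\<And>d. d \<in> acc UNIV \<Longrightarrow> Restr le_rel (C d) \<le>o \<xi>"
    and coh: "\<And>c d. c \<in> acc (C d) \<Longrightarrow> C c = C d \<inter> {..<c}"
  shows "\<exists>lab :: 'k \<Rightarrow> 'x option. (\<forall>d. \<forall>c\<in>acc (C d). d \<in> acc UNIV \<longrightarrow> lab c \<noteq> lab d) \<and>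
     range lab \<subseteq> insert None (Some ` Field \<xi>)"
proof -
  let ?P = "\<lambda>d a. a \<in> Field \<xi> \<and> Restr le_rel (C d) =o Restr \<xi> (underS \<xi> a)"
  \<comment> \<open>\<open>None\<close> is left for clubs whose order type is that of no proper
    initial segment of \<open>\<xi>\<close>. For a limit point \<open>c\<close> of
    \<open>C d\<close> it cannot occur, since \<open>C c\<close> is a proper initial segment of
    \<open>C d\<close>.\<close>
  define lab where "lab d = (if \<exists>a. ?P d a then Some (SOME a. ?P d a) else None)" for d
  have some: "?P d a" if "lab d = Some a" for d a
    using that someI_ex[of "?P d"] by (auto simp: lab_def split: if_splits)
  have "lab c \<noteq> lab d" if c: "c \<in> acc (C d)" and d: "d \<in> acc UNIV" for c d
  proof
    assume eq: "lab c = lab d"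
    have limc: "c \<in> acc UNIV" using c by (rule acc_subset_UNIV)
    have wo: "Well_order (Restr le_rel (C d))" "Well_order \<xi>" "Well_order (Restr le_rel (C c))"
      using C[OF d] C[OF limc] ordLeq_Well_order_simp by blast+
    have "c \<in> C d" using c by (simp add: acc_iff)
    then have less: "Restr le_rel (C c) <o Restr le_rel (C d)"
      using initial_segment_less[OF wo(1)] coh[OF c] by simp
    then have "Restr le_rel (C c) <o \<xi>" using C[OF d] by (rule ordLess_ordLeq_trans)
    then obtain a where "?P c a" using ordLess_iff_ordIso_Restr[OF wo(2,3)] by blast
    then have "\<exists>a. ?P c a" by blast
    then have "lab c = Some (SOME a. ?P c a)" unfolding lab_def by (rule if_P)
    then obtain a' where "lab c = Some a'" by blast
    then have "?P c a'" "?P d a'" using some eq by simp_all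
    then have "Restr le_rel (C c) =o Restr le_rel (C d)"
      using ordIso_symmetric ordIso_transitive by blast
    with less show False using not_ordLess_ordIso by blast
  qed
  moreover have "range lab \<subseteq> insert None (Some ` Field \<xi>)"
  proof
    fix v assume "v \<in> range lab"
    then obtain d where "v = lab d" by blast
    then show "v \<in> insert None (Some ` Field \<xi>)" using some[of d] by (cases v) auto
  qed
  ultimately show ?thesis by blast
qed

theorem mainTheorem1:
  fixes \<xi> :: "'x rel"
  assumes "Card_order (le_rel :: 'k::wellorder rel)"
    and "regularCard (le_rel :: 'k rel)"
    and "natLeq <o (le_rel :: 'k rel)"
    and "Well_order \<xi>"
    and "\<xi> \<le>o (le_rel :: 'k rel)"
    and "proxy \<xi> TYPE('k)"
  shows "\<exists>L :: 'k set \<Rightarrow> 'k rel.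
    (\<forall>\<zeta>. Linear_order (L \<zeta>) \<and> |Field (L \<zeta>)| =o (le_rel :: 'k rel) \<and>
         \<not> sigma_scattered (L \<zeta>) \<and> minimal_non_sigma_scattered (L \<zeta>)) \<and>
    (\<forall>\<zeta> \<zeta>'. \<zeta> \<noteq> \<zeta>' \<longrightarrow> \<not> lin_embeds (L \<zeta>) (L \<zeta>')) \<and>
    (\<xi> <o (le_rel :: 'k rel) \<longrightarrow> (\<forall>\<zeta>. countryman (le_rel :: 'k rel) (L \<zeta>)))"
proof -
  have inf: "infinite (UNIV :: 'k set)" using assms(1,3) by (rule le_rel_infinite)
  interpret R: regular_uncountable "TYPE('k)"
    using assms(1-3) by (rule regular_uncountable_le_rel)
  obtain cd :: "'k \<times> 'k mods \<times> bool \<Rightarrow> 'k" where cd: "inj cd" using ex_code[OF inf] ..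
  have "diamond TYPE('k)" using assms(6) by (simp add: proxy_def)
  then obtain N :: "'k \<Rightarrow> ('k \<times> 'k mods \<times> bool) set" where N: "\<forall>X h. \<exists>b\<in>closed_under h. \<forall>a l i. a < b \<longrightarrow> below b l \<longrightarrow>
    ((a, l, i) \<in> N b \<longleftrightarrow> (a, l, i) \<in> X)"
    using R.ex_guess[OF _ cd] by blast
  have "proxy_minus \<xi> TYPE('k)" using assms(6) by (simp add: proxy_def)
  then obtain C :: "'k \<Rightarrow> 'k set" where C:
    "\<forall>\<alpha>\<in>acc UNIV. club_below \<alpha> (C \<alpha>) \<and> Restr le_rel (C \<alpha>) \<le>o \<xi>"
    "\<forall>\<alpha>. \<forall>\<alpha>'\<in>acc (C \<alpha>). C \<alpha>' = C \<alpha> \<inter> {..<\<alpha>'}"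
    "\<forall>B :: 'k \<Rightarrow> 'k set. (\<forall>i. cofinal (B i) le_rel) \<longrightarrow> stationary {\<alpha>. \<forall>i<\<alpha>. isLub UNIV (nacc (C \<alpha>) \<inter> B i) \<alpha>}"
    unfolding proxy_minus_def by blast
  interpret P: proxy_seq "TYPE('k)" C N cd
    using C N cd by unfold_locales (auto simp: cofinal_iff)
  obtain x where x: "\<forall>a. node P.e (R.sc a) (x a)" "\<forall>a b. a < b \<longrightarrow> \<not> agree (R.sc a) (x a) (x b)"
    using P.ex_antichain by blast
  interpret L: tree_line "TYPE('k)" P.e x
    using x by unfold_locales auto
  obtain pr :: "'k \<times> 'k \<Rightarrow> 'k" where pr: "inj pr" using ex_pairing[OF inf] ..
  \<comment> \<open>Every element of \<open>Z\<close> is repeated along a fibre of the pairing. An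
    injective image of the whole type is unbounded, so sets that differ in one element are turned
    into sets that differ unboundedly often.\<close>
  define A where "A Z = pr ` (Z \<times> UNIV)" for Z
  have pr_A: "pr (z, y) \<in> A Z \<longleftrightarrow> z \<in> Z" for z y Z
    using inj_image_mem_iff[OF pr] by (simp add: A_def)
  have un: "unbdd {d. (d \<in> A Z) \<noteq> (d \<in> A Z')}" if ne: "Z \<noteq> Z'" for Z Z'
  proof -
    obtain z where z: "(z \<in> Z) \<noteq> (z \<in> Z')" using ne by blast
    have "inj (\<lambda>y. pr (z, y))" using inj_eq[OF pr] by (simp add: inj_def)
    then have "unbdd (range (\<lambda>y. pr (z, y)))" by (rule R.unbdd_range_inj)
    moreover have "range (\<lambda>y. pr (z, y)) \<subseteq> {d. (d \<in> A Z) \<noteq> (d \<in> A Z')}" using z pr_A by auto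
    ultimately show ?thesis unfolding unbdd_def by blast
  qed
  have ctm: "countryman (le_rel :: 'k rel) (rel_of (L.lt (A Z)))" if less: "\<xi> <o (le_rel :: 'k rel)" for Z
  proof -
    have C1: "\<And>d. d \<in> acc UNIV \<Longrightarrow> Restr le_rel (C d) \<le>o \<xi>" using C(1) by blast
    have C2: "\<And>c d. c \<in> acc (C d) \<Longrightarrow> C c = C d \<inter> {..<c}" using C(2) by blast
    obtain lab :: "'k \<Rightarrow> 'x option" where lab: "\<forall>d. \<forall>c\<in>acc (C d). d \<in> acc UNIV \<longrightarrow> lab c \<noteq> lab d"
      "range lab \<subseteq> insert None (Some ` Field \<xi>)"
      using ex_label[of C \<xi>, OF C1 C2] by blast
    interpret LL: labelled_line "TYPE('k)" C N cd lab x
      using lab(1) by unfold_locales blast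
    have "|Field \<xi>| \<le>o \<xi>" using assms(4) by (rule card_of_least)
    then have "|Field \<xi>| <o (le_rel :: 'k rel)" using less by (rule ordLeq_ordLess_trans)
    then have "small TYPE('k) (Field \<xi>)" by (rule small_if_card_less[OF assms(1,2) inf])
    then have "small TYPE('k) (range lab)"
      using small_subset[OF R.small_insert[OF small_image] lab(2)] by blast
    then show ?thesis by (rule LL.countryman_lt[OF assms(1)])
  qed
  have "|UNIV :: 'k set| =o (le_rel :: 'k rel)" using card_of_Field_ordIso[OF assms(1)] by simp
  moreover have "minimal_non_sigma_scattered (rel_of (L.lt (A Z)))" for Z by (rule L.minimal)
  moreover have "\<not> sigma_scattered (rel_of (L.lt (A Z)))" for Z
    using L.minimal unfolding minimal_non_sigma_scattered_def by blast
  moreover have "Linear_order (rel_of (L.lt (A Z)))" for Z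
    using L.inj_x by (rule Linear_order_lexl)
  moreover have "\<not> lin_embeds (rel_of (L.lt (A Z))) (rel_of (L.lt (A Z')))" if "Z \<noteq> Z'" for Z Z'
    using un[OF that] by (rule L.not_lin_embeds)
  ultimately show ?thesis
    using ctm by (intro exI[of _ "\<lambda>Z. rel_of (L.lt (A Z))"]) simp
qed

end
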